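(* Let $C$ be a minimal tetrahedral curve. Then its Hartshorne-Rao module has diameter two if and only if $C$ is isomorphic to one of the curves \[ (k,k-1,0,0,k-1,k+1)\ \text{ where } k\ge1,\qquad\text{or}\qquad (k,k-2,0,0,k-1,k)\ \text{ where } k\ge2 . \]
   Context: Let $K$ be a field and $R=K[a,b,c,d]$. For integers $a_1,\dots,a_6\ge0$, the tetrahedral curve $(a_1,\dots,a_6)$ is the subscheme $C$ of $\mathbb P^3$ with saturated ideal $(a,b)^{a_1}\cap(a,c)^{a_2}\cap(a,d)^{a_3}\cap(b,c)^{a_4}\cap(b,d)^{a_5}\cap(c,d)^{a_6}$. "Isomorphic" means equal up to a change of coordinates of $\mathbb P^3$ (a permutation of the variables $a,b,c,d$, which permutes the six lines). The Hartshorne-Rao module is $M(C)=\bigoplus_jH^1(\mathbb P^3,\mathcal I_C(j))$; the diameter of a nonzero finite length graded module with first and last non-zero components in degrees $d_1,d_2$ is $d_2-d_1+1$. Minimal means minimal in its even liaison class: the even liaison class of a curve (unmixed one-dimensional subscheme of $\mathbb P^3$) consists of the curves obtained from it by an even number of links by complete intersections, where $C,C'$ are linked by a complete intersection curve $X\supset C\cup C'$ if $I_X:I_C=I_{C'}$ and $I_X:I_{C'}=I_C$; a non-arithmetically Cohen-Macaulay curve $C$ (i.e. $M(C)\ne0$) is minimal if for each $C'$ in its even liaison class $M(C')\cong M(C)(-h)$ with $h\ge0$. For non-arithmetically Cohen-Macaulay tetrahedral curves this is equivalent to S-minimality, which means that none of the following systems holds: (A): $a_1+a_2\ge a_4$,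 $a_1+a_3\ge a_5$, $a_2+a_3\ge a_6$; (B): $a_1+a_4\ge a_2$, $a_1+a_5\ge a_3$, $a_4+a_5\ge a_6$; (C): $a_2+a_4\ge a_1$, $a_2+a_6\ge a_3$, $a_4+a_6\ge a_5$; (D): $a_3+a_5\ge a_1$, $a_3+a_6\ge a_2$, $a_5+a_6\ge a_4$. *)

theory Defs
  imports
    Complex_Main
    "HOL-Library.Poly_Mapping"
    "HOL-Library.Numeral_Type"
    "HOL-Library.Function_Algebras"
    "HOL-Library.Set_Algebras"
    "HOL-Computational_Algebra.Fraction_Field"
begin

text \<open>
  The variables \<open>a, b, c, d\<close> are indexed by the elements \<open>0, 1, 2, 3\<close> of the numeral type \<open>4\<close>.
  Polynomials are finitely supported functions from exponent vectors to coefficients, with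
  convolution as multiplication.
\<close>

type_synonym 'k poly4 = "(4 \<Rightarrow>\<^sub>0 nat) \<Rightarrow>\<^sub>0 'k"

definition Var :: "4 \<Rightarrow> 'k::field poly4" where
  "Var i = Poly_Mapping.single (Poly_Mapping.single i 1) 1"

definition homogeneous :: "int \<Rightarrow> 'k::field poly4 \<Rightarrow> bool" where
  "homogeneous e f \<longleftrightarrow>
     (\<forall>m \<in> Poly_Mapping.keys f. int (\<Sum>i\<in>UNIV. Poly_Mapping.lookup m i) = e)"

text \<open>
  A commutative ring as a module over itself: \<open>ideal.subspace\<close> is the predicate ``is an ideal''
  and \<open>ideal.span\<close> is the ideal generated by a set.
\<close>

interpretation ideal: module "(*) :: 'r::comm_ring_1 \<Rightarrow> 'r \<Rightarrow> 'r"
  by unfold_locales (simp_all add: algebra_simps)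

definition ideal_mult :: "'r::comm_ring_1 set \<Rightarrow> 'r set \<Rightarrow> 'r set" where
  "ideal_mult I J = ideal.span {x * y | x y. x \<in> I \<and> y \<in> J}"

primrec ideal_power :: "'r::comm_ring_1 set \<Rightarrow> nat \<Rightarrow> 'r set" where
  "ideal_power I 0 = UNIV"
| "ideal_power I (Suc n) = ideal_mult I (ideal_power I n)"

definition ideal_quotient :: "'r::comm_ring_1 set \<Rightarrow> 'r set \<Rightarrow> 'r set" where
  "ideal_quotient I J = {f. \<forall>g\<in>J. f * g \<in> I}"

definition prime_ideal :: "'r::comm_ring_1 set \<Rightarrow> bool" where
  "prime_ideal P \<longleftrightarrow> ideal.subspace P \<and> 1 \<notin> P \<and> (\<forall>x y. x * y \<in> P \<longrightarrow> x \<in> P \<or> y \<in> P)"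

definition associated_prime :: "'r::comm_ring_1 set \<Rightarrow> 'r set \<Rightarrow> bool" where
  "associated_prime P I \<longleftrightarrow> prime_ideal P \<and> (\<exists>f. P = {g. g * f \<in> I})"

definition homogeneous_ideal :: "'k::field poly4 set \<Rightarrow> bool" where
  "homogeneous_ideal I \<longleftrightarrow> (\<exists>S. (\<forall>f\<in>S. \<exists>e. homogeneous e f) \<and> I = ideal.span S)"

definition saturated :: "'k::field poly4 set \<Rightarrow> bool" where
  "saturated I \<longleftrightarrow> (\<forall>f. (\<forall>i. \<exists>n. Var i ^ n * f \<in> I) \<longrightarrow> f \<in> I)"

text \<open>
  Closed subschemes of projective three-space are represented by their saturated homogeneous
  ideals. The irreducible closed subsets of the subscheme of a homogeneous ideal \<open>I\<close> correspond
  (reversing inclusions) to the homogeneous primes that contain \<open>I\<close> but not all variables, and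
  the dimension is the maximal length of a chain of these.
\<close>

definition proj_chain :: "'k::field poly4 set \<Rightarrow> nat \<Rightarrow> bool" where
  "proj_chain I n \<longleftrightarrow> (\<exists>Q :: nat \<Rightarrow> 'k poly4 set.
     (\<forall>i\<le>n. prime_ideal (Q i) \<and> homogeneous_ideal (Q i) \<and> (\<exists>v. Var v \<notin> Q i) \<and> I \<subseteq> Q i) \<and>
     (\<forall>i<n. Q i \<subset> Q (Suc i)))"

definition has_proj_dim :: "'k::field poly4 set \<Rightarrow> nat \<Rightarrow> bool" where
  "has_proj_dim I n \<longleftrightarrow> proj_chain I n \<and> \<not> proj_chain I (Suc n)"

text \<open>
  Unmixed of dimension one: all associated primes, embedded ones included, define
  one-dimensional subvarieties.
\<close>

definition is_curve :: "'k::field poly4 set \<Rightarrow> bool" where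
  "is_curve I \<longleftrightarrow> homogeneous_ideal I \<and> saturated I \<and> has_proj_dim I 1 \<and>
     (\<forall>P. associated_prime P I \<longrightarrow> has_proj_dim P 1)"

definition tetrahedral :: "nat \<Rightarrow> nat \<Rightarrow> nat \<Rightarrow> nat \<Rightarrow> nat \<Rightarrow> nat \<Rightarrow> 'k::field poly4 set" where
  "tetrahedral a1 a2 a3 a4 a5 a6 =
     ideal_power (ideal.span {Var 0, Var 1}) a1 \<inter>
     ideal_power (ideal.span {Var 0, Var 2}) a2 \<inter>
     ideal_power (ideal.span {Var 0, Var 3}) a3 \<inter>
     ideal_power (ideal.span {Var 1, Var 2}) a4 \<inter>
     ideal_power (ideal.span {Var 1, Var 3}) a5 \<inter>
     ideal_power (ideal.span {Var 2, Var 3}) a6"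

text \<open>
  The substitution sending the variable \<open>i\<close> to the variable \<open>s i\<close>, for a permutation \<open>s\<close>: the
  coefficient of \<open>m\<close> in the image is the coefficient of \<open>m \<circ> s\<close> in \<open>f\<close>.
\<close>

definition permute_vars :: "(4 \<Rightarrow> 4) \<Rightarrow> 'k::field poly4 \<Rightarrow> 'k poly4" where
  "permute_vars s f = Poly_Mapping.map_key (Poly_Mapping.map_key s) f"

definition isomorphic_curves :: "'k::field poly4 set \<Rightarrow> 'k poly4 set \<Rightarrow> bool" where
  "isomorphic_curves I J \<longleftrightarrow> (\<exists>s. bij s \<and> permute_vars s ` I = J)"

text \<open>
  For a homogeneous ideal \<open>I\<close> with ideal sheaf \<open>F\<close>, the cohomology \<open>H\<^sup>1(F(j))\<close> is computed by the
  Cech complex of the standard affine cover. The sections of \<open>F(j)\<close> over the locus where the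
  variables in \<open>S\<close> do not vanish form the degree \<open>j\<close> part of the localization of \<open>I\<close> at the product
  of these variables, here inside the fraction field of the polynomial ring.
\<close>

definition sheaf_sections ::
    "'k::field poly4 set \<Rightarrow> int \<Rightarrow> 4 set \<Rightarrow> 'k poly4 fract set" where
  "sheaf_sections I j S =
     {Fract g ((\<Prod>i\<in>S. Var i) ^ n) | g n. g \<in> I \<and> homogeneous (j + int (n * card S)) g}"

text \<open>
  The cocycle condition for all triples of indices, repetitions included, makes the cochains
  alternating.
\<close>

definition cech_cocycles ::
    "'k::field poly4 set \<Rightarrow> int \<Rightarrow> (4 \<Rightarrow> 4 \<Rightarrow> 'k poly4 fract) set" where
  "cech_cocycles I j =
     {f. (\<forall>p q. f p q \<in> sheaf_sections I j {p, q}) \<and> (\<forall>p q r. f p q + f q r = f p r)}"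

definition cech_coboundaries ::
    "'k::field poly4 set \<Rightarrow> int \<Rightarrow> (4 \<Rightarrow> 4 \<Rightarrow> 'k poly4 fract) set" where
  "cech_coboundaries I j =
     {\<lambda>p q. h q - h p | h. \<forall>p. h p \<in> sheaf_sections I j {p}}"

text \<open>
  The component \<open>rao I j\<close> consists of the cosets of the coboundaries in the cocycles. Its addition
  is the elementwise addition of sets, its zero is \<open>cech_coboundaries I j\<close>, and
  \<open>rao_smult I j r\<close> is multiplication by a homogeneous polynomial \<open>r\<close> with values in degree \<open>j\<close>,
  \<open>f + B \<mapsto> r f + B'\<close> with \<open>B\<close>, \<open>B'\<close> the coboundaries of the respective degrees.
\<close>

definition rao ::
    "'k::field poly4 set \<Rightarrow> int \<Rightarrow> (4 \<Rightarrow> 4 \<Rightarrow> 'k poly4 fract) set set" where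
  "rao I j = (\<lambda>f. f +o cech_coboundaries I j) ` cech_cocycles I j"

definition rao_smult ::
    "'k::field poly4 set \<Rightarrow> int \<Rightarrow> 'k poly4 \<Rightarrow>
     (4 \<Rightarrow> 4 \<Rightarrow> 'k poly4 fract) set \<Rightarrow> (4 \<Rightarrow> 4 \<Rightarrow> 'k poly4 fract) set" where
  "rao_smult I j r X = (\<lambda>f p q. Fract r 1 * f p q) ` X + cech_coboundaries I j"

definition rao_nonzero :: "'k::field poly4 set \<Rightarrow> int \<Rightarrow> bool" where
  "rao_nonzero I j \<longleftrightarrow> rao I j \<noteq> {cech_coboundaries I j}"

definition has_rao_diameter :: "'k::field poly4 set \<Rightarrow> int \<Rightarrow> bool" where
  "has_rao_diameter I n \<longleftrightarrow> (\<exists>d1 d2. rao_nonzero I d1 \<and> rao_nonzero I d2 \<and>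
     (\<forall>j. rao_nonzero I j \<longrightarrow> d1 \<le> j \<and> j \<le> d2) \<and> n = d2 - d1 + 1)"

text \<open>
  Isomorphism of graded modules \<open>M(J) \<cong> M(I)(-h)\<close>, where \<open>M(-h)\<close> has the component of \<open>M\<close> of
  degree \<open>j - h\<close> in degree \<open>j\<close>.
\<close>

definition rao_iso_shift :: "'k::field poly4 set \<Rightarrow> 'k poly4 set \<Rightarrow> int \<Rightarrow> bool" where
  "rao_iso_shift J I h \<longleftrightarrow> (\<exists>\<phi>.
     (\<forall>j. bij_betw (\<phi> j) (rao J j) (rao I (j - h))) \<and>
     (\<forall>j. \<forall>X\<in>rao J j. \<forall>Y\<in>rao J j. \<phi> j (X + Y) = \<phi> j X + \<phi> j Y) \<and>
     (\<forall>j e r. homogeneous e r \<longrightarrow> (\<forall>X\<in>rao J j.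
        \<phi> (j + e) (rao_smult J (j + e) r X) = rao_smult I (j + e - h) r (\<phi> j X))))"

definition complete_intersection_curve :: "'k::field poly4 set \<Rightarrow> bool" where
  "complete_intersection_curve X \<longleftrightarrow> is_curve X \<and>
     (\<exists>F G d e. homogeneous d F \<and> homogeneous e G \<and> X = ideal.span {F, G})"

definition linked :: "'k::field poly4 set \<Rightarrow> 'k poly4 set \<Rightarrow> bool" where
  "linked I J \<longleftrightarrow> is_curve I \<and> is_curve J \<and>
     (\<exists>X. complete_intersection_curve X \<and> X \<subseteq> I \<inter> J \<and>
          ideal_quotient X I = J \<and> ideal_quotient X J = I)"

definition evenly_linked :: "'k::field poly4 set \<Rightarrow> 'k poly4 set \<Rightarrow> bool" where
  "evenly_linked I J \<longleftrightarrow> (\<exists>n. even n \<and> (linked ^^ n) I J)"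

text \<open>The second conjunct says that the curve is not arithmetically Cohen--Macaulay.\<close>

definition minimal_curve :: "'k::field poly4 set \<Rightarrow> bool" where
  "minimal_curve I \<longleftrightarrow> is_curve I \<and> (\<exists>j. rao_nonzero I j) \<and>
     (\<forall>J. evenly_linked I J \<longrightarrow> (\<exists>h\<ge>0. rao_iso_shift J I h))"

end

theory Submission
  imports Defs "HOL-Computational_Algebra.Polynomial"
begin

text \<open>
  A tetrahedral curve is given by weights \<open>w\<close> on the edges of a tetrahedron. Its ideal is generated by
  monomials, so the Rao module is graded by exponent vectors \<open>m\<close>; the component of degree \<open>m\<close> is the
  reduced cohomology in degree 0 of the complex of edges \<open>{i, j}\<close> with \<open>m k + m l < w k l\<close> for the
  opposite edge \<open>{k, l}\<close>. It is nonzero exactly if this complex consists of two opposite edges.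

  If \<open>w x y \<le> w v x + w v y\<close> for all \<open>x, y\<close> and some vertex \<open>v\<close>, then \<open>I = v J + (F)\<close>, where \<open>J\<close>
  lowers the weights at \<open>v\<close> by one and \<open>F\<close> is the product of the \<open>x ^ w v x\<close>. Two links, by \<open>(F, v G)\<close> and
  \<open>(F, G)\<close> for a product \<open>G\<close> of linear forms, lead from \<open>I\<close> to \<open>J\<close>, and the Rao module is shifted
  downwards, so \<open>I\<close> is not minimal. The duality \<open>X : (X : J) = J\<close> needed for this is checked at the
  prime of each line, where it follows from the position of the socle of a complete intersection of
  two binary forms.

  Hence, for a minimal curve, one pair of opposite edges \<open>p q\<close>, \<open>r s\<close> dominates the other edges, and
  the degrees of the Rao module are the integers from
  \<open>max (w p r + w q s) (w p s + w q r)\<close> to \<open>w p q + w r s - 2\<close>.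
\<close>

text \<open>The sums \<open>Var i + Var j\<close> replace them: they exist over every field, are
  divisible by no variable, and with either of their two variables they generate the ideal of the
  same line. Even linkage also demands that the residual scheme and the lowered one be curves in the
  sense of chains of primes. Primary decomposition is avoided by two conditions: every annihilator
  modulo the ideal lies in the prime of a line, which passes to colon ideals, and every prime above
  the ideal contains the prime of a line. The end degrees of the Rao module come from adding
  inequalities: two lower bounds on complementary pairs of exponents give the initial degree, two
  strict upper bounds the final one. Diameter two then leaves so little slack in the four dominance
  inequalities that one opposite pair of small weights vanishes and the other two differ by at most
  one.\<close>

section \<open>Monomial ideals and powers of line ideals\<close>

text \<open>This simplification rule reads \<open>a * (b * x) = (a * b) * x\<close> and makes \<open>mult.assoc\<close> loop.\<close>

declare ideal.scale_scale [simp del]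

abbreviation lk :: "('a \<Rightarrow>\<^sub>0 'b::zero) \<Rightarrow> 'a \<Rightarrow> 'b" where "lk \<equiv> Poly_Mapping.lookup"
abbreviation mon :: "'a \<Rightarrow> 'b::zero \<Rightarrow> ('a \<Rightarrow>\<^sub>0 'b)" where "mon \<equiv> Poly_Mapping.single"
abbreviation keys :: "('a \<Rightarrow>\<^sub>0 'b::zero) \<Rightarrow> 'a set" where "keys \<equiv> Poly_Mapping.keys"

lemma UNIV_4: "(UNIV :: 4 set) = {0, 1, 2, 3}"
proof -
  have "\<exists>i::4. i \<notin> {0, 1, 2, 3} \<Longrightarrow> False"
  proof -
    have c: "card (UNIV :: 4 set) = 4" by simp
    assume "\<exists>i::4. i \<notin> {0, 1, 2, 3}"
    then obtain i :: 4 where "i \<notin> {0, 1, 2, 3}" by blast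
    then have "card {i, 0, 1, 2, 3::4} = 5" by simp
    moreover have "card {i, 0, 1, 2, 3} \<le> card (UNIV :: 4 set)" by (intro card_mono) auto
    ultimately show False by simp
  qed
  then show ?thesis by blast
qed

lemma UNIV_distinct4:
  fixes p q r s :: 4
  assumes "distinct [p, q, r, s]"
  shows "UNIV = {p, q, r, s}"
proof -
  have "card {p, q, r, s} = card (UNIV :: 4 set)" using assms by simp
  then show ?thesis by (metis card_subset_eq finite subset_UNIV)
qed

lemma sum_distinct4:
  fixes p q r s :: 4 and f :: "4 \<Rightarrow> 'a::comm_monoid_add"
  assumes "distinct [p, q, r, s]"
  shows "sum f UNIV = f p + f q + f r + f s"
  unfolding UNIV_distinct4[OF assms] using assms by (simp add: add.assoc)

lemma complete2_distinct4:
  fixes p q :: 4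
  assumes "p \<noteq> q"
  obtains r s where "distinct [p, q, r, s]"
proof -
  have "card (UNIV - {p, q}) = 2" using assms by (simp add: card_Diff_subset)
  then obtain r s where "UNIV - {p, q} = {r, s}" "r \<noteq> s" by (auto simp: card_2_iff)
  then have "distinct [p, q, r, s]" using assms by auto
  then show ?thesis by (rule that)
qed

lemma keys_multD:
  fixes f g :: "'k::field poly4"
  assumes "m \<in> keys (f * g)"
  shows "\<exists>a\<in>keys f. \<exists>b\<in>keys g. m = a + b"
  using assms keys_mult[of f g] by blast

lemma poly_sum_monomials: "(f :: 'k::field poly4) = (\<Sum>m\<in>keys f. mon m (lk f m))"
  by (rule poly_mapping_eqI) (simp add: lookup_sum lookup_single when_def in_keys_iff)

lemma poly_monomials_induct [case_names zero mono add]: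
  fixes f :: "'k::field poly4"
  assumes "P 0" "\<And>m. m \<in> keys f \<Longrightarrow> P (mon m (lk f m))" "\<And>f g. P f \<Longrightarrow> P g \<Longrightarrow> P (f + g)"
  shows "P f"
proof -
  have "P (\<Sum>m\<in>A. mon m (lk f m))" if "A \<subseteq> keys f" "finite A" for A
    using that(2,1) by (induction A rule: finite_induct) (auto intro: assms)
  from this[of "keys f"] show ?thesis using poly_sum_monomials[of f] by simp
qed

lemma mono_split:
  fixes m n :: "4 \<Rightarrow>\<^sub>0 nat" and c :: "'k::field"
  assumes "\<And>i. lk n i \<le> lk m i"
  shows "mon m c = mon n 1 * mon (m - n) c"
proof -
  have "m = n + (m - n)" by (rule poly_mapping_eqI) (simp add: lookup_add lookup_minus assms)
  then show ?thesis by (metis mult_1 mult_single)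
qed

lemma mono_Var:
  fixes c :: "'k::field"
  assumes "lk m i > 0"
  shows "mon m c = Var i * mon (m - mon i 1) c"
  unfolding Var_def using assms by (intro mono_split) (auto simp: lookup_single when_def)

lemma lookup_mono_mult:
  fixes f :: "'k::field poly4"
  shows "lk (mon m c * f) (m + n) = c * lk f n"
proof (rule poly_monomials_induct[of _ f])
  fix a show "lk (mon m c * mon a (lk f a)) (m + n) = c * lk (mon a (lk f a)) n"
    by (simp add: mult_single lookup_single when_def)
qed (simp_all add: algebra_simps lookup_add)

text \<open>Membership depends on the support only, so inclusions can be tested exponent by
  exponent. The set is an ideal once \<open>S\<close> absorbs addition of exponents.\<close>

definition mon_ideal :: "(4 \<Rightarrow>\<^sub>0 nat) set \<Rightarrow> 'k::field poly4 set" where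
  "mon_ideal S = {f. keys f \<subseteq> S}"

lemma mono_in_mon_ideal: "mon m c \<in> mon_ideal S \<longleftrightarrow> c = 0 \<or> m \<in> S"
  by (simp add: mon_ideal_def)

lemma subspace_mon_ideal:
  assumes "\<And>m n. m \<in> S \<Longrightarrow> m + n \<in> S"
  shows "ideal.subspace (mon_ideal S :: 'k::field poly4 set)"
  unfolding ideal.subspace_def mon_ideal_def
proof (intro conjI ballI allI)
  fix c x :: "'k poly4" assume x: "x \<in> {f. keys f \<subseteq> S}"
  have "keys (c * x) \<subseteq> S"
  proof
    fix m assume "m \<in> keys (c * x)"
    then obtain a b where "b \<in> keys x" "m = a + b" using keys_multD by blast
    then show "m \<in> S" using x assms[of b a] by (auto simp: add.commute)
  qed
  then show "c * x \<in> {f. keys f \<subseteq> S}" by simp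
next
  fix x y :: "'k poly4" assume "x \<in> {f. keys f \<subseteq> S}" "y \<in> {f. keys f \<subseteq> S}"
  then show "x + y \<in> {f. keys f \<subseteq> S}" using keys_add[of x y] by auto
qed auto

lemma mon_ideal_subset_iff:
  assumes "ideal.subspace I"
  shows "mon_ideal S \<subseteq> I \<longleftrightarrow> (\<forall>m\<in>S. \<forall>c. mon m c \<in> I)"
proof (intro iffI ballI allI)
  fix m c assume "mon_ideal S \<subseteq> I" "m \<in> S"
  then show "mon m c \<in> I" by (auto simp: mono_in_mon_ideal subset_iff)
next
  assume *: "\<forall>m\<in>S. \<forall>c. mon m c \<in> I"
  show "mon_ideal S \<subseteq> I"
  proof
    fix f :: "'a poly4" assume f: "f \<in> mon_ideal S"
    show "f \<in> I"
    proof (rule poly_monomials_induct[of _ f])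
      show "0 \<in> I" using assms by (simp add: ideal.subspace_0)
    next
      fix m assume "m \<in> keys f"
      then show "mon m (lk f m) \<in> I" using * f by (auto simp: mon_ideal_def)
    qed (use assms in \<open>auto intro: ideal.subspace_add\<close>)
  qed
qed

abbreviation line_power :: "4 \<Rightarrow> 4 \<Rightarrow> nat \<Rightarrow> 'k::field poly4 set" where
  "line_power i j n \<equiv> mon_ideal {m. n \<le> lk m i + lk m j}"

lemma subspace_line_power: "ideal.subspace (line_power i j n)"
  by (rule subspace_mon_ideal) (simp add: lookup_add)

lemma Var_line_power: "Var i \<in> line_power i j 1" "Var j \<in> line_power i j 1"
  by (auto simp: Var_def mono_in_mon_ideal)

lemma line_power_mult:
  assumes "f \<in> line_power i j a" "g \<in> line_power i j b"
  shows "f * g \<in> line_power i j (a + b)"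
  unfolding mon_ideal_def
proof (intro CollectI subsetI)
  fix m assume "m \<in> keys (f * g)"
  then obtain x y where "x \<in> keys f" "y \<in> keys g" "m = x + y" using keys_multD by blast
  then have "a \<le> lk x i + lk x j" "b \<le> lk y i + lk y j" using assms by (auto simp: mon_ideal_def)
  then show "a + b \<le> lk m i + lk m j" unfolding \<open>m = x + y\<close> lookup_add by linarith
qed

lemma line_power_mono: "a \<le> b \<Longrightarrow> f \<in> line_power i j b \<Longrightarrow> f \<in> line_power i j a"
  by (auto simp: mon_ideal_def)

text \<open>A monomial of degree at least \<open>Suc n\<close> in the two variables is divisible by
  one of them, and the quotient still has degree at least \<open>n\<close>; this peels off one
  factor of the power.\<close>

lemma ideal_power_line:
  assumes "i \<noteq> j"
  shows "ideal_power (ideal.span {Var i, Var j}) n = line_power i j n"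
proof (induction n)
  case 0
  then show ?case by (simp add: mon_ideal_def)
next
  case (Suc n)
  have gen: "ideal.span {Var i, Var j} \<subseteq> line_power i j 1"
    by (rule ideal.span_minimal) (auto simp: subspace_line_power Var_line_power[simplified])
  have "ideal_mult (ideal.span {Var i, Var j}) (line_power i j n) \<subseteq> line_power i j (Suc n)"
    unfolding ideal_mult_def
    using gen line_power_mult[where i = i and j = j and a = 1 and b = n]
    by (intro ideal.span_minimal subspace_line_power) fastforce
  moreover have "line_power i j (Suc n) \<subseteq> ideal_mult (ideal.span {Var i, Var j}) (line_power i j n)"
    (is "_ \<subseteq> ?J")
  proof -
    have sub: "ideal.subspace ?J" by (simp add: ideal_mult_def)
    have *: "mon m c \<in> ?J" if "Suc n \<le> lk m i + lk m j" for m c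
    proof -
      have "lk m i > 0 \<or> lk m j > 0" using that by linarith
      then obtain k where k: "k = i \<or> k = j" "lk m k > 0" by blast
      have "mon (m - mon k 1) c \<in> line_power i j n"
        using that k assms by (auto simp: mono_in_mon_ideal lookup_minus lookup_single when_def)
      moreover have "Var k \<in> ideal.span {Var i, Var j}" using k by (auto intro: ideal.span_base)
      ultimately show ?thesis
        unfolding mono_Var[OF k(2), of c] ideal_mult_def by (intro ideal.span_base) blast
    qed
    show ?thesis by (subst mon_ideal_subset_iff[OF sub]) (auto intro: *)
  qed
  ultimately show ?case using Suc by auto
qed

section \<open>Tetrahedral ideals in terms of edge weights\<close>

definition tetra :: "(4 \<Rightarrow> 4 \<Rightarrow> nat) \<Rightarrow> 'k::field poly4 set" where
  "tetra w = mon_ideal {m. \<forall>i j. i \<noteq> j \<longrightarrow> w i j \<le> lk m i + lk m j}"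

text \<open>Comparing unordered pairs builds the symmetry in. The final branch serves
  \<open>{2, 3}\<close> and is the default on the diagonal.\<close>

definition edge_weights :: "nat \<Rightarrow> nat \<Rightarrow> nat \<Rightarrow> nat \<Rightarrow> nat \<Rightarrow> nat \<Rightarrow> 4 \<Rightarrow> 4 \<Rightarrow> nat" where
  "edge_weights a1 a2 a3 a4 a5 a6 i j =
    (if {i, j} = {0, 1} then a1 else if {i, j} = {0, 2} then a2 else if {i, j} = {0, 3} then a3
     else if {i, j} = {1, 2} then a4 else if {i, j} = {1, 3} then a5 else a6)"

lemma edge_weights_sym: "edge_weights a1 a2 a3 a4 a5 a6 i j = edge_weights a1 a2 a3 a4 a5 a6 j i"
  by (simp add: edge_weights_def insert_commute)

lemma subspace_tetra: "ideal.subspace (tetra w)"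
  unfolding tetra_def by (rule subspace_mon_ideal) (fastforce simp: lookup_add)

lemma all_4: "(\<forall>i::4. P i) \<longleftrightarrow> P 0 \<and> P 1 \<and> P 2 \<and> P 3"
  using UNIV_4 by (metis UNIV_I empty_iff insert_iff)

lemma tetrahedral_eq_tetra: "tetrahedral a1 a2 a3 a4 a5 a6 = tetra (edge_weights a1 a2 a3 a4 a5 a6)"
  unfolding tetrahedral_def tetra_def
  by (auto simp: ideal_power_line mon_ideal_def all_4 edge_weights_def doubleton_eq_iff add.commute subset_iff)

lemma tetra_subset_line_power: "i \<noteq> j \<Longrightarrow> tetra w \<subseteq> line_power i j (w i j)"
  by (auto simp: tetra_def mon_ideal_def)

lemma tetraI: "(\<And>i j. i \<noteq> j \<Longrightarrow> f \<in> line_power i j (w i j)) \<Longrightarrow> f \<in> tetra w"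
  unfolding tetra_def mon_ideal_def by blast

section \<open>Gradings and substitutions\<close>

text \<open>The weight is a parameter because two gradings are needed: the total degree
  \<open>tdeg\<close> for homogeneity of curves, and the degree \<open>line_deg\<close> in two
  variables for the analysis along a line.\<close>

definition graded_form :: "((4 \<Rightarrow>\<^sub>0 nat) \<Rightarrow> nat) \<Rightarrow> nat \<Rightarrow> 'k::field poly4 \<Rightarrow> bool" where
  "graded_form wt d f \<longleftrightarrow> (\<forall>m\<in>keys f. wt m = d)"

definition graded_part :: "((4 \<Rightarrow>\<^sub>0 nat) \<Rightarrow> nat) \<Rightarrow> nat \<Rightarrow> 'k::field poly4 \<Rightarrow> 'k poly4" where
  "graded_part wt d f = (\<Sum>m\<in>{m \<in> keys f. wt m = d}. mon m (lk f m))"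

lemma lookup_graded_part: "lk (graded_part wt d f) m = (if wt m = d then lk f m else 0)"
  by (auto simp: graded_part_def lookup_sum lookup_single when_def in_keys_iff)

lemma keys_graded_part: "keys (graded_part wt d f) = {m \<in> keys f. wt m = d}"
  by (auto simp: in_keys_iff lookup_graded_part split: if_splits)

lemma graded_part_add: "graded_part wt d (f + g) = graded_part wt d f + graded_part wt d g"
  by (rule poly_mapping_eqI) (simp add: lookup_graded_part lookup_add)

lemma graded_form_graded_part: "graded_form wt d (graded_part wt d f)"
  by (simp add: graded_form_def keys_graded_part)

lemma graded_part_graded_form: "graded_form wt e f \<Longrightarrow> graded_part wt d f = (if d = e then f else 0)"
  by (rule poly_mapping_eqI) (auto simp: lookup_graded_part graded_form_def in_keys_iff)

lemma sum_graded_part: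
  assumes "\<And>m. m \<in> keys f \<Longrightarrow> wt m < n"
  shows "f = (\<Sum>d<n. graded_part wt d f)"
proof (rule poly_mapping_eqI)
  fix m
  show "lk f m = lk (\<Sum>d<n. graded_part wt d f) m"
    using assms[of m] by (auto simp: lookup_sum lookup_graded_part in_keys_iff)
qed

lemma keys_bounded: "\<exists>n. \<forall>m\<in>keys f. wt m < (n::nat)"
proof -
  have "finite (wt ` keys f)" by simp
  then obtain n where "\<forall>x\<in>wt ` keys f. x < n"
    using finite_nat_set_iff_bounded by blast
  then show ?thesis by auto
qed

locale grading =
  fixes wt :: "(4 \<Rightarrow>\<^sub>0 nat) \<Rightarrow> nat"
  assumes wt_add: "wt (m + n) = wt m + wt n"
begin

lemma wt_zero: "wt 0 = 0"
  using wt_add[of 0 0] by simp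

lemma graded_form_mult: "graded_form wt d f \<Longrightarrow> graded_form wt e g \<Longrightarrow> graded_form wt (d + e) (f * g)"
  unfolding graded_form_def
proof (intro ballI)
  fix m assume *: "\<forall>m\<in>keys f. wt m = d" "\<forall>m\<in>keys g. wt m = e" and "m \<in> keys (f * g)"
  then obtain a b where "a \<in> keys f" "b \<in> keys g" "m = a + b" using keys_multD by blast
  with * show "wt m = d + e" by (simp add: wt_add)
qed

lemma graded_form_one: "graded_form wt 0 1"
  by (simp add: graded_form_def wt_zero)

lemma graded_form_prod_list: "(\<And>l. l \<in> set ls \<Longrightarrow> graded_form wt 1 l) \<Longrightarrow> graded_form wt (length ls) (prod_list ls)"
proof (induction ls)
  case (Cons l ls)
  then show ?case using graded_form_mult[of 1 l "length ls" "prod_list ls"] by simp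
qed (simp add: graded_form_one)

lemma graded_part_mult_hom:
  assumes g: "graded_form wt e g"
  shows "graded_part wt d (f * g) = (if d < e then 0 else graded_part wt (d - e) f * g)"
proof (cases "d < e")
  case True
  have "wt m \<noteq> d" if m: "m \<in> keys (f * g)" for m
  proof -
    obtain a b where "a \<in> keys f" "b \<in> keys g" "m = a + b" using keys_multD[OF m] by blast
    then show ?thesis using g True by (auto simp: wt_add graded_form_def)
  qed
  then have "graded_part wt d (f * g) = 0"
    by (intro poly_mapping_eqI) (auto simp: lookup_graded_part in_keys_iff)
  then show ?thesis using True by simp
next
  case False
  \<comment> \<open>The rest \<open>f'\<close> has no exponent of weight \<open>d - e\<close>, so
    multiplication by a form of weight \<open>e\<close> produces none of weight
    \<open>d\<close>.\<close>
  define f' where "f' = f - graded_part wt (d - e) f"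
  have ff: "f = graded_part wt (d - e) f + f'" by (simp add: f'_def)
  have f': "wt m \<noteq> d - e" if "m \<in> keys f'" for m
    using that by (auto simp: f'_def in_keys_iff lookup_minus lookup_graded_part)
  have "wt m \<noteq> d" if m: "m \<in> keys (f' * g)" for m
  proof -
    obtain a b where "a \<in> keys f'" "b \<in> keys g" "m = a + b" using keys_multD[OF m] by blast
    then show ?thesis using f'[of a] g False by (auto simp: wt_add graded_form_def)
  qed
  then have "graded_part wt d (f' * g) = 0"
    by (intro poly_mapping_eqI) (auto simp: lookup_graded_part in_keys_iff)
  moreover have "graded_part wt d (graded_part wt (d - e) f * g) = graded_part wt (d - e) f * g"
    using graded_form_mult[OF graded_form_graded_part[of wt "d - e" f] g] False by (simp add: graded_part_graded_form)
  ultimately have "graded_part wt d ((graded_part wt (d - e) f + f') * g) = graded_part wt (d - e) f * g"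
    by (simp add: distrib_right graded_part_add)
  then show ?thesis using ff False by simp
qed

text \<open>Taking the part of a multiple of a form only replaces the cofactor by one of its own
  parts.\<close>

lemma graded_part_span_pair:
  assumes "graded_form wt p F" "graded_form wt q G" "f \<in> ideal.span {F, G}"
  shows "graded_part wt d f \<in> ideal.span {F, G}"
proof -
  obtain s t where "f = s * F + t * G"
    using assms(3) by (auto simp: ideal.span_insert algebra_simps)
  then have "graded_part wt d f = graded_part wt d (s * F) + graded_part wt d (t * G)" by (simp add: graded_part_add)
  then show ?thesis unfolding graded_part_mult_hom[OF assms(1)] graded_part_mult_hom[OF assms(2)]
    by (auto intro!: ideal.span_add ideal.span_zero intro: ideal.span_scale ideal.span_base)
qed

end

section \<open>Substitutions and their kernels\<close>

locale coeff_hom =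
  fixes h :: "'k::field \<Rightarrow> 'r::comm_ring_1"
  assumes h_zero: "h 0 = 0" and h_one: "h 1 = 1"
    and h_add: "h (a + b) = h a + h b" and h_mult: "h (a * b) = h a * h b"
begin

text \<open>Coefficients pass through \<open>h\<close> so that one development has two targets:
  \<open>subst\<close> substitutes polynomials into polynomials, \<open>dehom\<close> maps to
  univariate polynomials.\<close>

definition ev :: "(4 \<Rightarrow> 'r) \<Rightarrow> 'k poly4 \<Rightarrow> 'r" where
  "ev g f = (\<Sum>m\<in>keys f. h (lk f m) * (\<Prod>i\<in>UNIV. g i ^ lk m i))"

lemma ev_superset:
  assumes "finite A" "keys f \<subseteq> A"
  shows "ev g f = (\<Sum>m\<in>A. h (lk f m) * (\<Prod>i\<in>UNIV. g i ^ lk m i))"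
  unfolding ev_def using assms
  by (intro sum.mono_neutral_left) (auto simp: in_keys_iff h_zero)

lemma ev_zero: "ev g 0 = 0"
  by (simp add: ev_def)

lemma ev_add: "ev g (p + q) = ev g p + ev g q"
proof -
  let ?A = "keys p \<union> keys q"
  have "keys (p + q) \<subseteq> ?A" by (rule keys_add)
  then show ?thesis
    by (simp add: ev_superset[of ?A] lookup_add h_add distrib_right sum.distrib)
qed

lemma ev_mon: "ev g (mon m c) = h c * (\<Prod>i\<in>UNIV. g i ^ lk m i)"
  by (subst ev_superset[of "{m}"]) auto

lemma ev_const: "ev g (mon 0 c) = h c"
  by (simp add: ev_mon)

lemma ev_one: "ev g 1 = 1"
  using ev_const[of g 1] by (simp add: h_one)

lemma ev_mult_mon: "ev g (mon m a * mon n b) = ev g (mon m a) * ev g (mon n b)"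
proof -
  have "(\<Prod>i\<in>UNIV. g i ^ lk (m + n) i) = (\<Prod>i\<in>UNIV. g i ^ lk m i) * (\<Prod>i\<in>UNIV. g i ^ lk n i)"
    by (simp only: lookup_add power_add prod.distrib)
  then show ?thesis by (simp only: mult_single ev_mon h_mult) (simp only: mult_ac)
qed

lemma ev_mult: "ev g (p * q) = ev g p * ev g q"
proof (induction p rule: poly_monomials_induct)
  case (mono m)
  show ?case
  proof (induction q rule: poly_monomials_induct)
    case (mono n)
    show ?case by (rule ev_mult_mon)
  next
    case (add q r)
    then show ?case by (simp only: distrib_left ev_add)
  qed (simp only: mult_zero_right ev_zero)
next
  case (add p r)
  then show ?case by (simp only: distrib_right ev_add)
qed (simp only: mult_zero_left ev_zero)

lemma ev_diff: "ev g (p - q) = ev g p - ev g q"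
  using ev_add[of g "p - q" q] by simp

lemma ev_Var: "ev g (Var i) = g i"
proof -
  have "(\<Prod>j\<in>UNIV. g j ^ lk (mon i (1::nat)) j) = (\<Prod>j\<in>UNIV. if j = i then g i else 1)"
    by (rule prod.cong) (auto simp: lookup_single when_def)
  then show ?thesis by (simp add: Var_def ev_mon h_one)
qed

end

lemma Var_power: "(Var i :: 'k::field poly4) ^ n = mon (mon i n) 1"
proof (induction n)
  case (Suc n)
  then show ?case using single_add[of i 1 n] by (simp add: Var_def mult_single)
qed simp

lemma mon_eq_prod: "(mon m c :: 'k::field poly4) = mon 0 c * (\<Prod>i\<in>UNIV. Var i ^ lk m i)"
proof -
  have "(\<Prod>i\<in>A. (Var i :: 'k poly4) ^ lk m i) = mon (\<Sum>i\<in>A. mon i (lk m i)) 1" if "finite A" for A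
    using that by (induction A rule: finite_induct) (simp_all add: Var_power mult_single)
  moreover have "(\<Sum>i\<in>UNIV. mon i (lk m i)) = m"
    by (rule poly_mapping_eqI) (simp add: lookup_sum lookup_single when_def)
  ultimately show ?thesis by (simp add: mult_single)
qed

lemma poly4_induct [case_names const Var add mult]:
  fixes f :: "'k::field poly4"
  assumes const: "\<And>c. P (mon 0 c)" and Var: "\<And>i. P (Var i)"
    and add: "\<And>f g. P f \<Longrightarrow> P g \<Longrightarrow> P (f + g)" and mult: "\<And>f g. P f \<Longrightarrow> P g \<Longrightarrow> P (f * g)"
  shows "P f"
proof (rule poly_monomials_induct[of _ f])
  show "P 0" using const[of 0] by simp
  have one: "P 1" using const[of 1] by simp
  have pow: "P (Var i ^ n)" for i n
  proof (induction n)
    case (Suc n)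
    then show ?case unfolding power_Suc by (rule mult[OF Var])
  qed (simp add: one)
  have prod: "P (\<Prod>i\<in>A. Var i ^ n i)" if "finite A" for A n
    using that
  proof (induction A rule: finite_induct)
    case (insert x A)
    then show ?case using mult[OF pow] by simp
  qed (simp add: one)
  fix m
  have "mon m (lk f m) = mon 0 (lk f m) * (\<Prod>i\<in>UNIV. Var i ^ lk m i)" by (rule mon_eq_prod)
  then show "P (mon m (lk f m))" using mult[OF const prod] by simp
qed (rule add)

interpretation subst: coeff_hom "mon 0 :: 'k::field \<Rightarrow> 'k poly4"
  by unfold_locales (simp_all add: single_add mult_single)

text \<open>An idempotent substitution changes \<open>f\<close> only by an element of the span: this
  is clear on constants and variables, and for products it follows from
  \<open>f * g - f' * g' = f * (g - g') + g' * (f - f')\<close>. Ideals of linear forms thereby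
  become kernels of maps into a domain, hence prime.\<close>

lemma span_eq_ker_subst:
  fixes y :: "4 \<Rightarrow> 'k::field poly4"
  assumes "\<And>i. subst.ev y (y i) = y i"
  shows "ideal.span (range (\<lambda>i. Var i - y i)) = {f. subst.ev y f = 0}" (is "?S = ?K")
proof
  have "ideal.subspace ?K"
    by (auto simp: ideal.subspace_def subst.ev_zero subst.ev_add subst.ev_mult)
  then show "?S \<subseteq> ?K"
    using assms by (intro ideal.span_minimal) (auto simp: subst.ev_diff subst.ev_Var)
  have "f - subst.ev y f \<in> ?S" for f
  proof (induction f rule: poly4_induct)
    case (const c)
    then show ?case by (simp add: subst.ev_const ideal.span_zero)
  next
    case (Var i)
    then show ?case by (simp add: subst.ev_Var ideal.span_base)
  next
    case (add f g)
    then show ?case using ideal.span_add[OF add] by (simp add: subst.ev_add algebra_simps)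
  next
    case (mult f g)
    have "f * g - subst.ev y (f * g) = f * (g - subst.ev y g) + subst.ev y g * (f - subst.ev y f)"
      by (simp add: subst.ev_mult algebra_simps)
    then show ?case using mult by (simp add: ideal.span_add ideal.span_scale)
  qed
  then show "?K \<subseteq> ?S" by (smt (verit) diff_zero mem_Collect_eq subsetI)
qed

lemma prime_ideal_ker_subst: "prime_ideal {f :: 'k::field poly4. subst.ev y f = 0}"
  unfolding prime_ideal_def ideal.subspace_def
  by (auto simp: subst.ev_zero subst.ev_add subst.ev_mult subst.ev_one)

text \<open>Divisibility by \<open>Var i\<close> is vanishing under the substitution of 0 for
  \<open>Var i\<close>, a ring homomorphism into a domain.\<close>

lemma prime_elem_Var: "prime_elem (Var i :: 'k::field poly4)"
proof -
  let ?y = "\<lambda>j. if j = i then 0 else Var j :: 'k poly4"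
  have "ideal.span (range (\<lambda>j. Var j - ?y j)) = {f. subst.ev ?y f = 0}"
    by (rule span_eq_ker_subst) (simp add: subst.ev_zero subst.ev_Var)
  moreover have "ideal.span (range (\<lambda>j. Var j - ?y j)) \<subseteq> ideal.span {Var i}"
    by (rule ideal.span_minimal) (auto simp: ideal.span_base ideal.span_zero)
  moreover have "ideal.span {Var i} \<subseteq> {f. subst.ev ?y f = 0}"
    using prime_ideal_ker_subst[of ?y]
    by (intro ideal.span_minimal) (auto simp: subst.ev_Var prime_ideal_def)
  ultimately have dvd: "Var i dvd f \<longleftrightarrow> subst.ev ?y f = 0" for f :: "'k poly4"
    unfolding ideal.span_singleton dvd_def by (auto simp: mult.commute)
  have "Var i \<noteq> (0 :: 'k poly4)" by (simp add: Var_def flip: keys_eq_empty)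
  then show ?thesis unfolding prime_elem_def dvd by (auto simp: subst.ev_mult subst.ev_one)
qed

lemma mem_span_pair: "f \<in> ideal.span {F, G} \<longleftrightarrow> (\<exists>s t. f = F * s + G * t)"
proof
  assume "f \<in> ideal.span {F, G}"
  then show "\<exists>s t. f = F * s + G * t" 
    by (auto simp: ideal.span_insert) (metis add.commute diff_add_cancel mult.commute)
next
  assume "\<exists>s t. f = F * s + G * t"
  then obtain s t where "f = s * F + t * G" by (auto simp: mult.commute)
  then show "f \<in> ideal.span {F, G}"
    by (auto intro!: ideal.span_add intro: ideal.span_scale ideal.span_base)
qed

section \<open>Unmixedness of complete intersections of linear products\<close>

text \<open>The annihilator of every nonzero element of R/I lies in a member of \<open>LL\<close>;
  in a noetherian ring this says that all associated primes do. In this form the property passes to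
  colon ideals and module extensions by elementary means.\<close>

definition unmixed_by :: "'r::comm_ring_1 set set \<Rightarrow> 'r set \<Rightarrow> bool" where
  "unmixed_by LL I \<longleftrightarrow> (\<forall>f. f \<notin> I \<longrightarrow> (\<exists>L\<in>LL. \<forall>g. g * f \<in> I \<longrightarrow> g \<in> L))"

lemma unmixed_byD:
  "unmixed_by LL I \<Longrightarrow> f \<notin> I \<Longrightarrow> \<exists>L\<in>LL. \<forall>g. g * f \<in> I \<longrightarrow> g \<in> L"
  unfolding unmixed_by_def by (drule spec, erule (1) mp)

lemma unmixed_byI:
  assumes "\<And>f. f \<notin> I \<Longrightarrow> \<exists>L\<in>LL. \<forall>g. g * f \<in> I \<longrightarrow> g \<in> L"
  shows "unmixed_by LL I"
  unfolding unmixed_by_def by (intro allI impI assms)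

text \<open>If \<open>f\<close> is outside X : J, some \<open>f * j\<close> is outside X, and
  whatever multiplies \<open>f\<close> into X : J multiplies \<open>f * j\<close> into X.\<close>

lemma unmixed_by_quotient:
  assumes "unmixed_by LL X"
  shows "unmixed_by LL (ideal_quotient X J)"
proof (rule unmixed_byI)
  fix f assume "f \<notin> ideal_quotient X J"
  then obtain j where j: "j \<in> J" "f * j \<notin> X" unfolding ideal_quotient_def by blast
  obtain L where L: "L \<in> LL" "\<forall>g. g * (f * j) \<in> X \<longrightarrow> g \<in> L"
    using unmixed_byD[OF assms j(2)] by (rule bexE)
  have "g \<in> L" if "g * f \<in> ideal_quotient X J" for g
  proof -
    have "g * f * j \<in> X" using that j(1) unfolding ideal_quotient_def by blast
    then show ?thesis using L(2) by (simp add: mult.assoc)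
  qed
  then show "\<exists>L\<in>LL. \<forall>g. g * f \<in> ideal_quotient X J \<longrightarrow> g \<in> L" using L(1) by blast
qed

lemma prime_prod_list_cancel:
  fixes ls :: "'r::idom list"
  assumes "\<And>l. l \<in> set ls \<Longrightarrow> prime_elem l" "\<And>l. l \<in> set ls \<Longrightarrow> \<not> l dvd g"
    and "prod_list ls dvd g * b"
  shows "prod_list ls dvd b"
  using assms
proof (induction ls arbitrary: b)
  case (Cons l ls)
  have l: "prime_elem l" "\<not> l dvd g" using Cons.prems(1,2) by simp_all
  have "l dvd g * b" using Cons.prems(3) unfolding prod_list.Cons by (rule dvd_mult_left)
  then have "l dvd b" using prime_elem_dvd_multD[OF l(1)] l(2) by blast
  then obtain c where c: "b = l * c" by (rule dvdE)
  have nz: "l \<noteq> 0" using l(1) unfolding prime_elem_def by blast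
  have gb: "g * b = l * (g * c)" unfolding c by (rule mult.left_commute)
  have "l * prod_list ls dvd l * (g * c)" using Cons.prems(3) unfolding prod_list.Cons gb .
  then have "prod_list ls dvd g * c" using nz by (simp add: dvd_mult_cancel_left)
  moreover have "prime_elem l'" "\<not> l' dvd g" if "l' \<in> set ls" for l'
    using Cons.prems(1,2)[of l'] that by simp_all
  ultimately have "prod_list ls dvd c" by (rule Cons.IH[rotated 2])
  then show ?case unfolding c prod_list.Cons by (rule mult_dvd_mono[OF dvd_refl])
qed simp

lemma prime_not_dvd_prod_list:
  fixes l :: "'r::idom"
  assumes "prime_elem l" "\<And>k. k \<in> set ks \<Longrightarrow> \<not> l dvd k"
  shows "\<not> l dvd prod_list ks"
  using assms(2)
proof (induction ks)
  case Nil
  then show ?case using assms(1) by (simp add: prime_elem_not_unit)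
next
  case (Cons k ks)
  then show ?case using assms(1) by (simp add: prime_elem_dvd_mult_iff)
qed

text \<open>\<open>R/(l g, h)\<close> is an extension of \<open>R/(l, h)\<close> by \<open>R/(g, h)\<close>.\<close>

lemma unmixed_by_span_mult:
  fixes l g h :: "'r::idom"
  assumes "unmixed_by LL (ideal.span {l, h})" "unmixed_by LL (ideal.span {g, h})"
    and "\<And>t. l dvd h * t \<Longrightarrow> l dvd t" and "l \<noteq> 0"
  shows "unmixed_by LL (ideal.span {l * g, h})"
proof (rule unmixed_byI)
  fix f assume f: "f \<notin> ideal.span {l * g, h}"
  show "\<exists>L\<in>LL. \<forall>z. z * f \<in> ideal.span {l * g, h} \<longrightarrow> z \<in> L"
  proof (cases "f \<in> ideal.span {l, h}")
    case True
    then obtain r t where rt: "f = l * r + h * t" unfolding mem_span_pair by blast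
    \<comment> \<open>Modulo \<open>h\<close>, \<open>f\<close> is \<open>l * r\<close>: it comes
      from R/(g, h), embedded by multiplication with \<open>l\<close>. Its annihilator is that of
      \<open>r\<close>, because \<open>l\<close> is a nonzerodivisor modulo
      \<open>h\<close>.\<close>
    have "r \<notin> ideal.span {g, h}"
    proof
      assume "r \<in> ideal.span {g, h}"
      then obtain a b where "r = g * a + h * b" unfolding mem_span_pair by blast
      then have "f = l * g * a + h * (l * b + t)" using rt by (simp add: algebra_simps)
      then show False using f unfolding mem_span_pair by blast
    qed
    from unmixed_byD[OF assms(2) this]
    obtain L where L: "L \<in> LL" "\<forall>z. z * r \<in> ideal.span {g, h} \<longrightarrow> z \<in> L" by (rule bexE)
    have "z * r \<in> ideal.span {g, h}" if z: "z * f \<in> ideal.span {l * g, h}" for z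
    proof -
      obtain a b where ab: "z * f = l * g * a + h * b" using z unfolding mem_span_pair by blast
      then have *: "l * (z * r - g * a) = h * (b - z * t)" by (simp add: rt algebra_simps)
      have "l dvd b - z * t" by (rule assms(3)) (simp flip: *)
      then obtain c where "b - z * t = l * c" by (rule dvdE)
      then have "l * (z * r - g * a) = l * (h * c)" using * by (simp add: mult.left_commute)
      then have "z * r - g * a = h * c" using assms(4) by simp
      then have "z * r = g * a + h * c" by (simp add: algebra_simps)
      then show ?thesis unfolding mem_span_pair by blast
    qed
    then show ?thesis using L by blast
  next
    case False
    obtain L where L: "L \<in> LL" "\<forall>z. z * f \<in> ideal.span {l, h} \<longrightarrow> z \<in> L"
      using unmixed_byD[OF assms(1) False] by (rule bexE)
    have "x \<in> ideal.span {l, h}" if x: "x \<in> ideal.span {l * g, h}" for x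
    proof -
      obtain a b where "x = l * g * a + h * b" using x unfolding mem_span_pair by blast
      then have "x = l * (g * a) + h * b" by (simp add: mult.assoc)
      then show ?thesis unfolding mem_span_pair by blast
    qed
    then show ?thesis using L by blast
  qed
qed

lemma unmixed_by_one:
  assumes "1 \<in> I" "ideal.subspace I"
  shows "unmixed_by LL I"
proof (rule unmixed_byI)
  fix f assume "f \<notin> I"
  moreover have "f * 1 \<in> I" using assms by (intro ideal.subspace_scale)
  ultimately show "\<exists>L\<in>LL. \<forall>g. g * f \<in> I \<longrightarrow> g \<in> L" by simp
qed

lemma unmixed_by_prime: "prime_ideal L \<Longrightarrow> unmixed_by {L} L"
  unfolding prime_ideal_def by (intro unmixed_byI) blast

lemma unmixed_by_mono: "unmixed_by LL I \<Longrightarrow> LL \<subseteq> MM \<Longrightarrow> unmixed_by MM I"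
  unfolding unmixed_by_def by blast

text \<open>Factors are split off one at a time on both sides until only prime ideals
  \<open>(l, k)\<close> remain. An empty product gives the unit ideal, for which the condition is
  vacuous.\<close>

lemma unmixed_by_prod_lists:
  fixes ls ks :: "'r::idom list"
  assumes pr: "\<And>l. l \<in> set ls \<Longrightarrow> prime_elem l"
    and nd: "\<And>l k. l \<in> set ls \<Longrightarrow> k \<in> set ks \<Longrightarrow> \<not> l dvd k"
    and LL: "\<And>l k. l \<in> set ls \<Longrightarrow> k \<in> set ks \<Longrightarrow>
      prime_ideal (ideal.span {l, k}) \<and> ideal.span {l, k} \<in> LL"
  shows "unmixed_by LL (ideal.span {prod_list ls, prod_list ks})"
  using assms
proof (induction ls)
  case Nil
  then show ?case by (simp add: unmixed_by_one ideal.span_base)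
next
  case (Cons l ls)
  note prems = Cons.prems and IH = Cons.IH
  have l: "prime_elem l" using prems(1) by simp
  then have nz: "l \<noteq> 0" by auto
  have single: "unmixed_by LL (ideal.span {l, prod_list ks'})" if "set ks' \<subseteq> set ks" for ks'
    using that
  proof (induction ks')
    case Nil
    then show ?case by (simp add: unmixed_by_one ideal.span_base)
  next
    case (Cons k ks')
    have k: "k \<in> set ks" and ks': "unmixed_by LL (ideal.span {prod_list ks', l})"
      using Cons by (simp_all add: insert_commute)
    have ldk: "\<not> l dvd k" using prems(2) k by simp
    then have "k \<noteq> 0" by auto
    have "prime_ideal (ideal.span {l, k})" "ideal.span {l, k} \<in> LL"
      using prems(3)[of l k] k by auto
    then have "unmixed_by LL (ideal.span {l, k})"
      by (intro unmixed_by_mono[OF unmixed_by_prime]) auto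
    then have "unmixed_by LL (ideal.span {k, l})"
      by (simp add: insert_commute)
    then have "unmixed_by LL (ideal.span {k * prod_list ks', l})"
    proof (rule unmixed_by_span_mult[OF _ ks' _ \<open>k \<noteq> 0\<close>])
      \<comment> \<open>Only \<open>l\<close> is known to be prime, so regularity of
        \<open>k\<close> modulo \<open>l\<close> is obtained the other way round: \<open>l\<close>
        divides the cofactor \<open>s\<close> and can be cancelled.\<close>
      fix t assume "k dvd l * t"
      then obtain s where s: "l * t = k * s" by (auto simp: dvd_def)
      then have "l dvd k * s" by (metis dvd_triv_left)
      then obtain s' where "s = l * s'" using l ldk by (metis prime_elem_dvd_multD dvdE)
      then have "t = k * s'" using s nz by (simp add: mult.left_commute)
      then show "k dvd t" by simp
    qed
    then show ?case by (simp add: insert_commute)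
  qed
  have nd: "\<not> l dvd prod_list ks" using prems(2) l by (intro prime_not_dvd_prod_list) auto
  have *: "l dvd t" if "l dvd prod_list ks * t" for t
    using that l nd by (simp add: prime_elem_dvd_mult_iff)
  have "unmixed_by LL (ideal.span {prod_list ls, prod_list ks})"
    by (rule IH) (use prems in auto)
  then show ?case
    unfolding prod_list.Cons by (rule unmixed_by_span_mult[OF single[OF subset_refl] _ * nz])
qed

section \<open>Double colon ideals along a line\<close>

text \<open>The hypothesis on \<open>r\<close> makes the substitution of 0 for \<open>Var i\<close>
  and \<open>- r\<close> for \<open>Var j\<close> idempotent, so that its kernel is generated by the
  two linear relations.\<close>

lemma span_Var_line:
  fixes r :: "'k::field poly4"
  assumes "i \<noteq> j" "subst.ev (Var(i := 0, j := - r)) r = r"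
  shows "ideal.span {Var i, Var j + r} = {f. subst.ev (Var(i := 0, j := - r)) f = 0}"
proof -
  let ?y = "Var(i := 0, j := - r)"
  have neg: "subst.ev ?y (- r) = - r"
    using subst.ev_diff[of ?y 0 r] assms(2) by (simp add: subst.ev_zero)
  have "ideal.span {Var i, Var j + r} = ideal.span (range (\<lambda>i. Var i - ?y i))"
  proof (rule antisym; rule ideal.span_minimal)
    have "Var i \<in> range (\<lambda>i. Var i - ?y i)" using assms(1) by (intro range_eqI[of _ _ i]) simp
    moreover have "Var j + r \<in> range (\<lambda>i. Var i - ?y i)" by (intro range_eqI[of _ _ j]) simp
    ultimately show "{Var i, Var j + r} \<subseteq> ideal.span (range (\<lambda>i. Var i - ?y i))"
      by (simp add: ideal.span_base)
    show "range (\<lambda>i. Var i - ?y i) \<subseteq> ideal.span {Var i, Var j + r}"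
      by (auto simp: ideal.span_zero intro: ideal.span_base)
  qed auto
  also have "\<dots> = {f. subst.ev ?y f = 0}"
  proof (rule span_eq_ker_subst)
    fix k
    consider "k = j" | "k = i" "k \<noteq> j" | "k \<noteq> i" "k \<noteq> j" by blast
    then show "subst.ev ?y (?y k) = ?y k"
    proof cases
      case 1
      then have "?y k = - r" by simp
      then show ?thesis using neg by (simp only:)
    qed (simp_all add: subst.ev_zero subst.ev_Var)
  qed
  finally show ?thesis .
qed

lemma prime_ideal_Var_line:
  fixes r :: "'k::field poly4"
  assumes "i \<noteq> j" "subst.ev (Var(i := 0, j := - r)) r = r"
  shows "prime_ideal (ideal.span {Var i, Var j + r})"
  unfolding span_Var_line[OF assms] by (rule prime_ideal_ker_subst)

lemma mem_span_Var_Var: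
  assumes "i \<noteq> j"
  shows "(f :: 'k::field poly4) \<in> ideal.span {Var i, Var j} \<longleftrightarrow> subst.ev (Var(i := 0, j := 0)) f = 0"
  using span_Var_line[OF assms, of "0 :: 'k poly4"] by (simp add: subst.ev_zero)

lemma prime_ideal_span_Var_Var:
  assumes "i \<noteq> j"
  shows "prime_ideal (ideal.span {Var i, Var j :: 'k::field poly4})"
  using prime_ideal_Var_line[OF assms, of "0 :: 'k poly4"] by (simp add: subst.ev_zero)

abbreviation line_deg :: "4 \<Rightarrow> 4 \<Rightarrow> (4 \<Rightarrow>\<^sub>0 nat) \<Rightarrow> nat" where
  "line_deg i j m \<equiv> lk m i + lk m j"

lemma grading_line_deg: "grading (line_deg i j)"
  by unfold_locales (simp add: lookup_add)

lemma mon_ideal_UNIV [simp]: "mon_ideal UNIV = UNIV"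
  by (simp add: mon_ideal_def)

lemma line_power_add: "f \<in> line_power i j n \<Longrightarrow> g \<in> line_power i j n \<Longrightarrow> f + g \<in> line_power i j n"
  by (rule ideal.subspace_add[OF subspace_line_power])

lemma line_power_scale: "f \<in> line_power i j n \<Longrightarrow> c * f \<in> line_power i j n"
  by (rule ideal.subspace_scale[OF subspace_line_power])

lemma line_power_diff: "f \<in> line_power i j n \<Longrightarrow> g \<in> line_power i j n \<Longrightarrow> f - g \<in> line_power i j n"
  by (rule ideal.subspace_diff[OF subspace_line_power])

lemma graded_form_line_power: "graded_form (line_deg i j) d f \<Longrightarrow> f \<in> line_power i j d"
  by (auto simp: graded_form_def mon_ideal_def)

lemma graded_part_line_power: "f \<in> line_power i j n \<Longrightarrow> d < n \<Longrightarrow> graded_part (line_deg i j) d f = 0"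
  by (rule poly_mapping_eqI) (fastforce simp: lookup_graded_part mon_ideal_def in_keys_iff)

lemma line_power_SucE:
  fixes z :: "'k::field poly4"
  assumes "i \<noteq> j" "z \<in> line_power i j (Suc n)"
  shows "\<exists>a\<in>line_power i j n. \<exists>b\<in>line_power i j n. z = Var i * a + Var j * b"
proof (rule poly_monomials_induct[of "\<lambda>z. \<exists>a\<in>line_power i j n. \<exists>b\<in>line_power i j n. z = Var i * a + Var j * b"])
  have zero: "(0 :: 'k poly4) \<in> line_power i j n" by (simp add: mon_ideal_def)
  then show "\<exists>a\<in>line_power i j n. \<exists>b\<in>line_power i j n. (0 :: 'k poly4) = Var i * a + Var j * b"
    by (intro bexI[of _ 0]) auto
  fix m assume "m \<in> keys z"
  then have m: "Suc n \<le> lk m i + lk m j" using assms(2) by (auto simp: mon_ideal_def)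
  then consider "lk m i > 0" | "lk m j > 0" by linarith
  then show "\<exists>a\<in>line_power i j n. \<exists>b\<in>line_power i j n. mon m (lk z m) = Var i * a + Var j * b"
  proof cases
    case 1
    have "mon (m - mon i 1) (lk z m) \<in> line_power i j n"
      using m 1 assms(1) by (auto simp: mono_in_mon_ideal lookup_minus lookup_single when_def)
    then show ?thesis
      by (rule bexI[rotated], intro bexI[OF _ zero]) (use mono_Var[OF 1, of "lk z m"] in simp)
  next
    case 2
    have "mon (m - mon j 1) (lk z m) \<in> line_power i j n"
      using m 2 assms(1) by (auto simp: mono_in_mon_ideal lookup_minus lookup_single when_def)
    then show ?thesis
      by (intro bexI[OF _ zero] bexI[of _ "mon (m - mon j 1) (lk z m)"])
        (use mono_Var[OF 2, of "lk z m"] in simp_all)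
  qed
next
  fix f g :: "'k poly4"
  assume "\<exists>a\<in>line_power i j n. \<exists>b\<in>line_power i j n. f = Var i * a + Var j * b"
    and "\<exists>a\<in>line_power i j n. \<exists>b\<in>line_power i j n. g = Var i * a + Var j * b"
  then obtain a b c d where "a \<in> line_power i j n" "b \<in> line_power i j n" "f = Var i * a + Var j * b"
    "c \<in> line_power i j n" "d \<in> line_power i j n" "g = Var i * c + Var j * d" by blast
  then show "\<exists>a\<in>line_power i j n. \<exists>b\<in>line_power i j n. f + g = Var i * a + Var j * b"
    by (intro bexI[of _ "a + c"] bexI[of _ "b + d"]) (simp_all add: line_power_add algebra_simps)
qed

lemma line_power_SucE':
  fixes z :: "'k::field poly4"
  assumes "i \<noteq> j" "z \<in> line_power i j (Suc n)"
    and "ideal.span {l, k} = ideal.span {Var i, Var j}"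
  shows "\<exists>a\<in>line_power i j n. \<exists>b\<in>line_power i j n. z = l * a + k * b"
proof -
  obtain a b where ab: "a \<in> line_power i j n" "b \<in> line_power i j n" "z = Var i * a + Var j * b"
    using line_power_SucE[OF assms(1,2)] by blast
  have "Var i \<in> ideal.span {l, k}" "Var j \<in> ideal.span {l, k}"
    unfolding assms(3) by (auto intro: ideal.span_base)
  then obtain s t s' t' where "Var i = l * s + k * t" "Var j = l * s' + k * t'"
    unfolding mem_span_pair by blast
  then have "z = l * (s * a + s' * b) + k * (t * a + t' * b)" using ab by (simp add: algebra_simps)
  moreover have "s * a + s' * b \<in> line_power i j n" "t * a + t' * b \<in> line_power i j n"
    using ab by (simp_all add: line_power_add line_power_scale)
  ultimately show ?thesis by blast
qed

text \<open>Each factor \<open>k\<close> gives \<open>z = l * a + k * b\<close>. The recursion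
  expands \<open>b\<close> along the remaining factors, and the multiple of \<open>l\<close> that
  arises in it, times \<open>k\<close>, is absorbed into \<open>a\<close>.\<close>

lemma line_power_split_prod:
  fixes z :: "'k::field poly4"
  assumes "i \<noteq> j" "\<And>k. k \<in> set ks \<Longrightarrow> k \<in> line_power i j 1"
    and "\<And>k. k \<in> set ks \<Longrightarrow> ideal.span {l, k} = ideal.span {Var i, Var j}"
    and "z \<in> line_power i j (length ks + n)"
  shows "\<exists>y\<in>line_power i j (length ks + n - 1). \<exists>w\<in>line_power i j n. z = l * y + prod_list ks * w"
  using assms(2-4)
proof (induction ks arbitrary: z)
  case Nil
  then show ?case by (intro bexI[of _ 0] bexI[of _ z]) (auto simp: mon_ideal_def)
next
  case (Cons k ks)
  have k: "k \<in> line_power i j 1" and span: "ideal.span {l, k} = ideal.span {Var i, Var j}"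
    using Cons.prems by simp_all
  have "z \<in> line_power i j (Suc (length ks + n))" using Cons.prems(3) by simp
  from line_power_SucE'[OF assms(1) this span] obtain a b where
    ab: "a \<in> line_power i j (length ks + n)" "b \<in> line_power i j (length ks + n)" "z = l * a + k * b"
    by blast
  obtain y w where yw: "y \<in> line_power i j (length ks + n - 1)" "w \<in> line_power i j n"
    "b = l * y + prod_list ks * w"
    using Cons.IH[OF _ _ ab(2)] Cons.prems by (auto simp del: One_nat_def)
  have "k * y \<in> line_power i j (1 + (length ks + n - 1))" by (rule line_power_mult[OF k yw(1)])
  then have "k * y \<in> line_power i j (length ks + n)" by (rule line_power_mono[rotated]) simp
  then have "a + k * y \<in> line_power i j (length (k # ks) + n - 1)"
    using ab(1) by (simp add: line_power_add)
  moreover have "z = l * (a + k * y) + prod_list (k # ks) * w"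
    using ab(3) yw(3) by (simp add: algebra_simps)
  ultimately show ?case using yw(2) by blast
qed

text \<open>Coprime binary forms of degrees p and q generate everything of degree at least p + q -
  1, one above the socle degree. Here this is a recursion that strips the factors of the first
  form.\<close>

lemma line_power_subset_span_prods:
  fixes z :: "'k::field poly4"
  assumes "i \<noteq> j" "\<And>k. k \<in> set ks \<Longrightarrow> k \<in> line_power i j 1"
    and "\<And>l k. l \<in> set ls \<Longrightarrow> k \<in> set ks \<Longrightarrow> ideal.span {l, k} = ideal.span {Var i, Var j}"
    and "z \<in> line_power i j (length ls + length ks - 1)"
  shows "z \<in> ideal.span {prod_list ls, prod_list ks}"
  using assms(3,4)
proof (induction ls arbitrary: z)
  case Nil
  have "z = 1 * z + prod_list ks * 0" by simp
  then show ?case unfolding mem_span_pair prod_list.Nil by blast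
next
  case (Cons l ls)
  have "z \<in> line_power i j (length ks + length ls)" using Cons.prems(2) by (simp add: add.commute)
  with line_power_split_prod[OF assms(1,2), of ks l z "length ls"] Cons.prems(1)
  obtain y w where yw: "y \<in> line_power i j (length ks + length ls - 1)" "z = l * y + prod_list ks * w"
    by auto
  have "y \<in> ideal.span {prod_list ls, prod_list ks}"
    using yw(1) Cons.prems(1) by (intro Cons.IH) (simp_all add: add.commute)
  then obtain s t where "y = prod_list ls * s + prod_list ks * t" unfolding mem_span_pair by blast
  then have "z = prod_list (l # ls) * s + prod_list ks * (l * t + w)"
    using yw(2) by (simp add: algebra_simps)
  then show ?case unfolding mem_span_pair by blast
qed

lemma Var_not_dvd_Var: "i \<noteq> j \<Longrightarrow> \<not> Var i dvd (Var j :: 'k::field poly4)"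
proof
  assume "i \<noteq> j" "Var i dvd (Var j :: 'k poly4)"
  then obtain c where "Var j = Var i * (c :: 'k poly4)" by (rule_tac dvdE)
  then have "subst.ev (Var(i := 0)) (Var j) = subst.ev (Var(i := 0)) (Var i * c)" by simp
  then show False using \<open>i \<noteq> j\<close> prime_elem_Var[of j, where 'k = 'k]
    by (simp add: subst.ev_mult subst.ev_Var prime_elem_def)
qed

lemma Var_nonzero: "Var i \<noteq> (0 :: 'k::field poly4)"
  using prime_elem_Var[of i, where 'k = 'k] by (simp add: prime_elem_def)

text \<open>The socle of \<open>K[x, y]/(F, G)\<close> lives in degree \<open>p + q - 2\<close>: it is generated by the
  determinant of the coefficients of \<open>F\<close> and \<open>G\<close> with respect to \<open>x, y\<close>.\<close>

lemma socle_degree: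
  fixes F G f :: "'k::field poly4"
  assumes "i \<noteq> j" and F: "graded_form (line_deg i j) p F" and G: "graded_form (line_deg i j) q G" and "p > 0" "q > 0"
    and coprime: "\<And>t. F dvd G * t \<Longrightarrow> F dvd t" and "F \<noteq> 0"
    and f: "graded_form (line_deg i j) d f" "d + 2 < p + q"
    and xf: "Var i * f \<in> ideal.span {F, G}" and yf: "Var j * f \<in> ideal.span {F, G}"
  shows "f \<in> ideal.span {F, G}"
proof -
  let ?x = "Var i :: 'k poly4" and ?y = "Var j :: 'k poly4"
  obtain s t where st: "?x * f = F * s + G * t" using xf unfolding mem_span_pair by blast
  obtain s' t' where st': "?y * f = F * s' + G * t'" using yf unfolding mem_span_pair by blast
  have "F \<in> line_power i j (Suc (p - 1))" using graded_form_line_power[OF F] \<open>p > 0\<close> by simp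
  then obtain F1 F2 where FF: "F1 \<in> line_power i j (p - 1)" "F2 \<in> line_power i j (p - 1)"
    "F = ?x * F1 + ?y * F2" using line_power_SucE[OF \<open>i \<noteq> j\<close>] by blast
  have "G \<in> line_power i j (Suc (q - 1))" using graded_form_line_power[OF G] \<open>q > 0\<close> by simp
  then obtain G1 G2 where GG: "G1 \<in> line_power i j (q - 1)" "G2 \<in> line_power i j (q - 1)"
    "G = ?x * G1 + ?y * G2" using line_power_SucE[OF \<open>i \<noteq> j\<close>] by blast
  have cancel: "?x dvd b" if "?x * a = ?y * b" for a b
  proof -
    have "?x dvd ?y * b" by (simp flip: that)
    from prime_elem_dvd_multD[OF prime_elem_Var this] show ?thesis
      using Var_not_dvd_Var[OF \<open>i \<noteq> j\<close>] by blast
  qed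
  \<comment> \<open>Both sides equal \<open>Var i * Var j * f\<close>. As \<open>F\<close> and
    \<open>G\<close> have only Koszul syzygies, the coefficient differences are \<open>G * w\<close>
    and \<open>F * w\<close> for a common \<open>w\<close>.\<close>
  have "?y * (F * s + G * t) = ?x * (F * s' + G * t')"
    unfolding st[symmetric] st'[symmetric] by (rule mult.left_commute)
  then have *: "F * (?y * s - ?x * s') = G * (?x * t' - ?y * t)" by (simp add: algebra_simps)
  have "F dvd ?x * t' - ?y * t" by (rule coprime) (simp flip: *)
  then obtain w where w: "?x * t' - ?y * t = F * w" by (rule dvdE)
  then have "F * (?y * s - ?x * s') = F * (G * w)" using * by (simp add: mult.left_commute)
  then have w': "?y * s - ?x * s' = G * w" using \<open>F \<noteq> 0\<close> by simp
  have "?x * (s' + w * G1) = ?y * (s - w * G2)" using w' unfolding GG(3) by (simp add: algebra_simps)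
  then have "?x dvd s - w * G2" by (rule cancel)
  then obtain s'' where s'': "s - w * G2 = ?x * s''" by (rule dvdE)
  have "?x * (t' - w * F1) = ?y * (t + w * F2)" using w unfolding FF(3) by (simp add: algebra_simps)
  then have "?x dvd t + w * F2" by (rule cancel)
  then obtain t'' where t'': "t + w * F2 = ?x * t''" by (rule dvdE)
  have s: "s = w * G2 + ?x * s''" and t: "t = ?x * t'' - w * F2"
    using s'' t'' by (simp_all add: algebra_simps)
  \<comment> \<open>Modulo \<open>(F, G)\<close>, \<open>f\<close> is \<open>w\<close> times the
    determinant. That has order at least p + q - 2 in the two variables, above the degree
    \<open>d\<close> of \<open>f\<close>, so it contributes nothing in degree
    \<open>d\<close>.\<close>
  let ?e = "w * (F1 * G2 - G1 * F2)"
  have "?x * f = ?x * (?e + (F * s'' + G * t''))"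
    unfolding st s t by (simp add: FF(3) GG(3) algebra_simps)
  then have fe: "f = ?e + (F * s'' + G * t'')" using Var_nonzero[of i, where 'k = 'k] by simp
  have "F1 * G2 - G1 * F2 \<in> line_power i j (p - 1 + (q - 1))"
    using line_power_mult[OF FF(1) GG(2)] line_power_mult[OF FF(2) GG(1)]
    by (simp add: line_power_diff mult.commute[of G1])
  then have "?e \<in> line_power i j (p - 1 + (q - 1))" by (rule line_power_scale)
  then have "graded_part (line_deg i j) d ?e = 0" by (rule graded_part_line_power) (use f(2) \<open>p > 0\<close> \<open>q > 0\<close> in linarith)
  then have "graded_part (line_deg i j) d f = graded_part (line_deg i j) d (F * s'' + G * t'')"
    by (subst fe) (simp add: graded_part_add)
  moreover have "F * s'' + G * t'' \<in> ideal.span {F, G}" unfolding mem_span_pair by blast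
  ultimately have "graded_part (line_deg i j) d f \<in> ideal.span {F, G}"
    using grading.graded_part_span_pair[OF grading_line_deg F G] by simp
  then show ?thesis using graded_part_graded_form[OF f(1)] by simp
qed

text \<open>Gorenstein duality for two binary forms: modulo \<open>(F, G)\<close>, what is killed by
  the k-th power of the maximal ideal has order at least p + q - 1 - k. Multiplying by a variable
  lowers \<open>k\<close>, and \<open>socle_degree\<close> divides this variable out again in low
  degrees.\<close>

lemma colon_line_power:
  fixes F G f :: "'k::field poly4"
  assumes "i \<noteq> j" and F: "graded_form (line_deg i j) p F" and G: "graded_form (line_deg i j) q G" and "p > 0" "q > 0"
    and coprime: "\<And>t. F dvd G * t \<Longrightarrow> F dvd t" and "F \<noteq> 0"
    and "\<And>z. z \<in> line_power i j k \<Longrightarrow> f * z \<in> ideal.span {F, G}"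
  shows "\<exists>u\<in>ideal.span {F, G}. \<exists>v\<in>line_power i j (p + q - 1 - k). f = u + v"
  using assms(8)
proof (induction k arbitrary: f)
  case 0
  have "f * 1 \<in> ideal.span {F, G}" by (rule 0) simp
  then show ?case by (intro bexI[of _ f] bexI[of _ 0]) (auto simp: mon_ideal_def)
next
  case (Suc k)
  let ?wt = "line_deg i j"
  define s where "s = p + q - 1 - k"
  \<comment> \<open>By induction \<open>Var l * f\<close> has order at least \<open>s\<close> modulo
    \<open>(F, G)\<close>. Its part of degree \<open>d + 1\<close>, which is \<open>Var l\<close>
    times the part of \<open>f\<close> of degree \<open>d\<close>, is therefore in
    \<open>(F, G)\<close>.\<close>
  have part: "Var l * graded_part ?wt d f \<in> ideal.span {F, G}" if d: "d + 1 < s" and l: "l = i \<or> l = j" for d l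
  proof -
    have Var1: "Var l \<in> line_power i j 1" using l Var_line_power by blast
    have "Var l * f * z \<in> ideal.span {F, G}" if z: "z \<in> line_power i j k" for z
    proof -
      have "Var l * z \<in> line_power i j (1 + k)" by (rule line_power_mult[OF Var1 z])
      then have "f * (Var l * z) \<in> ideal.span {F, G}" by (intro Suc.prems) simp
      then show ?thesis by (simp add: ac_simps)
    qed
    then obtain u v where uv: "u \<in> ideal.span {F, G}" "v \<in> line_power i j s" "Var l * f = u + v"
      using Suc.IH[of "Var l * f"] unfolding s_def by blast
    have "graded_form ?wt 1 (Var l :: 'k poly4)"
      using l assms(1) by (auto simp: graded_form_def Var_def lookup_single when_def)
    then have "graded_part ?wt (d + 1) (f * Var l) = graded_part ?wt d f * Var l"
      using grading.graded_part_mult_hom[OF grading_line_deg, of i j 1 "Var l" "d + 1" f] by simp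
    moreover have "graded_part ?wt (d + 1) (u + v) = graded_part ?wt (d + 1) u"
      using graded_part_line_power[OF uv(2) d] by (simp add: graded_part_add)
    ultimately have "graded_part ?wt d f * Var l = graded_part ?wt (d + 1) u"
      using uv(3) by (simp add: mult.commute)
    then show ?thesis
      using grading.graded_part_span_pair[OF grading_line_deg F G uv(1)] by (simp add: mult.commute)
  qed
  have comps: "graded_part ?wt d f \<in> ideal.span {F, G}" if "d + 1 < s" for d
    by (rule socle_degree[OF assms(1-7) graded_form_graded_part])
       (use that part in \<open>auto simp: s_def\<close>)
  \<comment> \<open>\<open>u\<close> collects the parts already known to lie in
    \<open>(F, G)\<close>; the remainder starts in degree \<open>s - 1\<close>, which is the bound
    for \<open>Suc k\<close>.\<close>
  define u where "u = (\<Sum>d<s - 1. graded_part ?wt d f)"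
  have "u \<in> ideal.span {F, G}" unfolding u_def by (intro ideal.span_sum comps) auto
  moreover have "f - u \<in> line_power i j (s - 1)"
    unfolding mon_ideal_def
  proof (intro CollectI subsetI)
    fix m assume m: "m \<in> keys (f - u)"
    show "s - 1 \<le> lk m i + lk m j"
    proof (rule ccontr)
      assume "\<not> s - 1 \<le> lk m i + lk m j"
      then have "lk u m = lk f m" by (simp add: u_def lookup_sum lookup_graded_part)
      then show False using m by (simp add: in_keys_iff lookup_minus)
    qed
  qed
  ultimately show ?case unfolding s_def by (intro bexI[of _ u] bexI[of _ "f - u"]) auto
qed

text \<open>Localising at the prime of a line, \<open>X\<close> becomes generated by two forms in the two
  variables of the line; \<open>u\<close> and \<open>v\<close> collect the factors that become units.\<close>

lemma double_colon_line:
  fixes f :: "'k::field poly4"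
  assumes "i \<noteq> j"
    and ls: "\<And>l. l \<in> set ls \<Longrightarrow> prime_elem l \<and> graded_form (line_deg i j) 1 l"
    and ks: "\<And>k. k \<in> set ks \<Longrightarrow> graded_form (line_deg i j) 1 k"
    and nd: "\<And>l k. l \<in> set ls \<Longrightarrow> k \<in> set ks \<Longrightarrow> \<not> l dvd k"
    and span: "\<And>l k. l \<in> set ls \<Longrightarrow> k \<in> set ks \<Longrightarrow> ideal.span {l, k} = ideal.span {Var i, Var j}"
    and u: "u \<notin> ideal.span {Var i, Var j}" and v: "v \<notin> ideal.span {Var i, Var j}"
    and n: "n \<le> length ls" "n \<le> length ks"
    and X: "X = ideal.span {prod_list ls * u, prod_list ks * v}"
    and J: "J \<subseteq> line_power i j n"
    and f: "f \<in> ideal_quotient X (ideal_quotient X J)"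
  shows "f \<in> line_power i j n"
proof (cases "n = 0")
  case True
  then show ?thesis by simp
next
  case False
  define p q where "p = length ls" "q = length ks"
  have pq: "p > 0" "q > 0" using False n by (auto simp: p_q_def)
  define F G where "F = prod_list ls" "G = prod_list ks"
  have F: "graded_form (line_deg i j) p F" and G: "graded_form (line_deg i j) q G"
    using grading.graded_form_prod_list[OF grading_line_deg] ls ks by (auto simp: p_q_def F_G_def)
  have pr: "prime_elem l" if "l \<in> set ls" for l using ls that by simp
  have coprime: "F dvd t" if "F dvd G * t" for t
    using that prime_prod_list_cancel[of ls G t] prime_not_dvd_prod_list[OF pr nd] pr
    unfolding F_G_def by blast
  have nz: "F \<noteq> 0" unfolding F_G_def prod_list_zero_iff using pr[of 0] by auto
  have PP: "prime_ideal (ideal.span {Var i, Var j :: 'k poly4})"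
    by (rule prime_ideal_span_Var_Var[OF assms(1)])
  have ks1: "k \<in> line_power i j 1" if "k \<in> set ks" for k by (rule graded_form_line_power[OF ks[OF that]])
  have unm: "unmixed_by {ideal.span {Var i, Var j}} (ideal.span {F, G})"
    unfolding F_G_def by (rule unmixed_by_prod_lists[OF pr nd]) (auto simp: span PP)
  have "f * y \<in> ideal.span {F, G}" if y: "y \<in> line_power i j (p + q - 1 - n)" for y
  proof -
    \<comment> \<open>The orders of \<open>y\<close> and of an element of \<open>J\<close> add up to
      p + q - 1, which forces their product into \<open>(F, G)\<close>; the factor
      \<open>u * v\<close> carries it on into \<open>X\<close>.\<close>
    have "u * v * y \<in> ideal_quotient X J"
      unfolding ideal_quotient_def
    proof (intro CollectI ballI)
      fix g assume "g \<in> J"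
      then have "y * g \<in> line_power i j (p + q - 1 - n + n)" using J by (intro line_power_mult[OF y]) blast
      then have "y * g \<in> line_power i j (p + q - 1)" by (rule line_power_mono[rotated]) simp
      then have "y * g \<in> ideal.span {F, G}"
        unfolding F_G_def p_q_def
        by (intro line_power_subset_span_prods[OF assms(1), of ks ls]) (simp_all only: ks1 span)
      then obtain a b where "y * g = F * a + G * b" unfolding mem_span_pair by blast
      then have "u * v * (y * g) = prod_list ls * u * (v * a) + prod_list ks * v * (u * b)"
        by (simp add: F_G_def algebra_simps)
      then show "u * v * y * g \<in> X" unfolding X mem_span_pair mult.assoc[of "u * v" y g] by blast
    qed
    then have "f * (u * v * y) \<in> X" using f unfolding ideal_quotient_def by blast
    then obtain a b where "f * (u * v * y) = prod_list ls * u * a + prod_list ks * v * b"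
      unfolding X mem_span_pair by blast
    then have "u * v * (f * y) = F * (u * a) + G * (v * b)" by (simp add: F_G_def algebra_simps)
    then have uvf: "u * v * (f * y) \<in> ideal.span {F, G}" unfolding mem_span_pair by blast
    \<comment> \<open>Annihilators modulo \<open>(F, G)\<close> lie in the prime of the line, so
      \<open>u * v\<close>, being outside it, can be cancelled.\<close>
    have "u * v \<notin> ideal.span {Var i, Var j}" using u v PP unfolding prime_ideal_def by blast
    then show ?thesis using unmixed_byD[OF unm, of "f * y"] uvf by blast
  qed
  then obtain a b where ab: "a \<in> ideal.span {F, G}" "b \<in> line_power i j (p + q - 1 - (p + q - 1 - n))" "f = a + b"
    using colon_line_power[OF assms(1) F G pq coprime nz] by blast
  \<comment> \<open>The truncated differences undo each other because n is at most p and q, which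
    are positive.\<close>
  have "p + q - 1 - (p + q - 1 - n) = n" using n pq by (simp add: p_q_def)
  then have b: "b \<in> line_power i j n" using ab by simp
  have "F \<in> line_power i j n" "G \<in> line_power i j n"
    using n line_power_mono graded_form_line_power[OF F] graded_form_line_power[OF G] unfolding p_q_def by blast+
  then have "ideal.span {F, G} \<subseteq> line_power i j n" by (intro ideal.span_minimal subspace_line_power) auto
  then show ?thesis using ab b by (auto intro: line_power_add)
qed

section \<open>Curves whose components are lines\<close>

interpretation dehom: coeff_hom "\<lambda>c :: 'k::field. [:c:]"
  by unfold_locales (simp_all add: one_pCons)

abbreviation tdeg :: "(4 \<Rightarrow>\<^sub>0 nat) \<Rightarrow> nat" where
  "tdeg m \<equiv> \<Sum>i\<in>UNIV. lk m i"

lemma grading_tdeg: "grading tdeg"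
  by unfold_locales (simp add: lookup_add sum.distrib)

lemma homogeneous_iff_hom: "homogeneous (int d) f \<longleftrightarrow> graded_form tdeg d f"
  unfolding homogeneous_def graded_form_def by (simp only: of_nat_eq_iff)

lemma homogeneous_nat:
  assumes "homogeneous e f" "f \<noteq> 0"
  shows "\<exists>d. e = int d"
  using assms unfolding homogeneous_def by (metis keys_eq_empty all_not_in_conv)

section \<open>Restriction of forms to a parametrised line\<close>

definition lin :: "4 \<Rightarrow> 4 \<Rightarrow> (4 \<Rightarrow> 'k::field) \<Rightarrow> (4 \<Rightarrow> 'k) \<Rightarrow> 4 \<Rightarrow> 'k poly4" where
  "lin u v a b i = mon 0 (a i) * Var u + mon 0 (b i) * Var v"

text \<open>Homogenisation of a univariate polynomial to degree \<open>n\<close>, with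
  \<open>Var v\<close> as the extra variable. Coefficients beyond \<open>n\<close> are cut off,
  whence the degree bounds in the multiplication rule.\<close>

definition homog :: "4 \<Rightarrow> 4 \<Rightarrow> nat \<Rightarrow> 'k::field poly \<Rightarrow> 'k poly4" where
  "homog u v n p = (\<Sum>k\<le>n. mon 0 (coeff p k) * Var u ^ k * Var v ^ (n - k))"

lemma homog_add: "homog u v n (p + q) = homog u v n p + homog u v n q"
  by (simp add: homog_def single_add distrib_right sum.distrib)

lemma homog_zero: "homog u v n 0 = 0"
  by (simp add: homog_def)

lemma homog_sum: "homog u v n (sum f A) = (\<Sum>i\<in>A. homog u v n (f i))"
  by (induction A rule: infinite_finite_induct) (simp_all add: homog_zero homog_add)

lemma homog_monom:
  assumes "k \<le> n"
  shows "homog u v n (monom c k) = mon 0 c * Var u ^ k * Var v ^ (n - k)"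
proof -
  have "homog u v n (monom c k) = (\<Sum>l\<le>n. if l = k then mon 0 c * Var u ^ k * Var v ^ (n - k) else 0)"
    unfolding homog_def by (rule sum.cong) auto
  then show ?thesis using assms by simp
qed

lemma homog_mult:
  assumes "degree p \<le> n" "degree q \<le> m"
  shows "homog u v (n + m) (p * q) = homog u v n p * homog u v m q"
proof -
  have "p * q = (\<Sum>k\<le>n. \<Sum>l\<le>m. monom (coeff p k * coeff q l) (k + l))"
    by (subst (1) poly_as_sum_of_monoms'[OF assms(1), symmetric],
        subst (1) poly_as_sum_of_monoms'[OF assms(2), symmetric])
       (simp add: sum_product mult_monom)
  then have "homog u v (n + m) (p * q) =
    (\<Sum>k\<le>n. \<Sum>l\<le>m. mon 0 (coeff p k * coeff q l) * Var u ^ (k + l) * Var v ^ (n + m - (k + l)))"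
    by (simp add: homog_sum homog_monom)
  also have "\<dots> = (\<Sum>k\<le>n. \<Sum>l\<le>m. (mon 0 (coeff p k) * Var u ^ k * Var v ^ (n - k)) *
      (mon 0 (coeff q l) * Var u ^ l * Var v ^ (m - l)))"
  proof (intro sum.cong refl)
    fix k l assume "k \<in> {..n}" "l \<in> {..m}"
    then have "n + m - (k + l) = (n - k) + (m - l)" by auto
    moreover have "mon 0 (coeff p k * coeff q l) = mon 0 (coeff p k) * (mon 0 (coeff q l) :: 'a poly4)"
      by (simp add: mult_single)
    ultimately show "mon 0 (coeff p k * coeff q l) * Var u ^ (k + l) * Var v ^ (n + m - (k + l)) =
      (mon 0 (coeff p k) * Var u ^ k * Var v ^ (n - k)) * (mon 0 (coeff q l) * Var u ^ l * Var v ^ (m - l))"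
      by (simp only: power_add) (simp only: mult_ac)
  qed
  also have "\<dots> = homog u v n p * homog u v m q" by (simp add: homog_def sum_product)
  finally show ?thesis .
qed

lemma homog_raise:
  fixes p :: "'k::field poly"
  assumes "degree p \<le> n"
  shows "homog u v (n + k) p = homog u v n p * Var v ^ k"
proof -
  have "homog u v k (1 :: 'k poly) = Var v ^ k"
    using homog_monom[of 0 k u v "1 :: 'k"] by simp
  then show ?thesis using homog_mult[OF assms, of 1 k u v] by simp
qed

lemma subst_lin_eq_homog_mon:
  fixes a b :: "4 \<Rightarrow> 'k::field"
  shows "degree (dehom.ev (\<lambda>i. [:b i, a i:]) (mon m c)) \<le> tdeg m \<and>
    subst.ev (lin u v a b) (mon m c) = homog u v (tdeg m) (dehom.ev (\<lambda>i. [:b i, a i:]) (mon m c))"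
proof (induction "tdeg m" arbitrary: m)
  case 0
  then have "m = 0" by (intro poly_mapping_eqI) simp
  then show ?case by (simp add: subst.ev_const dehom.ev_const homog_def)
next
  case (Suc n)
  let ?\<phi> = "dehom.ev (\<lambda>i. [:b i, a i:])"
  from Suc(2) obtain i where i: "lk m i > 0"
    by (metis (mono_tags, lifting) gr0I nat.distinct(1) sum.neutral)
  define m' where "m' = m - mon i 1"
  have m: "m = mon i 1 + m'"
    using i by (intro poly_mapping_eqI) (auto simp: m'_def lookup_add lookup_minus lookup_single when_def)
  have "tdeg (mon i (1::nat)) = 1" by (simp add: lookup_single when_def)
  then have d: "tdeg m = 1 + tdeg m'" unfolding m lookup_add sum.distrib by simp
  then have IH: "degree (?\<phi> (mon m' c)) \<le> tdeg m'"
    "subst.ev (lin u v a b) (mon m' c) = homog u v (tdeg m') (?\<phi> (mon m' c))"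
    using Suc(1)[of m'] Suc(2) by auto
  have mm: "mon m c = Var i * mon m' c" unfolding m'_def by (rule mono_Var[OF i])
  have deg1: "degree [:b i, a i:] \<le> 1" by (simp add: degree_pCons_le)
  have \<phi>: "?\<phi> (mon m c) = [:b i, a i:] * ?\<phi> (mon m' c)"
    unfolding mm dehom.ev_mult dehom.ev_Var ..
  have "lin u v a b i = homog u v 1 [:b i, a i:]"
    by (simp add: lin_def homog_def add.commute)
  then have "subst.ev (lin u v a b) (mon m c) = homog u v 1 [:b i, a i:] * homog u v (tdeg m') (?\<phi> (mon m' c))"
    unfolding mm subst.ev_mult subst.ev_Var IH(2) by simp
  also have "\<dots> = homog u v (tdeg m) (?\<phi> (mon m c))"
    unfolding \<phi> d by (rule homog_mult[OF deg1 IH(1), symmetric])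
  finally have "subst.ev (lin u v a b) (mon m c) = homog u v (tdeg m) (?\<phi> (mon m c))" .
  moreover have "degree (?\<phi> (mon m c)) \<le> tdeg m"
    unfolding \<phi> d using degree_mult_le[of "[:b i, a i:]" "?\<phi> (mon m' c)"] deg1 IH(1) by linarith
  ultimately show ?case by blast
qed

text \<open>On the chart \<open>Var v = 1\<close> the line has the parameter t, and
  \<open>Var i\<close> becomes \<open>[:b i, a i:]\<close>. Homogenising recovers the restriction of
  a form, which transfers questions about primes above the line to K[t].\<close>

lemma subst_lin_eq_homog:
  fixes f :: "'k::field poly4"
  assumes "graded_form tdeg e f"
  shows "degree (dehom.ev (\<lambda>i. [:b i, a i:]) f) \<le> e \<and>
    subst.ev (lin u v a b) f = homog u v e (dehom.ev (\<lambda>i. [:b i, a i:]) f)"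
proof (rule poly_monomials_induct[of "\<lambda>f. degree (dehom.ev (\<lambda>i. [:b i, a i:]) f) \<le> e \<and>
    subst.ev (lin u v a b) f = homog u v e (dehom.ev (\<lambda>i. [:b i, a i:]) f)"])
  fix m assume "m \<in> keys f"
  then have e: "e = tdeg m" using assms by (simp add: graded_form_def)
  show "degree (dehom.ev (\<lambda>i. [:b i, a i:]) (mon m (lk f m))) \<le> e \<and>
    subst.ev (lin u v a b) (mon m (lk f m)) = homog u v e (dehom.ev (\<lambda>i. [:b i, a i:]) (mon m (lk f m)))"
    unfolding e by (rule subst_lin_eq_homog_mon)
qed (auto simp: subst.ev_zero dehom.ev_zero homog_zero subst.ev_add dehom.ev_add homog_add degree_add_le)

text \<open>\<open>T\<close> is generated by an element \<open>d\<close> of least degree. A nonzero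
  \<open>f\<close> of least degree in \<open>S\<close> is \<open>d * e\<close>; \<open>d\<close> is
  not in the prime \<open>S\<close>, since \<open>q\<close> is a multiple of it, so \<open>e\<close>
  is, and comparing degrees makes \<open>d\<close> a unit.\<close>

lemma prime_ideal_poly_maximal:
  fixes S T :: "'k::field poly set"
  assumes S: "prime_ideal S" and "p \<in> S" "p \<noteq> 0" and T: "ideal.subspace T" and "S \<subseteq> T" "q \<in> T" "q \<notin> S"
  shows "1 \<in> T"
proof -
  obtain d where d: "d \<in> T" "d \<noteq> 0" and dmin: "\<And>z. z \<in> T \<Longrightarrow> z \<noteq> 0 \<Longrightarrow> degree d \<le> degree z"
    using ex_has_least_nat[of "\<lambda>z. z \<in> T \<and> z \<noteq> 0" p degree] assms by blast
  obtain f where f: "f \<in> S" "f \<noteq> 0" and fmin: "\<And>z. z \<in> S \<Longrightarrow> z \<noteq> 0 \<Longrightarrow> degree f \<le> degree z"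
    using ex_has_least_nat[of "\<lambda>z. z \<in> S \<and> z \<noteq> 0" p degree] assms by blast
  have dvd: "d dvd z" if z: "z \<in> T" for z
  proof -
    have "z mod d = z - (z div d) * d" by (simp add: minus_div_mult_eq_mod)
    then have "z mod d \<in> T" using T z d(1) by (simp add: ideal.subspace_diff ideal.subspace_scale)
    then have "z mod d = 0" using dmin[of "z mod d"] degree_mod_less[OF d(2), of z] by fastforce
    then show ?thesis by (rule mod_eq_0_iff_dvd[THEN iffD1])
  qed
  obtain e where e: "f = d * e" using dvd[of f] f(1) assms(5) by (auto elim: dvdE)
  obtain c where c: "q = d * c" using dvd[OF assms(6)] by (rule dvdE)
  have "d \<notin> S"
  proof
    assume "d \<in> S"
    then have "c * d \<in> S" using S unfolding prime_ideal_def by (intro ideal.subspace_scale) auto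
    then show False using c assms(7) by (simp add: mult.commute)
  qed
  then have "e \<in> S" using S f(1) e unfolding prime_ideal_def by blast
  moreover have "e \<noteq> 0" using e f(2) by auto
  ultimately have "degree f \<le> degree e" by (rule fmin)
  moreover have "degree f = degree d + degree e" using e d(2) \<open>e \<noteq> 0\<close> by (simp add: degree_mult_eq)
  ultimately have "d dvd 1" using d(2) by (simp add: is_unit_iff_degree)
  then obtain z where "1 = d * z" by (rule dvdE)
  then show ?thesis using ideal.subspace_scale[OF T d(1), of z] by (simp add: mult.commute)
qed

text \<open>\<open>Var u\<close> and \<open>Var v\<close> are coordinates on the line. The four
  normalisations make the substitution idempotent, so the ideal is generated by the forms
  \<open>Var i - lin u v a b i\<close>.\<close>

definition is_line :: "'k::field poly4 set \<Rightarrow> bool" where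
  "is_line L \<longleftrightarrow> (\<exists>u v a b. u \<noteq> v \<and> a u = 1 \<and> b u = 0 \<and> a v = 0 \<and> b v = 1 \<and>
    L = {f. subst.ev (lin u v a b) f = 0})"

lemma lin_fixed:
  assumes "a u = 1" "b u = 0" "a v = 0" "b v = 1"
  shows "subst.ev (lin u v a b) (lin u v a b i) = lin u v a b i"
proof -
  have "lin u v a b u = Var u" "lin u v a b v = Var v" using assms by (simp_all add: lin_def)
  then show ?thesis
    by (subst (2) lin_def) (simp add: subst.ev_add subst.ev_mult subst.ev_const subst.ev_Var lin_def)
qed

lemma graded_form_Var: "graded_form tdeg 1 (Var i :: 'k::field poly4)"
  by (simp add: graded_form_def Var_def lookup_single when_def)

lemma graded_form_add: "graded_form wt d f \<Longrightarrow> graded_form wt d g \<Longrightarrow> graded_form wt d (f + g)"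
  unfolding graded_form_def using keys_add[of f g] by blast

lemma graded_form_uminus: "graded_form wt d f \<Longrightarrow> graded_form wt d (- f)"
  unfolding graded_form_def by (simp add: in_keys_iff)

lemma graded_form_const: "graded_form tdeg 0 (mon 0 c)"
  by (simp add: graded_form_def)

lemma graded_form_lin: "graded_form tdeg 1 (lin u v a b i)"
  unfolding lin_def
  using grading.graded_form_mult[OF grading_tdeg graded_form_const graded_form_Var] by (intro graded_form_add) auto

lemma homogeneous_ideal_ker_lin:
  assumes "\<And>i. subst.ev (lin u v a b) (lin u v a b i) = lin u v a b i"
  shows "homogeneous_ideal {f. subst.ev (lin u v a b) f = 0}"
  unfolding homogeneous_ideal_def
proof (rule exI[of _ "range (\<lambda>i. Var i - lin u v a b i)"], intro conjI ballI)
  show "{f. subst.ev (lin u v a b) f = 0} = ideal.span (range (\<lambda>i. Var i - lin u v a b i))"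
    by (rule span_eq_ker_subst[symmetric]) (rule assms)
  fix f assume "f \<in> range (\<lambda>i. Var i - lin u v a b i)"
  then have "graded_form tdeg 1 f" using graded_form_add[OF graded_form_Var graded_form_uminus[OF graded_form_lin]] by auto
  then show "\<exists>e. homogeneous e f" unfolding homogeneous_iff_hom[symmetric] by blast
qed

lemma homogeneous_ideal_strict:
  assumes "homogeneous_ideal Q" "ideal.subspace P" "\<not> Q \<subseteq> P"
  shows "\<exists>f d. graded_form tdeg d f \<and> f \<in> Q \<and> f \<notin> P"
proof -
  obtain S where S: "\<forall>f\<in>S. \<exists>e. homogeneous e f" "Q = ideal.span S"
    using assms(1) unfolding homogeneous_ideal_def by blast
  have "\<not> S \<subseteq> P" using assms(2,3) S(2) ideal.span_minimal[of S P] by blast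
  then obtain f where f: "f \<in> S" "f \<notin> P" by blast
  then obtain e where e: "homogeneous e f" using S(1) by blast
  have "f \<noteq> 0" using f(2) assms(2) ideal.subspace_0 by blast
  then obtain d where "graded_form tdeg d f" using homogeneous_nat[OF e] e homogeneous_iff_hom by blast
  then show ?thesis using f S(2) ideal.span_base[of f S] by blast
qed

text \<open>The traces of \<open>P\<close> and \<open>Q\<close> on the chart
  \<open>Var v = 1\<close> would be a nonzero prime of K[t] and a strictly larger proper ideal,
  while nonzero primes of K[t] are maximal.\<close>

lemma line_chain_aux:
  fixes a b :: "4 \<Rightarrow> 'k::field"
  assumes "a u = 1" "b u = 0" "a v = 0" "b v = 1"
    and L: "L = {f. subst.ev (lin u v a b) f = 0}"
    and P: "prime_ideal P" "homogeneous_ideal P" "L \<subset> P"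
    and Q: "prime_ideal Q" "homogeneous_ideal Q" "P \<subset> Q" "Var v \<notin> Q"
  shows False
proof -
  let ?\<phi> = "dehom.ev (\<lambda>i. [:b i, a i:])" and ?H = "homog u v :: nat \<Rightarrow> 'k poly \<Rightarrow> 'k poly4"
  define T where "T R = {p. ?H (degree p) p \<in> R}" for R
  note fixed = lin_fixed[of a u b v, OF assms(1-4)]
  have sub: "ideal.subspace R" if "prime_ideal R" for R :: "'k poly4 set"
    using that by (simp add: prime_ideal_def)
  have pow: "Var v ^ k \<notin> R" if R: "prime_ideal R" "Var v \<notin> R" for R :: "'k poly4 set" and k
    using R by (induction k) (auto simp: prime_ideal_def)
  \<comment> \<open>The homogenising degree does not affect membership: raising it multiplies by a
    power of \<open>Var v\<close>, which is outside the prime \<open>R\<close>.\<close>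
  have T_iff: "p \<in> T R \<longleftrightarrow> ?H n p \<in> R" if R: "prime_ideal R" "Var v \<notin> R" and n: "degree p \<le> n" for R p n
  proof -
    have "?H n p = ?H (degree p) p * Var v ^ (n - degree p)"
      using homog_raise[of p "degree p" u v "n - degree p"] n by simp
    then show ?thesis using pow[OF R] R(1) ideal.subspace_scale[OF sub[OF R(1)]]
      unfolding T_def prime_ideal_def by (metis (no_types, lifting) mem_Collect_eq mult.commute)
  qed
  have T_prime: "prime_ideal (T R)" if R: "prime_ideal R" "Var v \<notin> R" for R
    unfolding prime_ideal_def ideal.subspace_def
  proof (intro conjI ballI allI impI)
    show "0 \<in> T R" using ideal.subspace_0[OF sub[OF R(1)]] by (simp add: T_def homog_zero)
    show "1 \<notin> T R" using R(1) by (simp add: T_def homog_def prime_ideal_def)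
  next
    fix p q assume pq: "p \<in> T R" "q \<in> T R"
    let ?n = "max (degree p) (degree q)"
    have "?H ?n p \<in> R" "?H ?n q \<in> R"
      using pq T_iff[OF R, of p ?n] T_iff[OF R, of q ?n] by auto
    then have "?H ?n (p + q) \<in> R" unfolding homog_add by (rule ideal.subspace_add[OF sub[OF R(1)]])
    then show "p + q \<in> T R" using T_iff[OF R, of "p + q" ?n] degree_add_le_max[of p q] by blast
  next
    fix p q
    have *: "p * q \<in> T R \<longleftrightarrow> ?H (degree p) p * ?H (degree q) q \<in> R"
      using T_iff[OF R degree_mult_le[of p q]] homog_mult[OF order_refl order_refl, of u v p q] by simp
    show "p \<in> T R \<or> q \<in> T R" if "p * q \<in> T R"
    proof -
      have "?H (degree p) p * ?H (degree q) q \<in> R" using that unfolding * .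
      then show ?thesis using R(1) unfolding T_def prime_ideal_def by blast
    qed
    show "p * q \<in> T R" if "q \<in> T R"
      unfolding * using that ideal.subspace_scale[OF sub[OF R(1)]] by (simp add: T_def)
  qed
  \<comment> \<open>A form differs from its restriction to the line by an element of
    \<open>L\<close>, so for \<open>R\<close> above \<open>L\<close> its univariate trace decides
    membership.\<close>
  have graded_form_T: "f \<in> R \<longleftrightarrow> ?\<phi> f \<in> T R" if R: "prime_ideal R" "Var v \<notin> R" "L \<subseteq> R" and f: "graded_form tdeg e f" for R f e
  proof -
    note se = subst_lin_eq_homog[OF f, of b a u v]
    have idem: "subst.ev (lin u v a b) (subst.ev (lin u v a b) f) = subst.ev (lin u v a b) f" for f
    proof (induction f rule: poly4_induct)
      case (Var i)
      show ?case unfolding subst.ev_Var by (rule fixed)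
    qed (simp_all add: subst.ev_const subst.ev_add subst.ev_mult)
    have "f - subst.ev (lin u v a b) f \<in> L" unfolding L by (simp add: subst.ev_diff idem)
    then have "f \<in> R \<longleftrightarrow> subst.ev (lin u v a b) f \<in> R"
      using R(3) ideal.subspace_diff[OF sub[OF R(1)], of f "f - subst.ev (lin u v a b) f"]
        ideal.subspace_add[OF sub[OF R(1)], of "f - subst.ev (lin u v a b) f" "subst.ev (lin u v a b) f"] by auto
    also have "\<dots> \<longleftrightarrow> ?\<phi> f \<in> T R" unfolding conjunct2[OF se] T_iff[OF R(1,2) conjunct1[OF se]] ..
    finally show ?thesis .
  qed
  have vP: "Var v \<notin> P" using Q by blast
  have LP: "L \<subseteq> P" and LQ: "L \<subseteq> Q" using P Q by auto
  have Lsub: "ideal.subspace L" using sub[OF prime_ideal_ker_subst] unfolding L .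
  obtain f d where f: "graded_form tdeg d f" "f \<in> P" "f \<notin> L"
    using homogeneous_ideal_strict[OF P(2) Lsub] P(3) by blast
  obtain g e where g: "graded_form tdeg e g" "g \<in> Q" "g \<notin> P"
    using homogeneous_ideal_strict[OF Q(2) sub[OF P(1)]] Q(3) by blast
  have "?\<phi> f \<noteq> 0"
    using f(3) subst_lin_eq_homog[OF f(1), of b a u v] unfolding L by (auto simp: homog_zero)
  moreover have "?\<phi> f \<in> T P" using graded_form_T[OF P(1) vP LP f(1)] f(2) by blast
  moreover have "T P \<subseteq> T Q" using Q(3) unfolding T_def by blast
  moreover have "?\<phi> g \<in> T Q" using graded_form_T[OF Q(1,4) LQ g(1)] g(2) by blast
  moreover have "?\<phi> g \<notin> T P" using graded_form_T[OF P(1) vP LP g(1)] g(3) by blast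
  ultimately have "1 \<in> T Q"
    using prime_ideal_poly_maximal[OF T_prime[OF P(1) vP]] sub T_prime[OF Q(1,4)]
    by (metis prime_ideal_def)
  then show False using T_prime[OF Q(1,4)] by (simp add: prime_ideal_def)
qed

lemma lin_swap: "lin u v a b = lin v u b a"
  by (simp add: lin_def fun_eq_iff add.commute)

text \<open>Every variable is, modulo \<open>L\<close>, a combination of \<open>Var u\<close> and
  \<open>Var v\<close>. As \<open>Q\<close> misses some variable it misses one of these two, and the
  chart is chosen accordingly.\<close>

lemma no_chain_above_line:
  fixes L :: "'k::field poly4 set"
  assumes "is_line L" and P: "prime_ideal P" "homogeneous_ideal P" "L \<subset> P"
    and Q: "prime_ideal Q" "homogeneous_ideal Q" "P \<subset> Q" "Var w \<notin> Q"
  shows False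
proof -
  obtain u v and a b :: "4 \<Rightarrow> 'k" where ab: "a u = 1" "b u = 0" "a v = 0" "b v = 1"
    and L: "L = {f. subst.ev (lin u v a b) f = 0}"
    using assms(1) unfolding is_line_def by blast
  have sub: "ideal.subspace Q" using Q by (simp add: prime_ideal_def)
  have "Var u \<notin> Q \<or> Var v \<notin> Q"
  proof (rule ccontr)
    assume "\<not> (Var u \<notin> Q \<or> Var v \<notin> Q)"
    then have "lin u v a b w \<in> Q"
      unfolding lin_def by (simp add: ideal.subspace_add[OF sub] ideal.subspace_scale[OF sub])
    moreover have "Var w - lin u v a b w \<in> L"
      unfolding L using lin_fixed[of a u b v, OF ab] by (simp add: subst.ev_diff subst.ev_Var)
    then have "Var w - lin u v a b w \<in> Q" using P Q by blast
    ultimately have "Var w - lin u v a b w + lin u v a b w \<in> Q" by (intro ideal.subspace_add[OF sub])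
    then show False using Q by simp
  qed
  then show False
  proof
    assume "Var v \<notin> Q"
    then show False using line_chain_aux[of a u b v, OF ab L P Q(1-3)] by blast
  next
    assume "Var u \<notin> Q"
    moreover have "L = {f. subst.ev (lin v u b a) f = 0}" unfolding L lin_swap[of u v a b] ..
    ultimately show False using line_chain_aux[of b v a u, OF ab(4,3,2,1) _ P Q(1-3)] by blast
  qed
qed

lemma prime_ideal_line: "is_line L \<Longrightarrow> prime_ideal L"
  unfolding is_line_def using prime_ideal_ker_subst by blast

lemma line_not_all_Var: "is_line L \<Longrightarrow> \<exists>i. Var i \<notin> L"
proof -
  assume "is_line L"
  then obtain u v a b where "a u = 1" "b u = 0" "L = {f. subst.ev (lin u v a b) f = 0}"
    unfolding is_line_def by blast
  then have "Var u \<notin> L" by (simp add: subst.ev_Var lin_def Var_nonzero)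
  then show ?thesis by blast
qed

text \<open>A chain of length one is the given line followed by a point on it. In a chain of length
  two the smallest prime would contain a line, with two further strict inclusions above it.\<close>

lemma has_proj_dim_one:
  fixes I :: "'k::field poly4 set"
  assumes "is_line L" "I \<subseteq> L"
    and above: "\<And>Q. prime_ideal Q \<Longrightarrow> I \<subseteq> Q \<Longrightarrow> \<exists>L'. is_line L' \<and> L' \<subseteq> Q"
  shows "has_proj_dim I 1"
  unfolding has_proj_dim_def
proof
  obtain u v and a b :: "4 \<Rightarrow> 'k" where uv: "u \<noteq> v" and ab: "a u = 1" "b u = 0" "a v = 0" "b v = 1"
    and L: "L = {f. subst.ev (lin u v a b) f = 0}"
    using assms(1) unfolding is_line_def by blast
  \<comment> \<open>The prime of the point of the line at which \<open>Var u\<close>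
    vanishes.\<close>
  define M where "M = {f. subst.ev (lin u v (\<lambda>_. 0) b) f = 0}"
  have y: "lin u v (\<lambda>_. 0) b i = mon 0 (b i) * Var v" for i by (simp add: lin_def)
  have l: "lin u v (\<lambda>_. 0) b u = 0" "lin u v (\<lambda>_. 0) b v = Var v" using ab by (simp_all add: lin_def)
  have fixed': "subst.ev (lin u v (\<lambda>_. 0) b) (lin u v (\<lambda>_. 0) b i) = lin u v (\<lambda>_. 0) b i" for i
    using ab by (simp add: y subst.ev_mult subst.ev_const subst.ev_Var)
  note fixed = lin_fixed[of a u b v, OF ab]
  have "L = ideal.span (range (\<lambda>i. Var i - lin u v a b i))"
    unfolding L by (rule span_eq_ker_subst[symmetric]) (rule fixed)
  also have "\<dots> \<subseteq> M"
  proof (rule ideal.span_minimal)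
    show "range (\<lambda>i. Var i - lin u v a b i) \<subseteq> M"
      unfolding M_def
      by (auto simp: subst.ev_diff subst.ev_Var, subst (2) lin_def,
          simp add: subst.ev_add subst.ev_mult subst.ev_const subst.ev_Var l, simp add: lin_def)
    show "ideal.subspace M" using prime_ideal_ker_subst unfolding M_def prime_ideal_def by blast
  qed
  finally have LM: "L \<subseteq> M" .
  have "Var u \<in> M" unfolding M_def by (simp add: subst.ev_Var l)
  moreover have "Var u \<notin> L" unfolding L by (simp add: subst.ev_Var lin_def ab Var_nonzero)
  ultimately have strict: "L \<subset> M" using LM by blast
  have M: "prime_ideal M" "homogeneous_ideal M" "Var v \<notin> M"
    unfolding M_def by (simp_all add: prime_ideal_ker_subst homogeneous_ideal_ker_lin[OF fixed'] subst.ev_Var l Var_nonzero)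
  have L': "prime_ideal L" "homogeneous_ideal L" "Var v \<notin> L"
    unfolding L by (simp_all add: prime_ideal_ker_subst homogeneous_ideal_ker_lin[OF fixed]
      subst.ev_Var lin_def ab Var_nonzero)
  show "proj_chain I 1"
    unfolding proj_chain_def
  proof (rule exI[of _ "\<lambda>n. if n = 0 then L else M"], intro conjI allI impI)
    fix i :: nat
    show "prime_ideal (if i = 0 then L else M)" "homogeneous_ideal (if i = 0 then L else M)"
      "\<exists>v. Var v \<notin> (if i = 0 then L else M)" "I \<subseteq> (if i = 0 then L else M)"
      using L' M LM assms(2) by auto
    assume "i < 1"
    then show "(if i = 0 then L else M) \<subset> (if Suc i = 0 then L else M)" using strict by simp
  qed
  show "\<not> proj_chain I (Suc 1)"
  proof
    assume "proj_chain I (Suc 1)"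
    then obtain Q :: "nat \<Rightarrow> 'k poly4 set" where
      Q: "\<And>i. i \<le> 2 \<Longrightarrow> prime_ideal (Q i) \<and> homogeneous_ideal (Q i) \<and> (\<exists>v. Var v \<notin> Q i) \<and> I \<subseteq> Q i"
      and lt: "\<And>i. i < 2 \<Longrightarrow> Q i \<subset> Q (Suc i)"
      unfolding proj_chain_def by (metis Suc_1)
    obtain L' where "is_line L'" "L' \<subseteq> Q 0" using above[of "Q 0"] Q[of 0] by auto
    moreover have "Q 0 \<subset> Q 1" "Q 1 \<subset> Q 2" using lt[of 0] lt[of 1] by (simp_all add: numeral_2_eq_2)
    moreover obtain w where "Var w \<notin> Q 2" using Q[of 2] by blast
    ultimately show False using no_chain_above_line[of L' "Q 1" "Q 2" w] Q[of 1] Q[of 2] by auto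
  qed
qed

text \<open>An associated prime lies inside a line by \<open>unm\<close> and contains one by
  \<open>above\<close>, hence has dimension one. If powers of all variables multiplied
  \<open>f\<close> into \<open>I\<close>, then all variables would lie in the prime of one line;
  this gives saturation.\<close>

lemma is_curveI:
  fixes I :: "'k::field poly4 set"
  assumes sub: "ideal.subspace I" and graded: "\<And>f d. f \<in> I \<Longrightarrow> graded_part tdeg d f \<in> I" and one: "1 \<notin> I"
    and unm: "unmixed_by {L. is_line L} I"
    and above: "\<And>Q. prime_ideal Q \<Longrightarrow> I \<subseteq> Q \<Longrightarrow> \<exists>L'. is_line L' \<and> L' \<subseteq> Q"
  shows "is_curve I"
  unfolding is_curve_def
proof (intro conjI allI impI)
  show "homogeneous_ideal I"
    unfolding homogeneous_ideal_def
  proof (rule exI[of _ "{f \<in> I. \<exists>d. graded_form tdeg d f}"], intro conjI ballI)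
    let ?S = "{f \<in> I. \<exists>d. graded_form tdeg d f}"
    show "\<exists>e. homogeneous e f" if "f \<in> ?S" for f using that homogeneous_iff_hom by blast
    show "I = ideal.span ?S"
    proof
      show "ideal.span ?S \<subseteq> I" by (rule ideal.span_minimal[OF _ sub]) blast
      show "I \<subseteq> ideal.span ?S"
      proof
        fix f assume f: "f \<in> I"
        obtain n where "\<forall>m\<in>keys f. tdeg m < n" using keys_bounded[of f tdeg] by blast
        then have "f = (\<Sum>d<n. graded_part tdeg d f)" by (intro sum_graded_part) blast
        also have "\<dots> \<in> ideal.span ?S"
          using graded[OF f] graded_form_graded_part by (intro ideal.span_sum ideal.span_base) blast
        finally show "f \<in> ideal.span ?S" .
      qed
    qed
  qed
  show "saturated I"
    unfolding saturated_def
  proof (intro allI impI, rule ccontr)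
    fix f assume f: "\<forall>i. \<exists>n. Var i ^ n * f \<in> I" "f \<notin> I"
    obtain L where L: "is_line L" "\<forall>g. g * f \<in> I \<longrightarrow> g \<in> L" using unmixed_byD[OF unm f(2)] by blast
    have pr: "prime_ideal L" by (rule prime_ideal_line[OF L(1)])
    have "Var i \<in> L" for i
    proof -
      obtain n where "Var i ^ n \<in> L" using f(1) L(2) by blast
      then show ?thesis using pr by (induction n) (auto simp: prime_ideal_def)
    qed
    then show False using line_not_all_Var[OF L(1)] by blast
  qed
  obtain L where L: "is_line L" "\<forall>g. g * 1 \<in> I \<longrightarrow> g \<in> L" using unmixed_byD[OF unm one] by blast
  then have "I \<subseteq> L" by auto
  then show "has_proj_dim I 1" by (rule has_proj_dim_one[OF L(1) _ above])
  fix P assume "associated_prime P I"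
  then obtain f where P: "prime_ideal P" "P = {g. g * f \<in> I}" unfolding associated_prime_def by blast
  then have "f \<notin> I" by (auto simp: prime_ideal_def)
  from unmixed_byD[OF unm this] obtain L where L: "is_line L" "P \<subseteq> L" unfolding P(2) by blast
  have "I \<subseteq> P" unfolding P(2) using ideal.subspace_scale[OF sub, of _ f] by (auto simp: mult.commute)
  then obtain L' where L': "is_line L'" "L' \<subseteq> P" using above[OF P(1)] by blast
  show "has_proj_dim P 1" by (rule has_proj_dim_one[OF L]) (use L' in blast)
qed

text \<open>\<open>c = 0\<close> gives the coordinate lines, \<open>c = 1\<close> the lines on which
  \<open>Var i\<close> and \<open>Var j + Var k\<close> vanish.\<close>

lemma is_line_span:
  assumes d: "distinct [i, j, k, l :: 4]"
  shows "is_line (ideal.span {Var i, Var j + mon 0 c * Var k :: 'k::field poly4})"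
proof -
  let ?r = "mon 0 c * Var k :: 'k poly4"
  \<comment> \<open>\<open>Var k\<close> and \<open>Var l\<close> are the coordinates on this line,
    where \<open>Var i\<close> is 0 and \<open>Var j\<close> is \<open>- c * Var k\<close>.\<close>
  let ?a = "(\<lambda>_. 0)(j := - c, k := 1)" and ?b = "(\<lambda>_. 0)(l := 1) :: 4 \<Rightarrow> 'k"
  have "lin k l ?a ?b n = (Var(i := 0, j := - ?r)) n" for n
  proof -
    consider "n = i" | "n = j" | "n = k" | "n = l" using UNIV_distinct4[OF d] by blast
    then show ?thesis using d by cases (auto simp: lin_def single_uminus)
  qed
  then have *: "lin k l ?a ?b = Var(i := 0, j := - ?r)" by (rule ext)
  have "ideal.span {Var i, Var j + ?r} = {f. subst.ev (lin k l ?a ?b) f = 0}"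
    unfolding * using d by (intro span_Var_line) (auto simp: subst.ev_mult subst.ev_const subst.ev_Var)
  then show ?thesis using d unfolding is_line_def by (intro exI[of _ k] exI[of _ l] exI[of _ ?a] exI[of _ ?b]) auto
qed

section \<open>Linkage of tetrahedral curves\<close>

lemma subspace_ideal_quotient: "ideal.subspace X \<Longrightarrow> ideal.subspace (ideal_quotient X J)"
  unfolding ideal_quotient_def ideal.subspace_def
  by (auto simp: distrib_right mult.assoc)

lemma subset_ideal_quotient: "ideal.subspace X \<Longrightarrow> X \<subseteq> ideal_quotient X J"
  using ideal.subspace_scale[of X] by (auto simp: ideal_quotient_def mult.commute)

lemma subset_double_quotient: "J \<subseteq> ideal_quotient X (ideal_quotient X J)"
  unfolding ideal_quotient_def by (auto simp: mult.commute)

lemma prime_ideal_prod_list: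
  assumes "prime_ideal Q" "prod_list ls \<in> Q"
  shows "\<exists>l\<in>set ls. l \<in> Q"
  using assms(2) by (induction ls) (use assms(1) in \<open>auto simp: prime_ideal_def\<close>)

lemma prime_ideal_power: "prime_ideal Q \<Longrightarrow> x \<notin> Q \<Longrightarrow> x ^ n \<notin> Q"
  by (induction n) (auto simp: prime_ideal_def)

lemma prime_ideal_mult: "prime_ideal Q \<Longrightarrow> x \<notin> Q \<Longrightarrow> y \<notin> Q \<Longrightarrow> x * y \<notin> Q"
  by (auto simp: prime_ideal_def)

text \<open>With completely split generators every component of the complete intersection is an
  explicit line, over any field.\<close>

locale linear_ci =
  fixes ls ks :: "'k::field poly4 list"
  assumes prime_ls: "l \<in> set ls \<Longrightarrow> prime_elem l"
    and graded_form_ls: "l \<in> set ls \<Longrightarrow> graded_form tdeg 1 l"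
    and graded_form_ks: "k \<in> set ks \<Longrightarrow> graded_form tdeg 1 k"
    and not_dvd: "l \<in> set ls \<Longrightarrow> k \<in> set ks \<Longrightarrow> \<not> l dvd k"
    and line: "l \<in> set ls \<Longrightarrow> k \<in> set ks \<Longrightarrow> is_line (ideal.span {l, k})"
begin

definition X where "X = ideal.span {prod_list ls, prod_list ks}"

lemma graded_form_prods: "graded_form tdeg (length ls) (prod_list ls)" "graded_form tdeg (length ks) (prod_list ks)"
  using grading.graded_form_prod_list[OF grading_tdeg] graded_form_ls graded_form_ks by blast+

lemma subspace_X: "ideal.subspace X"
  by (simp add: X_def)

lemma graded_part_X: "f \<in> X \<Longrightarrow> graded_part tdeg d f \<in> X"
  unfolding X_def by (rule grading.graded_part_span_pair[OF grading_tdeg graded_form_prods])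

lemma unmixed_X: "unmixed_by {L. is_line L} X"
  unfolding X_def by (rule unmixed_by_prod_lists) (auto simp: prime_ls not_dvd line prime_ideal_line)

lemma line_below_prime:
  assumes "prime_ideal Q" "X \<subseteq> Q"
  shows "\<exists>L. is_line L \<and> L \<subseteq> Q"
proof -
  have "prod_list ls \<in> Q" "prod_list ks \<in> Q"
    using assms(2) unfolding X_def by (auto simp: ideal.span_base subset_iff)
  then obtain l k where lk: "l \<in> set ls" "k \<in> set ks" "l \<in> Q" "k \<in> Q"
    using prime_ideal_prod_list[OF assms(1)] by blast
  then have "ideal.span {l, k} \<subseteq> Q"
    using assms(1) by (intro ideal.span_minimal) (auto simp: prime_ideal_def)
  then show ?thesis using line lk by blast
qed

lemma complete_intersection_X:
  assumes "1 \<notin> X"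
  shows "complete_intersection_curve X"
  unfolding complete_intersection_curve_def
proof
  show "is_curve X"
    by (rule is_curveI[OF subspace_X graded_part_X assms unmixed_X line_below_prime])
  have "homogeneous (int (length ls)) (prod_list ls)" "homogeneous (int (length ks)) (prod_list ks)"
    unfolding homogeneous_iff_hom by (rule graded_form_prods)+
  then show "\<exists>F G d e. homogeneous d F \<and> homogeneous e G \<and> X = ideal.span {F, G}"
    unfolding X_def by blast
qed

text \<open>A colon by a monomial ideal can be tested on monomials. These are homogeneous, so
  multiplying by one commutes, up to a shift of degree, with taking graded parts; hence the colon is
  homogeneous.\<close>

lemma is_curve_quotient_mon_ideal:
  assumes "\<not> mon_ideal S \<subseteq> X"
  shows "is_curve (ideal_quotient X (mon_ideal S))" (is "is_curve ?D")
proof (rule is_curveI)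
  show "ideal.subspace ?D" by (rule subspace_ideal_quotient[OF subspace_X])
  show "1 \<notin> ?D" using assms unfolding ideal_quotient_def by auto
  show "unmixed_by {L. is_line L} ?D" by (rule unmixed_by_quotient[OF unmixed_X])
  show "\<exists>L. is_line L \<and> L \<subseteq> Q" if "prime_ideal Q" "?D \<subseteq> Q" for Q
    using line_below_prime[OF that(1)] that(2) subset_ideal_quotient[OF subspace_X] by blast
  fix f d assume f: "f \<in> ?D"
  show "graded_part tdeg d f \<in> ?D"
    unfolding ideal_quotient_def
  proof (intro CollectI ballI)
    fix g :: "'k poly4" assume g: "g \<in> mon_ideal S"
    show "graded_part tdeg d f * g \<in> X"
    proof (rule poly_monomials_induct[of "\<lambda>g. graded_part tdeg d f * g \<in> X"])
      show "graded_part tdeg d f * 0 \<in> X" by (simp add: ideal.subspace_0[OF subspace_X])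
      show "graded_part tdeg d f * (p + q) \<in> X" if "graded_part tdeg d f * p \<in> X" "graded_part tdeg d f * q \<in> X" for p q
        unfolding distrib_left using that by (rule ideal.subspace_add[OF subspace_X])
      fix m assume "m \<in> keys g"
      then have "mon m (lk g m) \<in> mon_ideal S" using g by (auto simp: mon_ideal_def)
      then have "f * mon m (lk g m) \<in> X" using f unfolding ideal_quotient_def by blast
      then have "graded_part tdeg (d + tdeg m) (f * mon m (lk g m)) \<in> X" by (rule graded_part_X)
      moreover have "graded_form tdeg (tdeg m) (mon m (lk g m))" by (simp add: graded_form_def)
      ultimately show "graded_part tdeg d f * mon m (lk g m) \<in> X"
        by (simp add: grading.graded_part_mult_hom[OF grading_tdeg])
    qed
  qed
qed

end

lemma span_Var_Var_Var_add: "ideal.span {Var x, Var x + Var y} = ideal.span {Var x, Var y :: 'k::field poly4}"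
proof (rule antisym; rule ideal.span_minimal)
  have "(Var x + Var y :: 'k poly4) - Var x \<in> ideal.span {Var x, Var x + Var y}"
    by (intro ideal.span_diff ideal.span_base) auto
  then show "{Var x, Var y :: 'k poly4} \<subseteq> ideal.span {Var x, Var x + Var y}"
    by (auto simp: ideal.span_base)
  show "{Var x, Var x + Var y :: 'k poly4} \<subseteq> ideal.span {Var x, Var y}"
    by (auto simp: ideal.span_base intro: ideal.span_add)
qed auto

lemma mon_index_eq_iff: "mon x (1::nat) = mon y 1 \<longleftrightarrow> x = y"
proof
  assume "mon x (1::nat) = mon y 1"
  then have "lk (mon x (1::nat)) x = lk (mon y 1) x" by simp
  then show "x = y" by (simp add: lookup_single when_def split: if_splits)
qed simp

lemma Var_dvd_imp_subst_zero: "Var x dvd f \<Longrightarrow> subst.ev (Var(x := 0)) f = 0"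
  by (auto elim!: dvdE simp: subst.ev_mult subst.ev_Var)

lemma Var_add_nonzero:
  assumes "y \<noteq> z"
  shows "Var y + Var z \<noteq> (0 :: 'k::field poly4)"
proof -
  have "lk (Var y + Var z :: 'k poly4) (mon y 1) = 1"
    using assms mon_index_eq_iff[of y z] by (auto simp: Var_def lookup_add lookup_single when_def)
  then show ?thesis by auto
qed

lemma Var_not_dvd_Var_add:
  assumes "y \<noteq> z"
  shows "\<not> Var x dvd (Var y + Var z :: 'k::field poly4)"
proof
  assume "Var x dvd (Var y + Var z :: 'k poly4)"
  from Var_dvd_imp_subst_zero[OF this] show False
    using assms Var_add_nonzero[OF assms, where 'k = 'k] by (auto simp: subst.ev_add subst.ev_Var Var_nonzero split: if_splits)
qed

lemma power_line_power: "f \<in> line_power i j 1 \<Longrightarrow> f ^ n \<in> line_power i j n"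
proof (induction n)
  case (Suc n)
  then show ?case using line_power_mult[where f = f and g = "f ^ n" and a = 1 and b = n and i = i and j = j] by simp
qed (simp add: mon_ideal_def)

lemma graded_form_line_deg_Var: "graded_form (line_deg i j) (lk (mon k 1) i + lk (mon k 1) j) (Var k)"
  by (simp add: graded_form_def Var_def)

text \<open>One of the four systems whose failure at every vertex is S-minimality: at
  \<open>v\<close>, no opposite edge exceeds the sum of the two edges that join it to
  \<open>v\<close>.\<close>

locale star =
  fixes w :: "4 \<Rightarrow> 4 \<Rightarrow> nat" and v i j k :: 4
  assumes sym: "w x y = w y x" and dist: "distinct [v, i, j, k]"
    and star: "w i j \<le> w v i + w v j" "w i k \<le> w v i + w v k" "w j k \<le> w v j + w v k"
begin

definition F :: "'k::field poly4" where
  "F = Var i ^ w v i * Var j ^ w v j * Var k ^ w v k"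

text \<open>At the line \<open>(v, i)\<close> the relevant factors are \<open>Var i ^ w v i\<close>
  of \<open>F\<close> and \<open>Var v ^ m\<close> of \<open>G\<close>. At \<open>(i, j)\<close>
  they are \<open>Var i ^ w v i * Var j ^ w v j\<close> and \<open>(Var i + Var j) ^ w i j\<close>,
  and the star inequality says that \<open>F\<close> too vanishes there to order
  \<open>w i j\<close>.\<close>

definition G :: "nat \<Rightarrow> 'k::field poly4" where
  "G m = Var v ^ m * (Var i + Var j) ^ w i j * (Var i + Var k) ^ w i k * (Var j + Var k) ^ w j k"

text \<open>\<open>i\<close>, \<open>j\<close>, \<open>k\<close> play symmetric roles, so only the
  lines of the edges \<open>v i\<close> and \<open>i j\<close> need a computation.\<close>

lemma star_perm: "star w v j i k" "star w v i k j"
  using sym dist star by (auto simp: star_def add.commute)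

lemma F_perm: "star.F w v j i k = (F :: 'k::field poly4)" "star.F w v i k j = (F :: 'k poly4)"
  unfolding star.F_def[OF star_perm(1)] star.F_def[OF star_perm(2)] F_def by (simp_all only: mult_ac)

lemma G_perm: "star.G w v j i k m = (G m :: 'k::field poly4)" "star.G w v i k j m = (G m :: 'k poly4)"
  unfolding star.G_def[OF star_perm(1)] star.G_def[OF star_perm(2)] G_def
    sym[of j i] sym[of k j] add.commute[of "Var j" "Var i"] add.commute[of "Var k" "Var j"]
  by (simp_all only: mult_ac)

text \<open>All factors other than the powers of \<open>Var i\<close> and \<open>Var v\<close> are
  units at this line. The order \<open>n\<close> may be smaller than \<open>w v i\<close>, so that
  the lowered weights are covered as well.\<close>

lemma double_colon_vi:
  assumes "n \<le> w v i" "n \<le> m" "J \<subseteq> line_power v i n"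
    and X: "X = ideal.span {F, G m :: 'k::field poly4}"
  shows "X \<subseteq> line_power v i n \<and> ideal_quotient X (ideal_quotient X J) \<subseteq> line_power v i n"
proof
  have d: "v \<noteq> i" "v \<noteq> j" "v \<noteq> k" "i \<noteq> j" "i \<noteq> k" "j \<noteq> k" using dist by auto
  have mult: "f * g \<in> line_power v i n" if "f \<in> line_power v i n" for f g :: "'k poly4"
    using line_power_scale[OF that, of g] by (simp add: mult.commute)
  have "Var i ^ w v i \<in> line_power v i n"
    by (rule line_power_mono[OF assms(1)], intro power_line_power Var_line_power)
  then have "(F :: 'k poly4) \<in> line_power v i n" unfolding F_def by (intro mult)
  moreover have "Var v ^ m \<in> line_power v i n"
    by (rule line_power_mono[OF assms(2)], intro power_line_power Var_line_power)
  then have "(G m :: 'k poly4) \<in> line_power v i n" unfolding G_def by (intro mult)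
  ultimately show "X \<subseteq> line_power v i n"
    unfolding X by (intro ideal.span_minimal subspace_line_power) auto
  let ?P = "ideal.span {Var v, Var i :: 'k poly4}"
  have P: "prime_ideal ?P" by (rule prime_ideal_span_Var_Var[OF d(1)])
  have nin: "Var j \<notin> ?P" "Var k \<notin> ?P" "Var i + Var j \<notin> ?P" "Var i + Var k \<notin> ?P" "Var j + Var k \<notin> ?P"
    unfolding mem_span_Var_Var[OF d(1)]
    using d by (auto simp: subst.ev_Var subst.ev_add Var_nonzero Var_add_nonzero)
  let ?ls = "replicate (w v i) (Var i :: 'k poly4)" and ?ks = "replicate m (Var v :: 'k poly4)"
  have X': "X = ideal.span {prod_list ?ls * (Var j ^ w v j * Var k ^ w v k),
    prod_list ?ks * ((Var i + Var j) ^ w i j * (Var i + Var k) ^ w i k * (Var j + Var k) ^ w j k)}"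
    unfolding X F_def G_def by (simp add: prod_list_replicate mult.assoc)
  show "ideal_quotient X (ideal_quotient X J) \<subseteq> line_power v i n"
  proof
    fix f assume f: "f \<in> ideal_quotient X (ideal_quotient X J)"
    show "f \<in> line_power v i n"
    proof (rule double_colon_line[OF d(1) _ _ _ _ _ _ _ _ X' assms(3) f])
      show "Var j ^ w v j * Var k ^ w v k \<notin> ?P"
        by (intro prime_ideal_mult prime_ideal_power P nin)
      show "(Var i + Var j) ^ w i j * (Var i + Var k) ^ w i k * (Var j + Var k) ^ w j k \<notin> ?P"
        by (intro prime_ideal_mult prime_ideal_power P nin)
      show "prime_elem l \<and> graded_form (line_deg v i) 1 l" if "l \<in> set ?ls" for l
        using that d graded_form_line_deg_Var[of v i i, where 'a = 'k]
        by (auto simp: prime_elem_Var lookup_single when_def split: if_splits)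
      show "graded_form (line_deg v i) 1 l" if "l \<in> set ?ks" for l
        using that d graded_form_line_deg_Var[of v i v, where 'a = 'k]
        by (auto simp: lookup_single when_def split: if_splits)
      show "\<not> l dvd l'" if "l \<in> set ?ls" "l' \<in> set ?ks" for l l'
        using that d Var_not_dvd_Var[of i v] by (auto split: if_splits)
      show "ideal.span {l, l'} = ?P" if "l \<in> set ?ls" "l' \<in> set ?ks" for l l'
        using that by (auto simp: insert_commute split: if_splits)
    qed (use assms in auto)
  qed
qed

text \<open>The binary form cut from \<open>F\<close> has degree \<open>w v i + w v j\<close>.
  Double colon duality needs this to be at least \<open>w i j\<close>, and that is the star
  inequality.\<close>

lemma double_colon_ij:
  assumes "J \<subseteq> line_power i j (w i j)"
    and X: "X = ideal.span {F, G m :: 'k::field poly4}"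
  shows "X \<subseteq> line_power i j (w i j) \<and> ideal_quotient X (ideal_quotient X J) \<subseteq> line_power i j (w i j)"
proof
  have d: "v \<noteq> i" "v \<noteq> j" "v \<noteq> k" "i \<noteq> j" "i \<noteq> k" "j \<noteq> k" using dist by auto
  have mult: "f * g \<in> line_power i j n" if "f \<in> line_power i j n" for f g :: "'k poly4" and n
    using line_power_scale[OF that, of g] by (simp add: mult.commute)
  have "Var i ^ w v i * Var j ^ w v j \<in> line_power i j (w v i + w v j)"
    by (intro line_power_mult power_line_power Var_line_power)
  then have "Var i ^ w v i * Var j ^ w v j \<in> line_power i j (w i j)"
    by (rule line_power_mono[OF star(1)])
  then have "(F :: 'k poly4) \<in> line_power i j (w i j)" unfolding F_def by (rule mult)
  moreover have "(Var i + Var j :: 'k poly4) ^ w i j \<in> line_power i j (w i j)"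
    by (intro power_line_power line_power_add Var_line_power)
  then have "(Var i + Var j :: 'k poly4) ^ w i j * (Var v ^ m * (Var i + Var k) ^ w i k * (Var j + Var k) ^ w j k)
      \<in> line_power i j (w i j)" by (rule mult)
  then have "(G m :: 'k poly4) \<in> line_power i j (w i j)" unfolding G_def by (simp only: mult_ac)
  ultimately show "X \<subseteq> line_power i j (w i j)"
    unfolding X by (intro ideal.span_minimal subspace_line_power) auto
  let ?P = "ideal.span {Var i, Var j :: 'k poly4}"
  have P: "prime_ideal ?P" by (rule prime_ideal_span_Var_Var[OF d(4)])
  have nin: "Var k \<notin> ?P" "Var v \<notin> ?P" "Var i + Var k \<notin> ?P" "Var j + Var k \<notin> ?P"
    unfolding mem_span_Var_Var[OF d(4)]
    using d by (auto simp: subst.ev_Var subst.ev_add Var_nonzero)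
  let ?ls = "replicate (w v i) (Var i :: 'k poly4) @ replicate (w v j) (Var j)"
  let ?ks = "replicate (w i j) (Var i + Var j :: 'k poly4)"
  have "G m = prod_list ?ks * (Var v ^ m * (Var i + Var k) ^ w i k * (Var j + Var k) ^ w j k)"
    unfolding G_def prod_list_replicate by (simp only: mult_ac)
  then have X': "X = ideal.span {prod_list ?ls * Var k ^ w v k,
    prod_list ?ks * (Var v ^ m * (Var i + Var k) ^ w i k * (Var j + Var k) ^ w j k)}"
    unfolding X F_def by (simp only: prod_list_replicate prod_list.append)
  show "ideal_quotient X (ideal_quotient X J) \<subseteq> line_power i j (w i j)"
  proof
    fix f assume f: "f \<in> ideal_quotient X (ideal_quotient X J)"
    show "f \<in> line_power i j (w i j)"
    proof (rule double_colon_line[OF d(4) _ _ _ _ _ _ _ _ X' assms(1) f])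
      show "Var k ^ w v k \<notin> ?P"
        by (intro prime_ideal_power P nin)
      show "Var v ^ m * (Var i + Var k) ^ w i k * (Var j + Var k) ^ w j k \<notin> ?P"
        by (intro prime_ideal_mult prime_ideal_power P nin)
      have h: "graded_form (line_deg i j) 1 (Var i :: 'k poly4)" "graded_form (line_deg i j) 1 (Var j :: 'k poly4)"
        using d graded_form_line_deg_Var[of i j i, where 'a = 'k] graded_form_line_deg_Var[of i j j, where 'a = 'k]
        by (simp_all add: lookup_single when_def)
      show "prime_elem l \<and> graded_form (line_deg i j) 1 l" if "l \<in> set ?ls" for l
        using that h by (auto simp: prime_elem_Var split: if_splits)
      show "graded_form (line_deg i j) 1 l" if "l \<in> set ?ks" for l
        using that graded_form_add[OF h] by (auto split: if_splits)
      show "\<not> l dvd l'" if "l \<in> set ?ls" "l' \<in> set ?ks" for l l'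
        using that Var_not_dvd_Var_add[OF d(4), where 'k = 'k] by (auto split: if_splits)
      have "ideal.span {Var j, Var i + Var j} = ?P"
        using span_Var_Var_Var_add[of j i, where 'k = 'k] by (simp add: add.commute insert_commute)
      then show "ideal.span {l, l'} = ?P" if "l \<in> set ?ls" "l' \<in> set ?ks" for l l'
        using that span_Var_Var_Var_add[of i j, where 'k = 'k] by (auto split: if_splits)
    qed (use star(1) in auto)
  qed
qed

end

lemma is_line_Var_Var:
  assumes "x \<noteq> y"
  shows "is_line (ideal.span {Var x, Var y :: 'k::field poly4})"
proof -
  obtain r s where "distinct [x, y, r, s]" using complete2_distinct4[OF assms] .
  from is_line_span[OF this, of "0 :: 'k"] show ?thesis by simp
qed

lemma is_line_Var_Var_add:
  assumes "y \<noteq> z"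
  shows "is_line (ideal.span {Var x, Var y + Var z :: 'k::field poly4})"
proof -
  consider "x = y" | "x = z" | "distinct [x, y, z]" using assms by auto
  then show ?thesis
  proof cases
    case 1
    then show ?thesis using is_line_Var_Var[OF assms] by (simp add: span_Var_Var_Var_add)
  next
    case 2
    then show ?thesis
      using is_line_Var_Var[of z y, where 'k = 'k] assms
      by (simp add: add.commute[of "Var y"] span_Var_Var_Var_add)
  next
    case 3
    then have "card (UNIV - {x, y, z}) = 1" by (simp add: card_Diff_subset)
    then obtain r where "UNIV - {x, y, z} = {r}" by (auto simp: card_1_singleton_iff)
    then have "distinct [x, y, z, r]" using 3 by auto
    from is_line_span[OF this, of "1 :: 'k"] show ?thesis by simp
  qed
qed

text \<open>Truncated subtraction leaves a zero weight at zero.\<close>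

definition lower :: "4 \<Rightarrow> (4 \<Rightarrow> 4 \<Rightarrow> nat) \<Rightarrow> 4 \<Rightarrow> 4 \<Rightarrow> nat" where
  "lower v w x y = (if x = v \<or> y = v then w x y - 1 else w x y)"

context star
begin

lemma UNIV_eq: "UNIV = {v, i, j, k}"
  by (rule UNIV_distinct4[OF dist])

lemma linear_ci:
  "linear_ci (replicate (w v i) (Var i :: 'k::field poly4) @ replicate (w v j) (Var j) @ replicate (w v k) (Var k))
    (replicate m (Var v) @ replicate (w i j) (Var i + Var j) @ replicate (w i k) (Var i + Var k) @
      replicate (w j k) (Var j + Var k))" (is "linear_ci ?ls ?ks")
proof
  have d: "v \<noteq> i" "v \<noteq> j" "v \<noteq> k" "i \<noteq> j" "i \<noteq> k" "j \<noteq> k" using dist by auto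
  have ls: "\<exists>x. l = Var x \<and> x \<noteq> v" if "l \<in> set ?ls" for l
    using that d by (auto split: if_splits)
  have ks: "l = Var v \<or> (\<exists>y z. y \<noteq> z \<and> l = Var y + Var z)" if "l \<in> set ?ks" for l
    using that d by (auto split: if_splits)
  show "prime_elem l" "graded_form tdeg 1 l" if "l \<in> set ?ls" for l
    using ls[OF that] graded_form_Var prime_elem_Var by auto
  show "graded_form tdeg 1 l" if "l \<in> set ?ks" for l
    using ks[OF that] graded_form_add[OF graded_form_Var graded_form_Var] graded_form_Var by auto
  show "\<not> l dvd l'" "is_line (ideal.span {l, l'})" if "l \<in> set ?ls" "l' \<in> set ?ks" for l l'
    using ls[OF that(1)] ks[OF that(2)]
    by (auto simp: Var_not_dvd_Var Var_not_dvd_Var_add is_line_Var_Var is_line_Var_Var_add)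
qed

lemma prod_ls: "prod_list (replicate (w v i) (Var i :: 'k::field poly4) @ replicate (w v j) (Var j) @
    replicate (w v k) (Var k)) = F"
  by (simp add: F_def prod_list_replicate mult.assoc)

lemma prod_ks: "prod_list (replicate m (Var v :: 'k::field poly4) @ replicate (w i j) (Var i + Var j) @
    replicate (w i k) (Var i + Var k) @ replicate (w j k) (Var j + Var k)) = G m"
  by (simp add: G_def prod_list_replicate mult.assoc)

text \<open>A tetrahedral ideal is an intersection of powers of line ideals, so duality is checked
  on six lines. The weights \<open>u\<close> are separate from \<open>w\<close> because the result
  is applied to \<open>w\<close> and to \<open>lower v w\<close>.\<close>

lemma double_colon_tetra:
  fixes X :: "'k::field poly4 set"
  assumes u: "\<And>x y. u x y = u y x"
    and le: "\<And>x. x \<noteq> v \<Longrightarrow> u v x \<le> w v x \<and> u v x \<le> m"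
    and eq: "u i j = w i j" "u i k = w i k" "u j k = w j k"
    and X: "X = ideal.span {F, G m}"
  shows "X \<subseteq> tetra u \<and> ideal_quotient X (ideal_quotient X (tetra u)) = tetra u"
proof -
  have d: "v \<noteq> i" "v \<noteq> j" "v \<noteq> k" "i \<noteq> j" "i \<noteq> k" "j \<noteq> k" using dist by auto
  let ?Q = "\<lambda>x y. X \<subseteq> line_power x y (u x y) \<and>
    ideal_quotient X (ideal_quotient X (tetra u)) \<subseteq> line_power x y (u x y)"
  have swap: "?Q y x" if "?Q x y" for x y using that by (simp add: u[of y x] add.commute)
  have s3: "star w v k i j" and s4: "star w v j k i"
    using star.star_perm(1)[OF star_perm(2)] star.star_perm(2)[OF star_perm(1)] by auto
  have F3: "star.F w v k i j = (F :: 'k poly4)" "star.F w v j k i = (F :: 'k poly4)"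
    using star.F_perm(1)[OF star_perm(2), where 'k = 'k] star.F_perm(2)[OF star_perm(1), where 'k = 'k]
      F_perm[where 'k = 'k] by simp_all
  have G3: "star.G w v k i j m = (G m :: 'k poly4)" "star.G w v j k i m = (G m :: 'k poly4)"
    using star.G_perm(1)[OF star_perm(2), where 'k = 'k] star.G_perm(2)[OF star_perm(1), where 'k = 'k]
      G_perm[where 'k = 'k] by simp_all
  note t = tetra_subset_line_power
  have vi: "?Q v i"
    by (rule double_colon_vi[OF _ _ t X]) (use le d in auto)
  have vj: "?Q v j"
    by (rule star.double_colon_vi[OF star_perm(1) _ _ t, where m = m]) (use le d in \<open>auto simp: X F_perm G_perm\<close>)
  have vk: "?Q v k"
    by (rule star.double_colon_vi[OF s3 _ _ t, where m = m]) (use le d in \<open>auto simp: X F3 G3\<close>)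
  have ij: "?Q i j"
    unfolding eq by (rule double_colon_ij[OF t[OF d(4), of u, unfolded eq] X])
  have ik: "?Q i k"
    unfolding eq by (rule star.double_colon_ij[OF star_perm(2) t[OF d(5), of u, unfolded eq], where m = m])
      (simp add: X F_perm G_perm)
  have jk: "?Q j k"
    unfolding eq by (rule star.double_colon_ij[OF s4 t[OF d(6), of u, unfolded eq], where m = m])
      (simp add: X F3 G3)
  have all: "?Q x y" if "x \<noteq> y" for x y
  proof -
    have "x \<in> {v, i, j, k}" "y \<in> {v, i, j, k}" unfolding UNIV_eq[symmetric] by simp_all
    then have "(x = v \<and> (y = i \<or> y = j \<or> y = k)) \<or> (x = i \<and> (y = v \<or> y = j \<or> y = k)) \<or>
      (x = j \<and> (y = v \<or> y = i \<or> y = k)) \<or> (x = k \<and> (y = v \<or> y = i \<or> y = j))"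
      using that by blast
    then show ?thesis
      by (elim disjE conjE) (simp_all only: vi vj vk ij ik jk swap[OF vi] swap[OF vj] swap[OF vk] swap[OF ij] swap[OF ik] swap[OF jk])
  qed
  have "X \<subseteq> tetra u"
  proof
    fix f assume "f \<in> X"
    then show "f \<in> tetra u" using all by (intro tetraI) blast
  qed
  moreover have "ideal_quotient X (ideal_quotient X (tetra u)) \<subseteq> tetra u"
  proof
    fix f assume "f \<in> ideal_quotient X (ideal_quotient X (tetra u))"
    then show "f \<in> tetra u" using all by (intro tetraI) blast
  qed
  ultimately show ?thesis using subset_double_quotient by blast
qed

lemma Var_mult_tetra_lower:
  assumes "t \<in> tetra (lower v w)"
  shows "Var v * t \<in> (tetra w :: 'k::field poly4 set)"
  unfolding tetra_def mon_ideal_def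
proof (intro CollectI subsetI allI impI)
  fix m and x y :: 4
  assume "m \<in> keys (Var v * t)" "x \<noteq> y"
  then obtain a b where "a \<in> keys (Var v :: 'k poly4)" "b \<in> keys t" "m = a + b" using keys_multD by blast
  then have b: "b \<in> keys t" "m = mon v 1 + b" by (auto simp: Var_def split: if_splits)
  then have "lower v w x y \<le> lk b x + lk b y"
    using assms \<open>x \<noteq> y\<close> by (auto simp: tetra_def mon_ideal_def subset_iff)
  then show "w x y \<le> lk m x + lk m y"
    unfolding b(2) lookup_add lower_def by (auto simp: lookup_single when_def split: if_splits)
qed

lemma F_eq_mon: "F = (mon (mon i (w v i) + mon j (w v j) + mon k (w v k)) 1 :: 'k::field poly4)"
  by (simp add: F_def Var_power mult_single)

text \<open>For a monomial of \<open>tetra w\<close> without \<open>Var v\<close> the inequalities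
  at \<open>v\<close> bound every other exponent from below, which is divisibility by
  \<open>F\<close>. Any other monomial can be divided by \<open>Var v\<close>.\<close>

lemma tetra_split:
  assumes "f \<in> (tetra w :: 'k::field poly4 set)"
  shows "\<exists>t\<in>tetra (lower v w). \<exists>r. f = Var v * t + F * r"
proof (rule poly_monomials_induct[of "\<lambda>f. \<exists>t\<in>tetra (lower v w). \<exists>r. f = Var v * t + F * r"])
  have d: "v \<noteq> i" "v \<noteq> j" "v \<noteq> k" "i \<noteq> j" "i \<noteq> k" "j \<noteq> k" using dist by auto
  have zero: "(0 :: 'k poly4) \<in> tetra (lower v w)" by (rule ideal.subspace_0[OF subspace_tetra])
  then show "\<exists>t\<in>tetra (lower v w). \<exists>r. (0 :: 'k poly4) = Var v * t + F * r"
    by (intro bexI[of _ 0] exI[of _ 0]) auto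
  show "\<exists>t\<in>tetra (lower v w). \<exists>r. p + q = Var v * t + F * r"
    if p: "\<exists>t\<in>tetra (lower v w). \<exists>r. p = Var v * t + F * r"
      and q: "\<exists>t\<in>tetra (lower v w). \<exists>r. q = Var v * t + F * r" for p q :: "'k poly4"
  proof -
    obtain t r t' r' where t: "t \<in> tetra (lower v w)" "t' \<in> tetra (lower v w)"
      "p = Var v * t + F * r" "q = Var v * t' + F * r'" using p q by blast
    then have "p + q = Var v * (t + t') + F * (r + r')" by (simp add: algebra_simps)
    moreover have "t + t' \<in> tetra (lower v w)" using t by (intro ideal.subspace_add[OF subspace_tetra])
    ultimately show ?thesis by blast
  qed
  fix m assume "m \<in> keys f"
  then have m: "w x y \<le> lk m x + lk m y" if "x \<noteq> y" for x y
    using assms that by (auto simp: tetra_def mon_ideal_def)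
  let ?c = "lk f m"
  show "\<exists>t\<in>tetra (lower v w). \<exists>r. mon m ?c = Var v * t + F * r"
  proof (cases "lk m v > 0")
    case True
    have "mon (m - mon v 1) ?c \<in> tetra (lower v w)"
      unfolding tetra_def mono_in_mon_ideal lower_def
      using m True by (fastforce simp: lookup_minus lookup_single when_def)
    then show ?thesis
      by (rule bexI[rotated]) (use mono_Var[OF True, of ?c] in \<open>auto intro!: exI[of _ 0]\<close>)
  next
    case False
    let ?n = "mon i (w v i) + mon j (w v j) + mon k (w v k)"
    have "lk ?n x \<le> lk m x" for x
      using m[of v x] False d by (auto simp: lookup_add lookup_single when_def)
    from mono_split[OF this] have "mon m ?c = F * mon (m - ?n) ?c" unfolding F_eq_mon .
    then show ?thesis by (intro bexI[OF _ zero] exI[of _ "mon (m - ?n) ?c"]) simp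
  qed
qed

lemma Var_dvd_F_cancel:
  assumes "Var v dvd F * (a :: 'k::field poly4)"
  shows "Var v dvd a"
proof -
  have "\<not> Var v dvd (Var x :: 'k poly4) ^ n" if "x \<noteq> v" for x n
    using that Var_not_dvd_Var[of v x, where 'k = 'k] prime_elem_dvd_power[OF prime_elem_Var] by blast
  then have "\<not> Var v dvd (F :: 'k poly4)"
    using dist unfolding F_def by (auto dest!: prime_elem_dvd_multD[OF prime_elem_Var])
  then show ?thesis using prime_elem_dvd_multD[OF prime_elem_Var assms] by blast
qed

lemma G_Suc: "G (Suc m) = Var v * (G m :: 'k::field poly4)"
  by (simp add: G_def mult.assoc)

text \<open>Since \<open>I = v J + (F)\<close>, linking \<open>J\<close> by \<open>(F, G)\<close> and \<open>I\<close> by \<open>(F, v G)\<close> gives the same curve.\<close>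

lemma quotient_eq:
  "ideal_quotient (ideal.span {F, G (Suc m)}) (tetra w) =
    ideal_quotient (ideal.span {F, G m}) (tetra (lower v w) :: 'k::field poly4 set)"
proof (intro equalityI subsetI)
  fix f :: "'k poly4" assume f: "f \<in> ideal_quotient (ideal.span {F, G (Suc m)}) (tetra w)"
  show "f \<in> ideal_quotient (ideal.span {F, G m}) (tetra (lower v w))"
    unfolding ideal_quotient_def
  proof (intro CollectI ballI)
    fix t :: "'k poly4" assume "t \<in> tetra (lower v w)"
    then have "f * (Var v * t) \<in> ideal.span {F, G (Suc m)}"
      using f Var_mult_tetra_lower unfolding ideal_quotient_def by blast
    then obtain a b where ab: "f * (Var v * t) = F * a + G (Suc m) * b" unfolding mem_span_pair by blast
    then have *: "F * a = Var v * (f * t - G m * b)" by (simp add: G_Suc algebra_simps)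
    \<comment> \<open>\<open>F\<close> does not involve \<open>Var v\<close>, so a factor
      \<open>Var v\<close> can be removed from the whole equation.\<close>
    have "Var v dvd a" by (rule Var_dvd_F_cancel) (simp add: *)
    then obtain a' where "a = Var v * a'" by (rule dvdE)
    then have "Var v * (F * a') = Var v * (f * t - G m * b)" using * by (simp add: mult.left_commute)
    then have "f * t = F * a' + G m * b" by (simp add: Var_nonzero)
    then show "f * t \<in> ideal.span {F, G m}" unfolding mem_span_pair by blast
  qed
next
  fix f :: "'k poly4" assume f: "f \<in> ideal_quotient (ideal.span {F, G m}) (tetra (lower v w))"
  show "f \<in> ideal_quotient (ideal.span {F, G (Suc m)}) (tetra w)"
    unfolding ideal_quotient_def
  proof (intro CollectI ballI)
    fix z :: "'k poly4" assume "z \<in> tetra w"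
    then obtain t r where t: "t \<in> tetra (lower v w)" "z = Var v * t + F * r" using tetra_split by blast
    then have "f * t \<in> ideal.span {F, G m}" using f unfolding ideal_quotient_def by blast
    then obtain a b where "f * t = F * a + G m * b" unfolding mem_span_pair by blast
    then have "Var v * (f * t) = Var v * (F * a + G m * b)" by simp
    then have "f * z = F * (Var v * a + f * r) + G (Suc m) * b"
      unfolding t(2) G_Suc by (simp add: algebra_simps)
    then show "f * z \<in> ideal.span {F, G (Suc m)}" unfolding mem_span_pair by blast
  qed
qed

text \<open>This keeps the residual of the link from being empty. Every element of
  \<open>(F, G)\<close> is supported on monomials divisible by \<open>Var i\<close> or by
  \<open>Var v ^ m\<close>, which the lowered ideal is not.\<close>

lemma not_tetra_lower_subset:
  assumes "w v i > 0" "w v i \<le> m"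
  shows "\<not> tetra (lower v w) \<subseteq> (ideal.span {F, G m} :: 'k::field poly4 set)"
proof -
  have d: "v \<noteq> i" "v \<noteq> j" "v \<noteq> k" "i \<noteq> j" "i \<noteq> k" "j \<noteq> k" using dist by auto
  define S where "S = {n. lk n i \<ge> 1 \<or> lk n v \<ge> m}"
  have sub: "ideal.subspace (mon_ideal S :: 'k poly4 set)"
    by (rule subspace_mon_ideal) (auto simp: S_def lookup_add)
  have "(F :: 'k poly4) \<in> mon_ideal S"
    unfolding F_eq_mon mono_in_mon_ideal S_def using assms(1) d by (auto simp: lookup_add lookup_single when_def)
  moreover have "(Var v :: 'k poly4) ^ m \<in> mon_ideal S"
    unfolding Var_power mono_in_mon_ideal S_def by simp
  then have "(Var i + Var j) ^ w i j * (Var i + Var k) ^ w i k * (Var j + Var k) ^ w j k * Var v ^ m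
      \<in> (mon_ideal S :: 'k poly4 set)" by (rule ideal.subspace_scale[OF sub])
  then have "(G m :: 'k poly4) \<in> mon_ideal S" unfolding G_def by (simp only: mult_ac)
  ultimately have XS: "ideal.span {F, G m} \<subseteq> (mon_ideal S :: 'k poly4 set)"
    using sub by (intro ideal.span_minimal) auto
  define N where "N = (\<Sum>x\<in>UNIV. \<Sum>y\<in>UNIV. w x y)"
  have N: "w x y \<le> N" for x y
  proof -
    have "w x y \<le> (\<Sum>y\<in>UNIV. w x y)" by (rule member_le_sum) auto
    also have "\<dots> \<le> N" unfolding N_def by (rule member_le_sum[of x UNIV "\<lambda>x. \<Sum>y\<in>UNIV. w x y"]) auto
    finally show ?thesis .
  qed
  \<comment> \<open>The exponent of \<open>Var v\<close> meets the lowered weight of the edge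
    \<open>v i\<close> exactly and is below \<open>m\<close>; the huge exponents \<open>N\<close>
    satisfy all other edges.\<close>
  let ?n = "mon v (w v i - 1) + mon j N + mon k N"
  have n: "lk ?n v = w v i - 1" "lk ?n i = 0" "lk ?n j = N" "lk ?n k = N"
    using d by (auto simp: lookup_add lookup_single when_def)
  have "lower v w x y \<le> lk ?n x + lk ?n y" if "x \<noteq> y" for x y
  proof -
    have "lower v w x y \<le> N" using N[of x y] by (auto simp: lower_def)
    moreover have "lower v w v i = w v i - 1" "lower v w i v = w v i - 1" by (auto simp: lower_def sym[of i v])
    moreover have "x \<in> {v, i, j, k}" "y \<in> {v, i, j, k}" unfolding UNIV_eq[symmetric] by simp_all
    ultimately show ?thesis using that n by (elim insertE emptyE) simp_all
  qed
  then have "(mon ?n 1 :: 'k poly4) \<in> tetra (lower v w)"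
    unfolding tetra_def mono_in_mon_ideal by blast
  moreover have "(mon ?n 1 :: 'k poly4) \<notin> mon_ideal S"
    unfolding mono_in_mon_ideal S_def using n assms by simp
  ultimately show ?thesis using XS by blast
qed

text \<open>The positive weight of \<open>v i\<close> keeps the residual proper, that of
  \<open>j k\<close> keeps 1 out of both tetrahedral ideals.\<close>

lemma evenly_linked_lower:
  assumes pos: "w v i > 0" "w j k > 0" and curve: "is_curve (tetra w :: 'k::field poly4 set)"
  shows "evenly_linked (tetra w) (tetra (lower v w) :: 'k poly4 set)"
proof -
  have d: "v \<noteq> i" "v \<noteq> j" "v \<noteq> k" "i \<noteq> j" "i \<noteq> k" "j \<noteq> k" using dist by auto
  \<comment> \<open>The sum serves as a common bound for the three weights at
    \<open>v\<close>.\<close>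
  define m where "m = w v i + w v j + w v k"
  define X where "X = (ideal.span {F, G m} :: 'k poly4 set)"
  define X' where "X' = (ideal.span {F, G (Suc m)} :: 'k poly4 set)"
  define D where "D = ideal_quotient X (tetra (lower v w))"
  let ?ls = "replicate (w v i) (Var i :: 'k poly4) @ replicate (w v j) (Var j) @ replicate (w v k) (Var k)"
  let ?ks = "\<lambda>m. replicate m (Var v :: 'k poly4) @ replicate (w i j) (Var i + Var j) @
      replicate (w i k) (Var i + Var k) @ replicate (w j k) (Var j + Var k)"
  interpret ci: linear_ci ?ls "?ks m" by (rule linear_ci)
  interpret ci': linear_ci ?ls "?ks (Suc m)" by (rule linear_ci)
  have X: "X = ci.X" and X': "X' = ci'.X"
    unfolding X_def X'_def ci.X_def ci'.X_def prod_ls prod_ks by simp_all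
  have wm: "w v x \<le> m" if "x \<noteq> v" for x
  proof -
    have "x \<in> {v, i, j, k}" unfolding UNIV_eq[symmetric] by simp
    then show ?thesis using that by (auto simp: m_def)
  qed
  have J: "X \<subseteq> tetra (lower v w) \<and> ideal_quotient X D = tetra (lower v w)"
    unfolding D_def
  proof (rule double_colon_tetra[OF _ _ _ _ _ X_def])
    show "lower v w x y = lower v w y x" for x y by (auto simp: lower_def sym[of y x])
    show "lower v w v x \<le> w v x \<and> lower v w v x \<le> m" if "x \<noteq> v" for x
      using wm[OF that] by (auto simp: lower_def)
  qed (use d in \<open>auto simp: lower_def\<close>)
  have D': "ideal_quotient X' (tetra w) = D"
    unfolding X'_def D_def X_def by (rule quotient_eq)
  have I: "X' \<subseteq> tetra w \<and> ideal_quotient X' D = tetra w"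
    unfolding D'[symmetric]
    by (rule double_colon_tetra[OF sym _ _ _ _ X'_def]) (use wm in \<open>auto simp: le_SucI\<close>)
  have nJX: "\<not> tetra (lower v w) \<subseteq> X"
    unfolding X_def by (rule not_tetra_lower_subset[OF pos(1) wm[OF d(1)[symmetric]]])
  have D: "is_curve D"
    using ci.is_curve_quotient_mon_ideal nJX unfolding D_def X tetra_def by blast
  have oneJ: "1 \<notin> (tetra (lower v w) :: 'k poly4 set)"
  proof
    assume "1 \<in> (tetra (lower v w) :: 'k poly4 set)"
    then have "lower v w j k \<le> 0"
      using d(6) unfolding tetra_def mon_ideal_def by auto
    then show False using pos(2) d by (simp add: lower_def)
  qed
  have oneI: "1 \<notin> (tetra w :: 'k poly4 set)"
  proof
    assume "1 \<in> (tetra w :: 'k poly4 set)"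
    then have "w j k \<le> 0"
      using d(6) unfolding tetra_def mon_ideal_def by auto
    then show False using pos(2) by simp
  qed
  have Jcurve: "is_curve (tetra (lower v w) :: 'k poly4 set)"
  proof (rule is_curveI[OF subspace_tetra _ oneJ])
    show "graded_part tdeg d f \<in> tetra (lower v w)" if "f \<in> tetra (lower v w)" for f :: "'k poly4" and d
      using that by (auto simp: tetra_def mon_ideal_def keys_graded_part)
    \<comment> \<open>By duality the lowered ideal is itself a colon ideal of \<open>X\<close> and
      inherits unmixedness.\<close>
    show "unmixed_by {L. is_line L} (tetra (lower v w) :: 'k poly4 set)"
      using unmixed_by_quotient[OF ci.unmixed_X, of D] J unfolding X by simp
    show "\<exists>L. is_line L \<and> L \<subseteq> Q" if "prime_ideal Q" "tetra (lower v w) \<subseteq> Q" for Q :: "'k poly4 set"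
      using ci.line_below_prime[OF that(1)] that(2) J unfolding X by blast
  qed
  have subX: "ideal.subspace X" unfolding X_def by simp
  have "X' \<subseteq> X"
    unfolding X'_def X_def
  proof (rule ideal.span_minimal)
    show "{F, G (Suc m)} \<subseteq> (ideal.span {F, G m} :: 'k poly4 set)"
      unfolding G_Suc by (auto intro: ideal.span_base ideal.span_scale)
  qed simp
  moreover have "X \<subseteq> D" unfolding D_def by (rule subset_ideal_quotient[OF subX])
  ultimately have "linked (tetra w) D"
    unfolding linked_def using curve D I D' ci'.complete_intersection_X oneI unfolding X'
    by (intro conjI exI[of _ ci'.X]) auto
  moreover have "linked D (tetra (lower v w))"
    unfolding linked_def using D Jcurve J \<open>X \<subseteq> D\<close> ci.complete_intersection_X oneJ D_def unfolding X
    by (intro conjI exI[of _ ci.X]) auto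
  ultimately have "(linked ^^ 2) (tetra w) (tetra (lower v w) :: 'k poly4 set)"
    by (auto simp: numeral_2_eq_2)
  then show ?thesis unfolding evenly_linked_def by (intro exI[of _ 2]) simp
qed

end

section \<open>The Rao module of a tetrahedral curve\<close>

definition shift :: "4 set \<Rightarrow> nat \<Rightarrow> 4 \<Rightarrow>\<^sub>0 nat" where
  "shift S n = (\<Sum>i\<in>S. mon i n)"

lemma lookup_shift: "lk (shift S n) i = (if i \<in> S then n else 0)"
proof -
  have "lk (shift S n) i = (\<Sum>x\<in>S. if x = i then n else 0)"
    by (simp add: shift_def lookup_sum lookup_single when_def)
  then show ?thesis by simp
qed

lemma prod_Var_power: "(\<Prod>i\<in>S. Var i :: 'k::field poly4) ^ n = mon (shift S n) 1"
proof -
  have "(\<Prod>i\<in>S. (Var i :: 'k poly4) ^ n) = mon (shift S n) 1"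
    unfolding shift_def using finite[of S]
    by (induction S rule: finite_induct) (simp_all add: Var_power mult_single)
  then show ?thesis by (simp add: prod_power_distrib)
qed

lemma tdeg_shift: "tdeg (shift S n) = n * card S"
  by (simp add: lookup_shift sum.If_cases)

lemma tdeg_add: "tdeg (m + n) = tdeg m + tdeg n"
  by (simp add: lookup_add sum.distrib)

lemma homogeneous_mult_mon:
  "homogeneous d f \<Longrightarrow> homogeneous (d + int (tdeg m)) (f * mon m (c :: 'k::field))"
  unfolding homogeneous_def
proof
  fix n assume f: "\<forall>m\<in>keys f. int (tdeg m) = d" and "n \<in> keys (f * mon m c)"
  then obtain a where "a \<in> keys f" "n = a + m" using keys_multD[of n f "mon m c"] by (auto split: if_splits)
  then show "int (tdeg n) = d + int (tdeg m)" using f by (simp add: tdeg_add)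
qed

lemma homogeneous_add: "homogeneous d f \<Longrightarrow> homogeneous d g \<Longrightarrow> homogeneous d (f + g)"
  unfolding homogeneous_def using keys_add[of f g] by blast

lemma homogeneous_uminus: "homogeneous d f \<Longrightarrow> homogeneous d (- f)"
  unfolding homogeneous_def by (simp add: in_keys_iff)

lemma mon_one_nonzero: "mon m 1 \<noteq> (0 :: 'k::field poly4)"
  by (simp flip: keys_eq_empty)

section \<open>Sections over the standard charts\<close>

lemma sheaf_sections_eq:
  "sheaf_sections I j S =
    {Fract g (mon (shift S n) 1) | g n. g \<in> I \<and> homogeneous (j + int (n * card S)) g}"
  unfolding sheaf_sections_def prod_Var_power ..

lemma Fract_add_same: "d \<noteq> 0 \<Longrightarrow> Fract a d + Fract b d = Fract (a + b) (d :: 'k::field poly4)"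
  by (simp add: eq_fract algebra_simps)

lemma Fract_diff_same: "d \<noteq> 0 \<Longrightarrow> Fract a d - Fract b d = Fract (a - b) (d :: 'k::field poly4)"
  by (simp add: eq_fract algebra_simps)

lemma shift_mono: "n \<le> N \<Longrightarrow> shift UNIV N = shift S n + (shift UNIV N - shift S n)"
  by (rule poly_mapping_eqI) (simp add: lookup_add lookup_minus lookup_shift)

text \<open>All sections can be written over one power of the product of the four variables, so that
  cochains are compared through the coefficients of their numerators.\<close>

lemma sheaf_section_denominator:
  assumes "x \<in> sheaf_sections I j (S :: 4 set)"
  shows "\<exists>n. \<forall>N\<ge>n. \<exists>g. x = Fract g (mon (shift UNIV N) (1 :: 'k::field))"
proof -
  obtain g n where x: "x = Fract g (mon (shift S n) 1)" using assms unfolding sheaf_sections_eq by blast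
  have "x = Fract (g * mon (shift UNIV N - shift S n) 1) (mon (shift UNIV N) 1)" if "n \<le> N" for N
  proof -
    have "mon (shift UNIV N) 1 = mon (shift S n) 1 * mon (shift UNIV N - shift S n) (1 :: 'k)"
      using shift_mono[OF that, of S] by (simp add: mult_single)
    then show ?thesis unfolding x by (simp add: eq_fract mon_one_nonzero mult_ac)
  qed
  then show ?thesis by blast
qed

lemma zero_sheaf_section: "ideal.subspace I \<Longrightarrow> 0 \<in> sheaf_sections I j S"
  unfolding sheaf_sections_eq
  by (intro CollectI exI[of _ 0]) (simp add: ideal.subspace_0 homogeneous_def eq_fract Zero_fract_def mon_one_nonzero)

lemma add_sheaf_section:
  assumes I: "ideal.subspace I" and "x \<in> sheaf_sections I j S" "y \<in> sheaf_sections I j S"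
  shows "x + y \<in> sheaf_sections I j (S :: 4 set)"
proof -
  obtain g n h m where x: "x = Fract g (mon (shift S n) 1)" "g \<in> I" "homogeneous (j + int (n * card S)) g"
    and y: "y = Fract h (mon (shift S m) 1)" "h \<in> I" "homogeneous (j + int (m * card S)) h"
    using assms unfolding sheaf_sections_eq by blast
  have sh: "shift S n + shift S m = shift S (n + m)"
    by (rule poly_mapping_eqI) (simp add: lookup_add lookup_shift)
  let ?z = "g * mon (shift S m) 1 + h * mon (shift S n) 1"
  have "x + y = Fract ?z (mon (shift S (n + m)) 1)"
    unfolding x(1) y(1) by (simp add: mon_one_nonzero mult_single sh)
  moreover have "?z \<in> I"
    using x(2) y(2) I by (metis ideal.subspace_add ideal.subspace_scale mult.commute)
  moreover have "homogeneous (j + int ((n + m) * card S)) ?z"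
    using homogeneous_mult_mon[OF x(3), of "shift S m" 1] homogeneous_mult_mon[OF y(3), of "shift S n" 1]
    unfolding tdeg_shift by (intro homogeneous_add) (simp_all add: algebra_simps)
  ultimately show ?thesis unfolding sheaf_sections_eq by blast
qed

lemma uminus_sheaf_section:
  assumes I: "ideal.subspace I" and "x \<in> sheaf_sections I j S"
  shows "- x \<in> sheaf_sections I j (S :: 4 set)"
proof -
  obtain g n where x: "x = Fract g (mon (shift S n) 1)" "g \<in> I" "homogeneous (j + int (n * card S)) g"
    using assms unfolding sheaf_sections_eq by blast
  have "- x = Fract (- g) (mon (shift S n) 1)" unfolding x(1) by simp
  moreover have "- g \<in> I" using x(2) I by (rule ideal.subspace_neg[rotated])
  ultimately show ?thesis unfolding sheaf_sections_eq using homogeneous_uminus[OF x(3)] by blast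
qed

lemma diff_sheaf_section:
  "ideal.subspace I \<Longrightarrow> x \<in> sheaf_sections I j S \<Longrightarrow> y \<in> sheaf_sections I j S \<Longrightarrow>
    x - y \<in> sheaf_sections I j (S :: 4 set)"
  using add_sheaf_section[of I x j S "- y"] uminus_sheaf_section[of I y j S] by simp

lemma rao_nonzero_iff:
  fixes I :: "'k::field poly4 set"
  assumes I: "ideal.subspace I"
  shows "rao_nonzero I j \<longleftrightarrow> \<not> cech_cocycles I j \<subseteq> cech_coboundaries I j"
proof -
  let ?B = "cech_coboundaries I j" and ?Z = "cech_cocycles I j"
  have zero: "0 \<in> ?B" unfolding cech_coboundaries_def
    by (intro CollectI exI[of _ "\<lambda>_. 0"]) (simp add: zero_sheaf_section[OF I] fun_eq_iff)
  have add: "x + y \<in> ?B" if "x \<in> ?B" "y \<in> ?B" for x y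
  proof -
    obtain h h' where "x = (\<lambda>p q. h q - h p)" "\<forall>p. h p \<in> sheaf_sections I j {p}"
      "y = (\<lambda>p q. h' q - h' p)" "\<forall>p. h' p \<in> sheaf_sections I j {p}"
      using \<open>x \<in> ?B\<close> \<open>y \<in> ?B\<close> unfolding cech_coboundaries_def by blast
    then show ?thesis unfolding cech_coboundaries_def
      by (intro CollectI exI[of _ "\<lambda>p. h p + h' p"]) (simp add: add_sheaf_section[OF I] fun_eq_iff)
  qed
  have diff: "x - y \<in> ?B" if "x \<in> ?B" "y \<in> ?B" for x y
  proof -
    obtain h h' where "x = (\<lambda>p q. h q - h p)" "\<forall>p. h p \<in> sheaf_sections I j {p}"
      "y = (\<lambda>p q. h' q - h' p)" "\<forall>p. h' p \<in> sheaf_sections I j {p}"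
      using \<open>x \<in> ?B\<close> \<open>y \<in> ?B\<close> unfolding cech_coboundaries_def by blast
    then show ?thesis unfolding cech_coboundaries_def
      by (intro CollectI exI[of _ "\<lambda>p. h p - h' p"]) (simp add: diff_sheaf_section[OF I] fun_eq_iff)
  qed
  have coset: "f +o ?B = ?B \<longleftrightarrow> f \<in> ?B" for f
  proof
    assume "f +o ?B = ?B"
    moreover have "f + 0 \<in> f +o ?B" using zero unfolding elt_set_plus_def by blast
    ultimately show "f \<in> ?B" by simp
  next
    assume f: "f \<in> ?B"
    have "x \<in> f +o ?B" if "x \<in> ?B" for x
      using diff[OF that f] unfolding elt_set_plus_def by (intro CollectI bexI[of _ "x - f"]) auto
    moreover have "x \<in> ?B" if "x \<in> f +o ?B" for x
      using that add[OF f] unfolding elt_set_plus_def by blast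
    ultimately show "f +o ?B = ?B" by blast
  qed
  have "0 \<in> ?Z" unfolding cech_cocycles_def by (simp add: zero_sheaf_section[OF I])
  then have "rao I j = {?B} \<longleftrightarrow> (\<forall>f\<in>?Z. f +o ?B = ?B)" unfolding rao_def by blast
  then show ?thesis unfolding rao_nonzero_def coset by blast
qed

text \<open>The exponent \<open>g - N\<close> (with possibly negative entries) belongs to the localization of
  \<open>tetra w\<close> at the variables in \<open>S\<close>.\<close>

definition local_exp :: "(4 \<Rightarrow> 4 \<Rightarrow> nat) \<Rightarrow> nat \<Rightarrow> 4 set \<Rightarrow> (4 \<Rightarrow>\<^sub>0 nat) \<Rightarrow> bool" where
  "local_exp w N S g \<longleftrightarrow> (\<forall>i. i \<notin> S \<longrightarrow> N \<le> lk g i) \<and>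
    (\<forall>i j. i \<noteq> j \<longrightarrow> i \<notin> S \<longrightarrow> j \<notin> S \<longrightarrow> w i j + 2 * N \<le> lk g i + lk g j)"

lemma local_exp_iff:
  "local_exp w N S g \<longleftrightarrow> (\<exists>n d. (\<forall>i j. i \<noteq> j \<longrightarrow> w i j \<le> lk d i + lk d j) \<and>
     g + shift S n = d + shift UNIV N)"
proof
  assume l: "local_exp w N S g"
  \<comment> \<open>\<open>W\<close> bounds all weights: adding \<open>N + W\<close> to the
    exponents in \<open>S\<close> satisfies every edge that meets \<open>S\<close>.\<close>
  define W where "W = (\<Sum>x\<in>UNIV. \<Sum>y\<in>UNIV. w x y)"
  have W: "w x y \<le> W" for x y
  proof -
    have "w x y \<le> (\<Sum>y\<in>UNIV. w x y)" by (rule member_le_sum) auto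
    also have "\<dots> \<le> W" unfolding W_def by (rule member_le_sum[of x UNIV "\<lambda>x. \<Sum>y\<in>UNIV. w x y"]) auto
    finally show ?thesis .
  qed
  define d where "d = g + shift S (N + W) - shift UNIV N"
  have d: "lk d i = (if i \<in> S then lk g i + W else lk g i - N)" for i
    by (simp add: d_def lookup_add lookup_minus lookup_shift)
  have N: "N \<le> lk g i" if "i \<notin> S" for i using l that by (simp add: local_exp_def)
  have "g + shift S (N + W) = d + shift UNIV N"
    using N by (intro poly_mapping_eqI) (simp add: lookup_add lookup_shift d)
  moreover have "w i j \<le> lk d i + lk d j" if "i \<noteq> j" for i j
  proof (cases "i \<in> S \<or> j \<in> S")
    case True
    then show ?thesis using W[of i j] by (auto simp: d)
  next
    case False
    then have "w i j + 2 * N \<le> lk g i + lk g j" using l that by (simp add: local_exp_def)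
    then show ?thesis using False N[of i] N[of j] by (simp add: d)
  qed
  ultimately show "\<exists>n d. (\<forall>i j. i \<noteq> j \<longrightarrow> w i j \<le> lk d i + lk d j) \<and> g + shift S n = d + shift UNIV N"
    by blast
next
  assume "\<exists>n d. (\<forall>i j. i \<noteq> j \<longrightarrow> w i j \<le> lk d i + lk d j) \<and> g + shift S n = d + shift UNIV N"
  then obtain n d where d: "\<And>i j. i \<noteq> j \<Longrightarrow> w i j \<le> lk d i + lk d j" "g + shift S n = d + shift UNIV N"
    by blast
  have "lk g i = lk d i + N" if "i \<notin> S" for i
    using arg_cong[OF d(2), of "\<lambda>m. lk m i"] that by (simp add: lookup_add lookup_shift)
  then show "local_exp w N S g" using d(1) by (fastforce simp: local_exp_def)
qed

text \<open>Cross-multiplication only translates exponents, so every single exponent of a section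
  must itself belong to the localization. The term \<open>4 * N\<close> is the degree of the
  denominator.\<close>

lemma section_lookup:
  fixes G :: "'k::field poly4"
  assumes "Fract G (mon (shift UNIV N) 1) \<in> sheaf_sections (tetra w) j S" and "lk G g \<noteq> 0"
  shows "local_exp w N S g \<and> int (tdeg g) = j + int (4 * N)"
proof -
  obtain f n where f: "Fract G (mon (shift UNIV N) 1) = Fract f (mon (shift S n) 1)"
    "f \<in> tetra w" "homogeneous (j + int (n * card S)) f"
    using assms(1) unfolding sheaf_sections_eq by blast
  then have "G * mon (shift S n) 1 = f * mon (shift UNIV N) 1"
    by (simp add: eq_fract mon_one_nonzero)
  then have "lk (mon (shift UNIV N) 1 * f) (shift S n + g) = lk (mon (shift S n) 1 * G) (shift S n + g)"
    by (simp add: mult.commute)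
  also have "\<dots> \<noteq> 0" unfolding lookup_mono_mult using assms(2) by simp
  finally have "shift S n + g \<in> keys (mon (shift UNIV N) 1 * f)" by (simp add: in_keys_iff)
  then obtain d where d: "d \<in> keys f" "shift S n + g = shift UNIV N + d"
    using keys_multD[of "shift S n + g" "mon (shift UNIV N) 1" f] by (auto split: if_splits)
  have "\<forall>i j. i \<noteq> j \<longrightarrow> w i j \<le> lk d i + lk d j"
    using f(2) d(1) by (auto simp: tetra_def mon_ideal_def)
  then have "local_exp w N S g" unfolding local_exp_iff using d(2) by (metis add.commute)
  moreover have "int (tdeg d) = j + int (n * card S)" using f(3) d(1) by (simp add: homogeneous_def)
  moreover have "n * card S + tdeg g = 4 * N + tdeg d"
    using arg_cong[OF d(2), of tdeg] unfolding tdeg_add tdeg_shift by simp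
  ultimately show ?thesis by linarith
qed

lemma sectionI:
  fixes G :: "'k::field poly4"
  assumes "\<And>g. lk G g \<noteq> 0 \<Longrightarrow> local_exp w N S g \<and> int (tdeg g) = j + int (4 * N)"
  shows "Fract G (mon (shift UNIV N) 1) \<in> sheaf_sections (tetra w) j S"
proof (rule poly_monomials_induct[of "\<lambda>G. Fract G (mon (shift UNIV N) 1) \<in> sheaf_sections (tetra w) j S"])
  let ?D = "mon (shift UNIV N) 1 :: 'k poly4"
  have "Fract 0 ?D = 0" by (simp add: Zero_fract_def eq_fract mon_one_nonzero)
  then show "Fract 0 ?D \<in> sheaf_sections (tetra w) j S"
    by (simp add: zero_sheaf_section[OF subspace_tetra])
  show "Fract (p + q) ?D \<in> sheaf_sections (tetra w) j S"
    if "Fract p ?D \<in> sheaf_sections (tetra w) j S" "Fract q ?D \<in> sheaf_sections (tetra w) j S" for p q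
    using add_sheaf_section[OF subspace_tetra that] by (simp only: Fract_add_same[OF mon_one_nonzero])
  fix g assume "g \<in> keys G"
  then have g: "local_exp w N S g" "int (tdeg g) = j + int (4 * N)"
    using assms by (auto simp: in_keys_iff)
  let ?c = "lk G g"
  obtain n d where d: "\<forall>i j. i \<noteq> j \<longrightarrow> w i j \<le> lk d i + lk d j" "g + shift S n = d + shift UNIV N"
    using g(1) unfolding local_exp_iff by blast
  have "Fract (mon g ?c) ?D = Fract (mon d ?c) (mon (shift S n) 1)"
    using d(2) by (simp add: eq_fract mon_one_nonzero mult_single)
  moreover have "mon d ?c \<in> tetra w" using d(1) by (simp add: tetra_def mono_in_mon_ideal)
  moreover have "tdeg g + n * card S = tdeg d + 4 * N"
    using arg_cong[OF d(2), of tdeg] unfolding tdeg_add tdeg_shift by simp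
  then have "int (tdeg d) = j + int (n * card S)" using g(2) by linarith
  then have "homogeneous (j + int (n * card S)) (mon d ?c)" by (simp add: homogeneous_def)
  ultimately show "Fract (mon g ?c) ?D \<in> sheaf_sections (tetra w) j S"
    unfolding sheaf_sections_eq by blast
qed

definition split_exp :: "(4 \<Rightarrow> 4 \<Rightarrow> nat) \<Rightarrow> (4 \<Rightarrow>\<^sub>0 nat) \<Rightarrow> bool" where
  "split_exp w m \<longleftrightarrow> (\<exists>p q r s. distinct [p, q, r, s] \<and>
     lk m p + lk m q < w p q \<and> lk m r + lk m s < w r s \<and>
     w p r \<le> lk m p + lk m r \<and> w p s \<le> lk m p + lk m s \<and>
     w q r \<le> lk m q + lk m r \<and> w q s \<le> lk m q + lk m s)"

text \<open>The complex of the sets \<open>S\<close> with \<open>\<not> local_exp w N S g\<close> is connected, unless it consists of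
  two disjoint edges.\<close>

lemma connected_or_split:
  assumes sym: "\<And>x y. w x y = w y x"
    and e: "\<And>p q. \<not> local_exp w N {p, q} g \<Longrightarrow> e p = e q"
    and V: "\<not> local_exp w N {p} g" "\<not> local_exp w N {q} g"
    and ns: "(\<And>i. N \<le> lk g i) \<Longrightarrow> \<not> split_exp w (g - shift UNIV N)"
  shows "e p = e q"
proof (cases "\<exists>i. lk g i < N")
  case True
  then obtain i where i: "lk g i < N" by blast
  \<comment> \<open>A negative exponent at \<open>i\<close> makes all sets that avoid
    \<open>i\<close> non-local, so the other three vertices are joined to each other. It remains to
    join \<open>i\<close> to them when it is a vertex of the complex.\<close>
  have off: "e x = e y" if "x \<noteq> i" "y \<noteq> i" for x y
    using i that by (intro e) (auto simp: local_exp_def not_le)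
  have "e x = e y" if x: "\<not> local_exp w N {x} g" and y: "y \<noteq> i" for x y
  proof (cases "x = i")
    case False
    then show ?thesis using off y by blast
  next
    case True
    from x consider k where "k \<noteq> i" "lk g k < N"
      | k l where "k \<noteq> l" "k \<noteq> i" "l \<noteq> i" "lk g k + lk g l < w k l + 2 * N"
      unfolding True local_exp_def by (auto simp: not_le)
    then show ?thesis
    proof cases
      case 1
      obtain r s where rs: "distinct [i, k, r, s]" using complete2_distinct4[of i k] 1(1) by metis
      have "e i = e r" using 1 rs by (intro e) (auto simp: local_exp_def not_le)
      then show ?thesis using off[of r y] rs y True by auto
    next
      case 2
      then have "card (UNIV - {i, k, l}) = 1" by (simp add: card_Diff_subset)
      then obtain r where "UNIV - {i, k, l} = {r}" by (auto simp: card_1_singleton_iff)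
      then have r: "r \<noteq> i" "r \<noteq> k" "r \<noteq> l" by auto
      have "\<not> local_exp w N {i, r} g"
        using 2 r unfolding local_exp_def by (metis insertE not_le singletonD)
      then have "e i = e r" by (rule e)
      then show ?thesis using off[of r y] r y True by auto
    qed
  qed
  note * = this
  obtain y where "y \<noteq> i" using UNIV_4 by (metis zero_neq_one)
  then show ?thesis using *[OF V(1)] *[OF V(2)] by metis
next
  case False
  then have N: "N \<le> lk g i" for i by (simp add: not_less)
  define m where "m = g - shift UNIV N"
  have m: "lk g i = lk m i + N" for i using N[of i] by (simp add: m_def lookup_minus lookup_shift)
  define low where "low x y \<longleftrightarrow> lk m x + lk m y < w x y" for x y
  have low_sym: "low x y \<longleftrightarrow> low y x" for x y by (simp add: low_def sym[of x y] add.commute)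
  have loc: "local_exp w N S g \<longleftrightarrow> (\<forall>i j. i \<noteq> j \<longrightarrow> i \<notin> S \<longrightarrow> j \<notin> S \<longrightarrow> \<not> low i j)" for S
    unfolding local_exp_def low_def m not_less by simp
  show ?thesis
  proof (rule ccontr)
    assume neq: "e p \<noteq> e q"
    then have "p \<noteq> q" by auto
    then obtain r s where d: "distinct [p, q, r, s]" by (rule complete2_distinct4)
    have all: "x \<in> {p, q, r, s}" for x using UNIV_distinct4[OF d] by simp
    have edge: "e x = e y" if "low x' y'" "x' \<noteq> y'" "x' \<notin> {x, y}" "y' \<notin> {x, y}" for x y x' y'
      using that by (intro e) (auto simp: loc)
    have V': "\<exists>y z. y \<noteq> z \<and> y \<noteq> x \<and> z \<noteq> x \<and> low y z" if "\<not> local_exp w N {x} g" for x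
      using that unfolding loc by auto
    \<comment> \<open>\<open>r s\<close> cannot be low, as that would join \<open>p\<close> to
      \<open>q\<close>. That \<open>p\<close> and \<open>q\<close> are vertices of the complex then
      gives a low edge from \<open>q\<close> and one from \<open>p\<close> to \<open>{r, s}\<close>,
      and only two opposite low edges avoid joining \<open>p\<close> to \<open>q\<close>.\<close>
    have nrs: "\<not> low r s" using edge[of r s p q] neq d by auto
    have a: "low q r \<or> low q s"
      using V'[OF V(1)] all nrs low_sym by (metis insertE singletonD)
    have b: "low p r \<or> low p s"
      using V'[OF V(2)] all nrs low_sym by (metis insertE singletonD)
    have 1: "low q r \<Longrightarrow> e p = e s" "low q s \<Longrightarrow> e p = e r" "low p r \<Longrightarrow> e q = e s" "low p s \<Longrightarrow> e q = e r"
      "low p q \<Longrightarrow> e r = e s"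
      using edge[of q r p s] edge[of q s p r] edge[of p r q s] edge[of p s q r] edge[of p q r s] d by auto
    from a b 1 neq consider "low q r" "low p s" "\<not> low q s" "\<not> low p r" "\<not> low p q"
      | "low q s" "low p r" "\<not> low q r" "\<not> low p s" "\<not> low p q" by metis
    then have "split_exp w m"
    proof cases
      case 1
      then show ?thesis unfolding split_exp_def
        using d nrs by (intro exI[of _ p] exI[of _ s] exI[of _ q] exI[of _ r])
          (auto simp: low_def not_less sym[of s q] sym[of s r] add.commute)
    next
      case 2
      then show ?thesis unfolding split_exp_def
        using d nrs by (intro exI[of _ p] exI[of _ r] exI[of _ q] exI[of _ s])
          (auto simp: low_def not_less sym[of r q] add.commute)
    qed
    then show False using ns[OF N] by (simp add: m_def)
  qed
qed

text \<open>Without regard to charts, \<open>f\<close> is the coboundary of its row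
  \<open>f 0\<close>. At each exponent that row is constant on the vertices where the exponent is
  not allowed, so subtracting a constant per exponent moves it into the right sections.\<close>

lemma cocycle_coboundary:
  assumes sym: "\<And>x y. w x y = w y x"
    and ns: "\<And>m. int (tdeg m) = j \<Longrightarrow> \<not> split_exp w m"
    and f: "f \<in> cech_cocycles (tetra w :: 'k::field poly4 set) j"
  shows "f \<in> cech_coboundaries (tetra w) j"
proof -
  have fs: "f p q \<in> sheaf_sections (tetra w) j {p, q}" and fc: "f p q + f q r = f p r" for p q r
    using f by (auto simp: cech_cocycles_def)
  have "\<exists>n. \<forall>q. \<forall>N\<ge>n q. \<exists>g. f 0 q = Fract g (mon (shift UNIV N) 1)"
    using sheaf_section_denominator[OF fs] by metis
  then obtain n where n: "\<And>q N. n q \<le> N \<Longrightarrow> \<exists>g. f 0 q = Fract g (mon (shift UNIV N) 1)" by blast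
  define N where "N = (\<Sum>q\<in>UNIV. n q)"
  have "n q \<le> N" for q unfolding N_def by (rule member_le_sum) auto
  then have "\<forall>q. \<exists>g. f 0 q = Fract g (mon (shift UNIV N) 1)" using n by blast
  then obtain G where G: "\<And>q. f 0 q = Fract (G q) (mon (shift UNIV N) 1)" by metis
  let ?D = "mon (shift UNIV N) 1 :: 'k poly4"
  have fG: "f p q = Fract (G q - G p) ?D" for p q
  proof -
    have "f p q = f 0 q - f 0 p" using fc[of 0 p q] by (simp add: algebra_simps)
    then show ?thesis unfolding G by (simp only: Fract_diff_same[OF mon_one_nonzero])
  qed
  have eq: "lk (G p) g = lk (G q) g" if "\<not> local_exp w N {p, q} g" for p q g
  proof (rule ccontr)
    assume "lk (G p) g \<noteq> lk (G q) g"
    then have "lk (G q - G p) g \<noteq> 0" by (simp add: lookup_minus)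
    moreover have "Fract (G q - G p) ?D \<in> sheaf_sections (tetra w) j {p, q}" using fs[of p q] unfolding fG .
    ultimately show False using section_lookup that by blast
  qed
  have deg: "int (tdeg g) = j + int (4 * N)" if "lk (G q) g \<noteq> 0" for q g
    using section_lookup[of "G q" N w j "{0, q}" g] fs[of 0 q] G[of q] that by simp
  have const: "lk (G p) g = lk (G q) g"
    if "\<not> local_exp w N {p} g" "\<not> local_exp w N {q} g" "int (tdeg g) = j + int (4 * N)" for p q g
  proof (rule connected_or_split[OF sym _ that(1,2)])
    show "lk (G p) g = lk (G q) g" if "\<not> local_exp w N {p, q} g" for p q using eq that .
    assume N: "\<And>i. N \<le> lk g i"
    have "g = (g - shift UNIV N) + shift UNIV N"
      by (rule poly_mapping_eqI) (simp add: N lookup_add lookup_minus lookup_shift)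
    then have "tdeg g = tdeg (g - shift UNIV N) + N * card (UNIV :: 4 set)"
      using tdeg_add[of "g - shift UNIV N" "shift UNIV N"] unfolding tdeg_shift by simp
    then have "int (tdeg (g - shift UNIV N)) = j" using that(3) by simp
    then show "\<not> split_exp w (g - shift UNIV N)" by (rule ns)
  qed
  \<comment> \<open>Minus the common coefficient over the non-local vertices; with none of them,
    0.\<close>
  define c where "c g = (if \<exists>q. \<not> local_exp w N {q} g then - lk (G (SOME q. \<not> local_exp w N {q} g)) g else 0)" for g
  define K where "K = (\<Union>q. keys (G q))"
  have "finite K" by (simp add: K_def)
  define H where "H = (\<Sum>g\<in>K. mon g (c g))"
  have H: "lk H g = (if g \<in> K then c g else 0)" for g
    using \<open>finite K\<close> by (simp add: H_def lookup_sum lookup_single when_def)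
  define h where "h q = Fract (G q + H) ?D" for q
  have "h q \<in> sheaf_sections (tetra w) j {q}" for q
    unfolding h_def
  proof (rule sectionI)
    fix g assume nz: "lk (G q + H) g \<noteq> 0"
    then have gK: "g \<in> K" by (auto simp: lookup_add H K_def in_keys_iff split: if_splits)
    then have tg: "int (tdeg g) = j + int (4 * N)" using deg by (auto simp: K_def in_keys_iff)
    have "local_exp w N {q} g"
    proof (rule ccontr)
      assume q: "\<not> local_exp w N {q} g"
      then have "\<not> local_exp w N {SOME q. \<not> local_exp w N {q} g} g" by (rule someI)
      from const[OF q this tg] have "lk (G q) g = - c g" using q unfolding c_def by auto
      then show False using nz gK by (simp add: lookup_add H)
    qed
    then show "local_exp w N {q} g \<and> int (tdeg g) = j + int (4 * N)" using tg by blast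
  qed
  moreover have "f p q = h q - h p" for p q
    unfolding fG h_def Fract_diff_same[OF mon_one_nonzero] by simp
  then have "f = (\<lambda>p q. h q - h p)" by (intro ext)
  ultimately show ?thesis unfolding cech_coboundaries_def by blast
qed

text \<open>The cocycle is the difference of the indicator of one component, \<open>x\<close> on
  \<open>p\<close> and \<open>q\<close> and 0 on \<open>r\<close> and \<open>s\<close>. Were it a
  coboundary, sections at \<open>p\<close> and \<open>r\<close> would differ by the monomial of
  \<open>m\<close>, which is allowed in neither.\<close>

lemma split_exp_cocycle:
  fixes w :: "4 \<Rightarrow> 4 \<Rightarrow> nat"
  assumes sym: "\<And>x y. w x y = w y x" and deg: "int (tdeg m) = j" and "split_exp w m"
  shows "\<not> cech_cocycles (tetra w :: 'k::field poly4 set) j \<subseteq> cech_coboundaries (tetra w) j"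
proof
  assume sub: "cech_cocycles (tetra w :: 'k poly4 set) j \<subseteq> cech_coboundaries (tetra w) j"
  obtain p q r s where d: "distinct [p, q, r, s]"
    and low: "lk m p + lk m q < w p q" "lk m r + lk m s < w r s"
    and high: "w p r \<le> lk m p + lk m r" "w p s \<le> lk m p + lk m s"
      "w q r \<le> lk m q + lk m r" "w q s \<le> lk m q + lk m s"
    using assms(3) unfolding split_exp_def by blast
  have all: "x = p \<or> x = q \<or> x = r \<or> x = s" for x using UNIV_distinct4[OF d] by auto
  define x where "x = Fract (mon m 1 :: 'k poly4) 1"
  define h where "h i = (if i = p \<or> i = q then x else 0)" for i
  have shift0: "shift UNIV 0 = 0" by (rule poly_mapping_eqI) (simp add: lookup_shift)
  have x: "x \<in> sheaf_sections (tetra w) j S" if "local_exp w 0 S m" for S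
  proof -
    have "Fract (mon m 1 :: 'k poly4) (mon (shift UNIV 0) 1) \<in> sheaf_sections (tetra w) j S"
      by (rule sectionI) (use that deg in \<open>auto simp: lookup_single when_def split: if_splits\<close>)
    then show ?thesis by (simp add: x_def shift0)
  qed
  have mem: "h b - h a \<in> sheaf_sections (tetra w) j {a, b}" for a b
  proof (cases "(a = p \<or> a = q) = (b = p \<or> b = q)")
    case True
    then show ?thesis by (simp add: h_def zero_sheaf_section[OF subspace_tetra])
  next
    case False
    \<comment> \<open>For \<open>a\<close> and \<open>b\<close> in different components the
      complement is again a mixed pair, where the weights are met.\<close>
    then have "local_exp w 0 {a, b} m"
      using all[of a] all[of b] high d all unfolding local_exp_def
      by (smt (verit) add.commute add_0_right insertI1 insertI2 mult_zero_right sym zero_le)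
    note xs = x[OF this]
    then show ?thesis using False uminus_sheaf_section[OF subspace_tetra xs] by (auto simp: h_def)
  qed
  have "(\<lambda>a b. h b - h a) \<in> cech_cocycles (tetra w) j"
    unfolding cech_cocycles_def using mem by simp
  then obtain h' where h': "(\<lambda>a b. h b - h a) = (\<lambda>p q. h' q - h' p)"
    "\<And>p. h' p \<in> sheaf_sections (tetra w) j {p}"
    using sub unfolding cech_coboundaries_def by blast
  have "h r - h p = h' r - h' p" using fun_cong[OF fun_cong[OF h'(1), of p], of r] .
  moreover have "h p = x" "h r = 0" using d by (auto simp: h_def)
  ultimately have eq: "h' p = h' r + x" by (simp add: algebra_simps)
  obtain n1 n2 where n: "\<And>N. n1 \<le> N \<Longrightarrow> \<exists>g. h' p = Fract g (mon (shift UNIV N) 1)"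
    "\<And>N. n2 \<le> N \<Longrightarrow> \<exists>g. h' r = Fract g (mon (shift UNIV N) 1)"
    using sheaf_section_denominator[OF h'(2)[of p]] sheaf_section_denominator[OF h'(2)[of r]] by metis
  define N where "N = n1 + n2"
  let ?D = "mon (shift UNIV N) 1 :: 'k poly4"
  obtain G1 G2 where G: "h' p = Fract G1 ?D" "h' r = Fract G2 ?D"
    using n(1)[of N] n(2)[of N] by (auto simp: N_def)
  have "x = Fract (mon (m + shift UNIV N) 1) ?D"
    unfolding x_def by (simp add: eq_fract mon_one_nonzero mult_single)
  then have "Fract G1 ?D = Fract (G2 + mon (m + shift UNIV N) 1) ?D"
    using eq unfolding G by (simp only: Fract_add_same[OF mon_one_nonzero])
  then have G12: "G1 = G2 + mon (m + shift UNIV N) 1" by (simp add: eq_fract mon_one_nonzero)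
  have "\<not> local_exp w N {p} (m + shift UNIV N)"
  proof
    assume "local_exp w N {p} (m + shift UNIV N)"
    then have "r \<noteq> s \<longrightarrow> r \<notin> {p} \<longrightarrow> s \<notin> {p} \<longrightarrow>
        w r s + 2 * N \<le> lk (m + shift UNIV N) r + lk (m + shift UNIV N) s"
      unfolding local_exp_def by blast
    then show False using low(2) d by (auto simp: lookup_add lookup_shift)
  qed
  then have "lk G1 (m + shift UNIV N) = 0" using section_lookup h'(2)[of p] G(1) by metis
  moreover have "\<not> local_exp w N {r} (m + shift UNIV N)"
  proof
    assume "local_exp w N {r} (m + shift UNIV N)"
    then have "p \<noteq> q \<longrightarrow> p \<notin> {r} \<longrightarrow> q \<notin> {r} \<longrightarrow>
        w p q + 2 * N \<le> lk (m + shift UNIV N) p + lk (m + shift UNIV N) q"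
      unfolding local_exp_def by blast
    then show False using low(1) d by (auto simp: lookup_add lookup_shift)
  qed
  then have "lk G2 (m + shift UNIV N) = 0" using section_lookup h'(2)[of r] G(2) by metis
  ultimately show False unfolding G12 by (simp add: lookup_add)
qed

lemma rao_nonzero_tetra:
  assumes "\<And>x y. w x y = w y x"
  shows "rao_nonzero (tetra w :: 'k::field poly4 set) j \<longleftrightarrow> (\<exists>m. int (tdeg m) = j \<and> split_exp w m)"
  unfolding rao_nonzero_iff[OF subspace_tetra]
proof
  assume "\<not> cech_cocycles (tetra w :: 'k poly4 set) j \<subseteq> cech_coboundaries (tetra w) j"
  then show "\<exists>m. int (tdeg m) = j \<and> split_exp w m"
    using cocycle_coboundary[of w j] assms by blast
next
  assume "\<exists>m. int (tdeg m) = j \<and> split_exp w m"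
  then show "\<not> cech_cocycles (tetra w :: 'k poly4 set) j \<subseteq> cech_coboundaries (tetra w) j"
    using split_exp_cocycle[of w] assms by blast
qed

section \<open>Minimality, diameter and isomorphism\<close>

lemma split_expE_at:
  assumes sym: "\<And>x y. w x y = w y x" and "split_exp w m"
  shows "\<exists>i j k. distinct [v, i, j, k] \<and> lk m v + lk m i < w v i \<and> lk m j + lk m k < w j k \<and>
    w v j \<le> lk m v + lk m j \<and> w v k \<le> lk m v + lk m k \<and>
    w i j \<le> lk m i + lk m j \<and> w i k \<le> lk m i + lk m k"
proof -
  obtain p q r s where d: "distinct [p, q, r, s]"
    and low: "lk m p + lk m q < w p q" "lk m r + lk m s < w r s"
    and high: "w p r \<le> lk m p + lk m r" "w p s \<le> lk m p + lk m s"
      "w q r \<le> lk m q + lk m r" "w q s \<le> lk m q + lk m s"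
    using assms(2) unfolding split_exp_def by blast
  have c: "lk m x + lk m y = lk m y + lk m x" for x y by simp
  have "v = p \<or> v = q \<or> v = r \<or> v = s" using UNIV_distinct4[OF d] by auto
  then show ?thesis
  proof (elim disjE)
    assume "v = p"
    then show ?thesis using d low high by (intro exI[of _ q] exI[of _ r] exI[of _ s]) simp
  next
    assume "v = q"
    then show ?thesis using d low high
      by (intro exI[of _ p] exI[of _ r] exI[of _ s]) (auto simp: c[of q p] sym[of q p])
  next
    assume "v = r"
    then show ?thesis using d low high
      by (intro exI[of _ s] exI[of _ p] exI[of _ q])
        (auto simp: c[of r p] c[of r q] c[of s p] c[of s q] sym[of r p] sym[of r q] sym[of s p] sym[of s q])
  next
    assume "v = s"
    then show ?thesis using d low high
      by (intro exI[of _ r] exI[of _ p] exI[of _ q])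
        (auto simp: c[of s r] c[of r p] c[of r q] c[of s p] c[of s q]
          sym[of s r] sym[of r p] sym[of r q] sym[of s p] sym[of s q])
  qed
qed

text \<open>If \<open>m\<close> were zero at \<open>v\<close>, the lower bounds on the edges
  \<open>v j\<close> and \<open>v k\<close> and the star inequality would give \<open>w j k\<close>
  at most \<open>m j + m k\<close>. Otherwise both sides of all inequalities at \<open>v\<close>
  drop by one.\<close>

lemma split_exp_lower:
  assumes sym: "\<And>x y. w x y = w y x" and "split_exp w m"
    and star: "\<And>x y. distinct [v, x, y] \<Longrightarrow> w x y \<le> w v x + w v y"
  shows "lk m v > 0 \<and> split_exp (lower v w) (m - mon v 1)"
proof -
  obtain i j k where d: "distinct [v, i, j, k]" and m: "lk m v + lk m i < w v i" "lk m j + lk m k < w j k"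
    "w v j \<le> lk m v + lk m j" "w v k \<le> lk m v + lk m k" "w i j \<le> lk m i + lk m j" "w i k \<le> lk m i + lk m k"
    using split_expE_at[OF sym assms(2), of v] by blast
  have pos: "lk m v > 0" using star[of j k] d m by (intro gr0I) simp
  have n: "lk (m - mon v 1) v = lk m v - 1" "lk (m - mon v 1) i = lk m i"
    "lk (m - mon v 1) j = lk m j" "lk (m - mon v 1) k = lk m k"
    using d by (auto simp: lookup_minus lookup_single when_def)
  have lw: "lower v w v i = w v i - 1" "lower v w v j = w v j - 1" "lower v w v k = w v k - 1"
    "lower v w j k = w j k" "lower v w i j = w i j" "lower v w i k = w i k"
    using d by (auto simp: lower_def)
  have "split_exp (lower v w) (m - mon v 1)"
    unfolding split_exp_def
    by (intro exI[of _ v] exI[of _ i] exI[of _ j] exI[of _ k] conjI d; unfold n lw; use m pos in linarith)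
  then show ?thesis using pos by blast
qed

text \<open>A component is zero exactly if it has one element, which any bijection
  preserves.\<close>

lemma rao_nonzero_shift:
  assumes J: "ideal.subspace J" and "rao_iso_shift J I h" and nz: "rao_nonzero J j"
  shows "rao_nonzero I (j - h)"
  unfolding rao_nonzero_def
proof
  obtain \<phi> where \<phi>: "bij_betw (\<phi> j) (rao J j) (rao I (j - h))"
    using assms(2) unfolding rao_iso_shift_def by blast
  have "0 \<in> cech_cocycles J j" unfolding cech_cocycles_def by (simp add: zero_sheaf_section[OF J])
  then have "0 +o cech_coboundaries J j \<in> rao J j" unfolding rao_def by (rule imageI)
  then have mem: "cech_coboundaries J j \<in> rao J j" by simp
  assume "rao I (j - h) = {cech_coboundaries I (j - h)}"
  then have "card (rao J j) = 1" using bij_betw_same_card[OF \<phi>] by simp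
  then have "rao J j = {cech_coboundaries J j}" using mem by (metis card_1_singletonE singletonD)
  then show False using nz by (simp add: rao_nonzero_def)
qed

text \<open>An exponent of least degree survives lowering at \<open>v\<close> with its degree
  reduced by one. A shift with \<open>h \<ge> 0\<close> would bring this even smaller degree back
  into the original module.\<close>

lemma minimal_imp_not_star:
  assumes sym: "\<And>x y. w x y = w y x" and minimal: "minimal_curve (tetra w :: 'k::field poly4 set)"
  shows "\<exists>x y. distinct [v, x, y] \<and> w v x + w v y < w x y"
proof (rule ccontr)
  assume "\<not> ?thesis"
  then have star: "w x y \<le> w v x + w v y" if "distinct [v, x, y]" for x y
    using that by (meson not_less)
  let ?I = "tetra w :: 'k poly4 set" and ?J = "tetra (lower v w) :: 'k poly4 set"
  let ?P = "\<lambda>n. \<exists>m. tdeg m = n \<and> split_exp w m"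
  obtain j0 where "rao_nonzero ?I j0" using minimal unfolding minimal_curve_def by blast
  then obtain m0 where m0: "split_exp w m0" using rao_nonzero_tetra[of w, where 'k = 'k] sym by blast
  \<comment> \<open>A nonzero component supplies the opposite edges of positive weight that the link
    requires.\<close>
  then obtain i j k where d: "distinct [v, i, j, k]" "lk m0 v + lk m0 i < w v i" "lk m0 j + lk m0 k < w j k"
    using split_expE_at[OF sym m0, of v] by blast
  have "star w v i j k" by unfold_locales (use sym d star in auto)
  then have "evenly_linked ?I ?J"
    by (rule star.evenly_linked_lower) (use d minimal in \<open>auto simp: minimal_curve_def\<close>)
  then obtain h where h: "h \<ge> 0" "rao_iso_shift ?J ?I h" using minimal unfolding minimal_curve_def by blast
  have sym': "lower v w x y = lower v w y x" for x y unfolding lower_def using sym[of x y] by auto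
  have "\<exists>n. ?P n" using m0 by blast
  then have "?P (LEAST n. ?P n)" by (rule LeastI_ex)
  then obtain m where m: "tdeg m = (LEAST n. ?P n)" "split_exp w m" by blast
  have low: "lk m v > 0" "split_exp (lower v w) (m - mon v 1)"
    using split_exp_lower[OF sym m(2) star] by auto
  have "m = (m - mon v 1) + mon v 1"
    using low(1) by (intro poly_mapping_eqI) (auto simp: lookup_add lookup_minus lookup_single when_def)
  then have "tdeg m = tdeg (m - mon v 1) + tdeg (mon v (1::nat))" by (metis tdeg_add)
  then have t: "tdeg m = tdeg (m - mon v 1) + 1" by (simp add: lookup_single when_def)
  have "rao_nonzero ?J (int (tdeg (m - mon v 1)))"
    using rao_nonzero_tetra[of "lower v w", where 'k = 'k] sym' low(2) by blast
  then have "rao_nonzero ?I (int (tdeg (m - mon v 1)) - h)"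
    by (rule rao_nonzero_shift[OF subspace_tetra h(2)])
  then obtain m' where m': "int (tdeg m') = int (tdeg (m - mon v 1)) - h" "split_exp w m'"
    using rao_nonzero_tetra[of w, where 'k = 'k] sym by blast
  then have "tdeg m' < tdeg m" using t h(1) by linarith
  moreover have "(LEAST n. ?P n) \<le> tdeg m'" using m'(2) by (intro Least_le) blast
  ultimately show False using m(1) by linarith
qed

text \<open>The shape of an S-minimal weight: each of the four triangles has an edge longer than the
  sum of the other two, and these long edges form an opposite pair \<open>p q\<close>, \<open>r s\<close>.\<close>

definition dominant :: "(4 \<Rightarrow> 4 \<Rightarrow> nat) \<Rightarrow> 4 \<Rightarrow> 4 \<Rightarrow> 4 \<Rightarrow> 4 \<Rightarrow> bool" where
  "dominant w p q r s \<longleftrightarrow> distinct [p, q, r, s] \<and>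
    w p r + w q r < w p q \<and> w p s + w q s < w p q \<and> w q r + w q s < w r s \<and> w p r + w p s < w r s"

text \<open>The letters are the weights of 01, 02, 03, 12, 13, 23, one hypothesis per vertex. A long
  edge is strictly longer than its two neighbours, so incompatible choices at different vertices
  produce a cycle of strict inequalities.\<close>

lemma long_edges:
  fixes a b c d e f :: nat
  assumes "a + b < d \<or> a + c < e \<or> b + c < f" "a + d < b \<or> a + e < c \<or> d + e < f"
    "b + d < a \<or> b + f < c \<or> d + f < e" "c + e < a \<or> c + f < b \<or> e + f < d"
  shows "(b + d < a \<and> c + e < a \<and> d + e < f \<and> b + c < f) \<or>
    (a + d < b \<and> c + f < b \<and> d + f < e \<and> a + c < e) \<or>
    (a + e < c \<and> b + f < c \<and> e + f < d \<and> a + b < d)"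
  using assms(1)
proof (elim disjE)
  assume 1: "a + b < d"
  then have 2: "a + e < c \<or> d + e < f" using assms(2) by auto
  from 1 have 3: "b + f < c \<or> d + f < e" using assms(3) by auto
  from 2 3 have 4: "a + e < c \<and> b + f < c" using assms(4) 1 by linarith
  then have "e + f < d" using assms(4) by linarith
  with 1 4 show ?thesis by blast
next
  assume 1: "a + c < e"
  have "a + d < b \<or> d + e < f" using assms(2) 1 by linarith
  moreover note assms(3)
  moreover have "c + f < b \<or> e + f < d" using assms(4) 1 by linarith
  ultimately have "a + d < b \<and> d + f < e \<and> c + f < b" using 1 by linarith
  with 1 show ?thesis by blast
next
  assume 1: "b + c < f"
  note assms(2)
  moreover have "b + d < a \<or> d + f < e" using assms(3) 1 by linarith
  moreover have "c + e < a \<or> e + f < d" using assms(4) 1 by linarith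
  ultimately have "d + e < f \<and> b + d < a \<and> c + e < a" using 1 by linarith
  with 1 show ?thesis by blast
qed

lemma not_star_imp_dominant:
  assumes sym: "\<And>x y. w x y = w y x"
    and "\<And>v. \<exists>x y. distinct [v, x, y] \<and> w v x + w v y < w x y"
  shows "\<exists>p q r s. dominant w p q r s"
proof -
  let ?a = "w 0 1" and ?b = "w 0 2" and ?c = "w 0 3" and ?d = "w 1 2" and ?e = "w 1 3" and ?f = "w 2 3"
  have ex: "(\<exists>x::4. P x) \<longleftrightarrow> P 0 \<or> P 1 \<or> P 2 \<or> P 3" for P
    using all_4[of "\<lambda>x. \<not> P x"] by blast
  note sy = sym[of 1 0] sym[of 2 0] sym[of 3 0] sym[of 2 1] sym[of 3 1] sym[of 3 2]
  have "?a + ?b < ?d \<or> ?a + ?c < ?e \<or> ?b + ?c < ?f"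
    using assms(2)[of 0] unfolding ex by (auto simp: sy add.commute)
  moreover have "?a + ?d < ?b \<or> ?a + ?e < ?c \<or> ?d + ?e < ?f"
    using assms(2)[of 1] unfolding ex by (auto simp: sy add.commute)
  moreover have "?b + ?d < ?a \<or> ?b + ?f < ?c \<or> ?d + ?f < ?e"
    using assms(2)[of 2] unfolding ex by (auto simp: sy add.commute)
  moreover have "?c + ?e < ?a \<or> ?c + ?f < ?b \<or> ?e + ?f < ?d"
    using assms(2)[of 3] unfolding ex by (auto simp: sy add.commute)
  ultimately have "dominant w 0 1 2 3 \<or> dominant w 0 2 1 3 \<or> dominant w 0 3 1 2"
    using long_edges[of ?a ?b ?d ?c ?e ?f] by (auto simp: dominant_def sy add.commute)
  then show ?thesis by blast
qed

text \<open>\<open>x\<close>, \<open>y\<close>, \<open>z\<close>, \<open>t\<close> are exponents at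
  \<open>p\<close>, \<open>q\<close>, \<open>r\<close>, \<open>s\<close>. The lower bounds give a
  total of at least \<open>B + E\<close> and at least \<open>C + D\<close>; the witnesses make the
  larger of these pairs, and one further bound, tight.\<close>

lemma least_split:
  fixes A B C D E F :: nat
  assumes "B + D < A" "C + E < A" "D + E < F" "B + C < F"
  shows "\<exists>x y z t. x + y < A \<and> z + t < F \<and> B \<le> x + z \<and> C \<le> x + t \<and> D \<le> y + z \<and> E \<le> y + t \<and>
    x + y + z + t = max (B + E) (C + D)"
proof -
  consider "C + D \<le> B + E" "D \<le> B" | "C + D \<le> B + E" "B < D"
    | "B + E < C + D" "E \<le> C" | "B + E < C + D" "C < E" by linarith
  then show ?thesis
  proof cases
    case 1
    then show ?thesis using assms
      by (intro exI[of _ "B - D"] exI[of _ 0] exI[of _ D] exI[of _ E]) auto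
  next
    case 2
    then show ?thesis using assms
      by (intro exI[of _ 0] exI[of _ "E - C"] exI[of _ B] exI[of _ C]) auto
  next
    case 3
    then show ?thesis using assms
      by (intro exI[of _ "C - E"] exI[of _ 0] exI[of _ D] exI[of _ E]) auto
  next
    case 4
    then show ?thesis using assms
      by (intro exI[of _ 0] exI[of _ "D - B"] exI[of _ B] exI[of _ C]) auto
  qed
qed

text \<open>The summand 3 is the gap 2 in the top degree \<open>w p q + w r s - 2\<close>, caused by
  two strict inequalities, plus the difference 1 between two consecutive degrees.\<close>

lemma diameter_dominant:
  assumes sym: "\<And>x y. w x y = w y x" and dom: "dominant w p q r s"
  shows "has_rao_diameter (tetra w :: 'k::field poly4 set) 2 \<longleftrightarrow>
    w p q + w r s = max (w p r + w q s) (w p s + w q r) + 3"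
proof -
  let ?A = "w p q" and ?F = "w r s" and ?B = "w p r" and ?C = "w p s" and ?D = "w q r" and ?E = "w q s"
  let ?\<mu> = "max (?B + ?E) (?C + ?D)" and ?nz = "rao_nonzero (tetra w :: 'k poly4 set)"
  have d: "distinct [p, q, r, s]" and dd: "?B + ?D < ?A" "?C + ?E < ?A" "?D + ?E < ?F" "?B + ?C < ?F"
    using dom by (simp_all add: dominant_def)
  note t4 = sum_distinct4[OF d, where 'a = nat]
  have nz: "?nz j \<longleftrightarrow> (\<exists>m. int (tdeg m) = j \<and> split_exp w m)" for j
    by (rule rao_nonzero_tetra) (rule sym)
  have bounds: "int ?\<mu> \<le> j \<and> j + 2 \<le> int (?A + ?F)" if nzj: "?nz j" for j
  proof -
    obtain m where m: "int (tdeg m) = j" "split_exp w m" using nzj unfolding nz by blast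
    obtain i k l where i: "distinct [p, i, k, l]" "lk m p + lk m i < w p i" "lk m k + lk m l < w k l"
      "w p k \<le> lk m p + lk m k" "w p l \<le> lk m p + lk m l" "w i k \<le> lk m i + lk m k" "w i l \<le> lk m i + lk m l"
      using split_expE_at[OF sym m(2), of p] by blast
    have mem: "x = p \<or> x = q \<or> x = r \<or> x = s" for x using UNIV_distinct4[OF d] by auto
    \<comment> \<open>A splitting that pairs \<open>p\<close> with \<open>r\<close> or
      \<open>s\<close> would make the weight of the dominant pair at most the degree, and this
      contradicts dominance.\<close>
    have "i = q \<and> k = r \<and> l = s \<or> i = q \<and> k = s \<and> l = r \<or> i = r \<and> k = q \<and> l = s \<or> i = r \<and> k = s \<and> l = q \<or>
      i = s \<and> k = q \<and> l = r \<or> i = s \<and> k = r \<and> l = q"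
      using mem[of i] mem[of k] mem[of l] i(1) by auto
    then have "?\<mu> \<le> tdeg m \<and> tdeg m + 2 \<le> ?A + ?F"
      using i dd sym[of s r] sym[of r q] sym[of s q] unfolding t4
      by (elim disjE conjE) simp_all
    then show ?thesis using m(1) by linarith
  qed
  have attained: "?nz (int (x + y + z + t))"
    if "x + y < ?A" "z + t < ?F" "?B \<le> x + z" "?C \<le> x + t" "?D \<le> y + z" "?E \<le> y + t" for x y z t
  proof -
    define m where "m = mon p x + mon q y + mon r z + mon s t"
    have m: "lk m p = x" "lk m q = y" "lk m r = z" "lk m s = t"
      using d by (auto simp: m_def lookup_add lookup_single when_def)
    have "split_exp w m" unfolding split_exp_def
      using d that by (intro exI[of _ p] exI[of _ q] exI[of _ r] exI[of _ s]) (simp add: m)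
    moreover have "tdeg m = x + y + z + t" unfolding t4 m ..
    ultimately show ?thesis unfolding nz by (intro exI[of _ m]) simp
  qed
  obtain x y z t where xyzt: "x + y < ?A" "z + t < ?F" "?B \<le> x + z" "?C \<le> x + t" "?D \<le> y + z" "?E \<le> y + t"
    "x + y + z + t = ?\<mu>" using least_split[OF dd] by blast
  have lo: "?nz (int ?\<mu>)" using attained[OF xyzt(1-6)] xyzt(7) by simp
  \<comment> \<open>Raising \<open>x\<close> and \<open>z\<close> makes both strict bounds tight
    without violating the lower ones.\<close>
  have "?nz (int ((?A - 1 - y) + y + (?F - 1 - t) + t))"
    by (rule attained) (use xyzt in auto)
  moreover have "(?A - 1 - y) + y + (?F - 1 - t) + t = ?A + ?F - 2" using xyzt by linarith
  ultimately have hi: "?nz (int (?A + ?F) - 2)" using xyzt by (simp add: of_nat_diff)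
  show ?thesis
  proof
    assume "has_rao_diameter (tetra w :: 'k poly4 set) 2"
    then obtain d1 d2 where d12: "?nz d1" "?nz d2" "\<And>j. ?nz j \<Longrightarrow> d1 \<le> j \<and> j \<le> d2" "2 = d2 - d1 + 1"
      unfolding has_rao_diameter_def by blast
    then show "?A + ?F = ?\<mu> + 3"
      using d12(3)[OF lo] d12(3)[OF hi] bounds[OF d12(1)] bounds[OF d12(2)] by linarith
  next
    assume e: "?A + ?F = ?\<mu> + 3"
    have "int (?A + ?F) - 2 = int ?\<mu> + 1" unfolding e by simp
    then show "has_rao_diameter (tetra w :: 'k poly4 set) 2"
      unfolding has_rao_diameter_def using lo hi bounds
      by (intro exI[of _ "int ?\<mu>"] exI[of _ "int (?A + ?F) - 2"]) fastforce
  qed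
qed

section \<open>Permutations of the variables\<close>

lemma lookup_map_key: "inj s \<Longrightarrow> lk (Poly_Mapping.map_key s m) i = lk m (s i)"
  by (simp add: map_key.rep_eq)

lemma lookup_permute_vars:
  assumes "bij s"
  shows "lk (permute_vars s f) m = lk f (Poly_Mapping.map_key s m)"
proof -
  have "inj (Poly_Mapping.map_key s :: _ \<Rightarrow> 4 \<Rightarrow>\<^sub>0 nat)"
  proof (rule injI)
    fix m n :: "4 \<Rightarrow>\<^sub>0 nat" assume e: "Poly_Mapping.map_key s m = Poly_Mapping.map_key s n"
    show "m = n"
    proof (rule poly_mapping_eqI)
      fix i
      have "lk (Poly_Mapping.map_key s m) (inv s i) = lk (Poly_Mapping.map_key s n) (inv s i)" using e by simp
      then show "lk m i = lk n i"
        using assms by (simp add: lookup_map_key bij_is_inj bij_is_surj surj_f_inv_f)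
    qed
  qed
  then show ?thesis unfolding permute_vars_def by (rule lookup_map_key)
qed

lemma permute_vars_inv:
  fixes f :: "'k::field poly4"
  assumes "bij s"
  shows "permute_vars s (permute_vars (inv s) f) = f"
proof (rule poly_mapping_eqI)
  fix m :: "4 \<Rightarrow>\<^sub>0 nat"
  have "Poly_Mapping.map_key (inv s) (Poly_Mapping.map_key s m) = m"
    using assms by (intro poly_mapping_eqI)
      (simp add: lookup_map_key bij_imp_bij_inv bij_is_inj bij_is_surj surj_f_inv_f)
  then show "lk (permute_vars s (permute_vars (inv s) f)) m = lk f m"
    using assms by (simp add: lookup_permute_vars bij_imp_bij_inv)
qed

text \<open>The exponent of \<open>Var x\<close> in the image is that of
  \<open>Var (inv s x)\<close> in the source, hence the inverse in the weights.\<close>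

lemma permute_vars_tetra_subset:
  assumes "bij s"
  shows "permute_vars s ` tetra w \<subseteq> tetra (\<lambda>x y. w (inv s x) (inv s y))"
proof (rule image_subsetI)
  fix f :: "'a poly4" assume f: "f \<in> tetra w"
  show "permute_vars s f \<in> tetra (\<lambda>x y. w (inv s x) (inv s y))"
    unfolding tetra_def mon_ideal_def
  proof (intro CollectI subsetI allI impI)
    fix m and x y :: 4 assume "m \<in> keys (permute_vars s f)" and xy: "x \<noteq> y"
    then have "Poly_Mapping.map_key s m \<in> keys f" using assms by (simp add: in_keys_iff lookup_permute_vars)
    moreover have "inv s x \<noteq> inv s y" using assms xy by (metis bij_inv_eq_iff)
    ultimately have "w (inv s x) (inv s y) \<le>
        lk (Poly_Mapping.map_key s m) (inv s x) + lk (Poly_Mapping.map_key s m) (inv s y)"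
      using f by (auto simp: tetra_def mon_ideal_def subset_iff)
    then show "w (inv s x) (inv s y) \<le> lk m x + lk m y"
      using assms by (simp add: lookup_map_key bij_is_inj bij_is_surj surj_f_inv_f)
  qed
qed

lemma permute_vars_tetra:
  assumes "bij s"
  shows "permute_vars s ` tetra w = tetra (\<lambda>x y. w (inv s x) (inv s y))"
proof (rule antisym[OF permute_vars_tetra_subset[OF assms]])
  have "permute_vars (inv s) ` tetra (\<lambda>x y. w (inv s x) (inv s y)) \<subseteq> (tetra w :: 'a poly4 set)"
    using permute_vars_tetra_subset[OF bij_imp_bij_inv[OF assms], of "\<lambda>x y. w (inv s x) (inv s y)"] assms
    by (simp add: inv_inv_eq surj_f_inv_f bij_is_surj bij_is_inj)
  then have "permute_vars s ` permute_vars (inv s) ` tetra (\<lambda>x y. w (inv s x) (inv s y)) \<subseteq>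
      permute_vars s ` (tetra w :: 'a poly4 set)" by (rule image_mono)
  then show "tetra (\<lambda>x y. w (inv s x) (inv s y)) \<subseteq> permute_vars s ` (tetra w :: 'a poly4 set)"
    by (simp add: image_image permute_vars_inv[OF assms])
qed

lemma tetra_cong: "(\<And>x y. x \<noteq> y \<Longrightarrow> w x y = w' x y) \<Longrightarrow> tetra w = tetra w'"
  by (simp add: tetra_def)

lemma isomorphic_relabel:
  assumes sym: "\<And>x y. w x y = w y x" and d: "distinct [p, q, r, s]"
  shows "isomorphic_curves (tetra w) (tetrahedral (w p q) (w p r) (w p s) (w q r) (w q s) (w r s))"
proof -
  define g :: "4 \<Rightarrow> 4" where "g x = (if x = p then 0 else if x = q then 1 else if x = r then 2 else 3)" for x
  have g: "g p = 0" "g q = 1" "g r = 2" "g s = 3" using d by (auto simp: g_def)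
  have mem: "x = p \<or> x = q \<or> x = r \<or> x = s" for x using UNIV_distinct4[OF d] by auto
  have "inj g"
  proof (rule injI)
    fix x y assume "g x = g y"
    then show "x = y" using mem[of x] mem[of y] g by (elim disjE) simp_all
  qed
  then have bij: "bij g" by (simp add: bij_def finite_UNIV_inj_surj)
  have ig: "inv g 0 = p" "inv g 1 = q" "inv g 2 = r" "inv g 3 = s"
    using g inv_f_f[OF \<open>inj g\<close>] by metis+
  have "tetra (\<lambda>x y. w (inv g x) (inv g y)) =
    tetra (edge_weights (w p q) (w p r) (w p s) (w q r) (w q s) (w r s))"
  proof (rule tetra_cong)
    fix x y :: 4
    assume "x \<noteq> y"
    moreover have "\<forall>x y. x \<noteq> y \<longrightarrow> w (inv g x) (inv g y) =
      edge_weights (w p q) (w p r) (w p s) (w q r) (w q s) (w r s) x y"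
      unfolding all_4 using sym
      by (auto simp: ig edge_weights_def doubleton_eq_iff)
    ultimately show "w (inv g x) (inv g y) =
      edge_weights (w p q) (w p r) (w p s) (w q r) (w q s) (w r s) x y" by blast
  qed
  then show ?thesis
    unfolding isomorphic_curves_def tetrahedral_eq_tetra using bij permute_vars_tetra[OF bij, of w] by metis
qed

text \<open>The isomorphism is absorbed into a relabelling of the vertices, so the diameter is
  computed for \<open>C\<close> directly and needs no transport along it.\<close>

lemma isomorphic_tetrahedral:
  assumes "isomorphic_curves C (tetrahedral b1 b2 b3 b4 b5 b6)"
  shows "\<exists>w p q r s. (\<forall>x y. w x y = w y x) \<and> distinct [p, q, r, s] \<and> C = tetra w \<and>
    w p q = b1 \<and> w p r = b2 \<and> w p s = b3 \<and> w q r = b4 \<and> w q s = b5 \<and> w r s = b6"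
proof -
  let ?e = "edge_weights b1 b2 b3 b4 b5 b6"
  obtain g where g: "bij g" "permute_vars g ` C = tetra ?e"
    using assms unfolding isomorphic_curves_def tetrahedral_eq_tetra by blast
  have ig: "bij (inv g)" "inv (inv g) = g" using g(1) by (simp_all add: bij_imp_bij_inv inv_inv_eq)
  have "permute_vars (inv g) ` permute_vars g ` C = C"
    by (simp add: image_image permute_vars_inv[OF ig(1), unfolded ig(2)])
  then have C: "C = tetra (\<lambda>x y. ?e (g x) (g y))"
    unfolding g(2) permute_vars_tetra[OF ig(1)] ig(2) by simp
  have gi: "g (inv g x) = x" for x using g(1) by (simp add: bij_is_surj surj_f_inv_f)
  have "distinct [inv g 0, inv g 1, inv g 2, inv g 3]"
    using bij_is_inj[OF ig(1)] by (simp add: inj_eq)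
  then show ?thesis
    using C edge_weights_sym
    by (intro exI[of _ "\<lambda>x y. ?e (g x) (g y)"] exI[of _ "inv g 0"] exI[of _ "inv g 1"]
        exI[of _ "inv g 2"] exI[of _ "inv g 3"])
      (simp add: gi edge_weights_def doubleton_eq_iff insert_commute)
qed

lemma dominant_diameter_two_shape:
  assumes sym: "\<And>x y. w x y = w y x" and dom: "dominant w p q r s"
    and "w p s + w q r \<le> w p r + w q s" "w p q + w r s = w p r + w q s + 3"
  shows "(\<exists>k\<ge>1. isomorphic_curves (tetra w) (tetrahedral k (k - 1) 0 0 (k - 1) (k + 1))) \<or>
    (\<exists>k\<ge>2. isomorphic_curves (tetra w) (tetrahedral k (k - 2) 0 0 (k - 1) k))"
proof -
  let ?A = "w p q" and ?F = "w r s" and ?B = "w p r" and ?C = "w p s" and ?D = "w q r" and ?E = "w q s"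
  have d: "distinct [p, q, r, s]" and dd: "?B + ?D < ?A" "?C + ?E < ?A" "?D + ?E < ?F" "?B + ?C < ?F"
    using dom by (simp_all add: dominant_def)
  have relabel: "isomorphic_curves (tetra w) (tetrahedral (w p q) (w p r) (w p s) (w q r) (w q s) (w r s))"
    if "distinct [p, q, r, s]" for p q r s
    by (rule isomorphic_relabel[OF _ that]) (rule sym)
  \<comment> \<open>Adding \<open>B + D < A\<close> and \<open>D + E < F\<close> gives
    \<open>B + E + 2 * D + 2\<close> at most \<open>B + E + 3\<close>, so \<open>D\<close> vanishes;
    the other two inequalities give \<open>C = 0\<close>.\<close>
  have 0: "?C = 0" "?D = 0" using dd assms(4) by linarith+
  \<comment> \<open>Now \<open>A\<close> and \<open>F\<close> both exceed the larger of
    \<open>B\<close> and \<open>E\<close> and sum to \<open>B + E + 3\<close>, so \<open>B\<close>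
    and \<open>E\<close> differ by at most one. Cases 2 and 4 are cases 1 and 3 relabelled.\<close>
  consider "?E = ?B" "?A = ?B + 1" "?F = ?B + 2" | "?E = ?B" "?A = ?B + 2" "?F = ?B + 1"
    | "?E = ?B + 1" "?A = ?B + 2" "?F = ?B + 2" | "?B = ?E + 1" "?A = ?E + 2" "?F = ?E + 2"
    using dd assms(4) by linarith
  then show ?thesis
  proof cases
    case 1
    then show ?thesis using relabel[OF d] 0 by (intro disjI1 exI[of _ "?B + 1"]) simp
  next
    case 2
    have "distinct [r, s, p, q]" using d by auto
    from relabel[OF this] show ?thesis
      using 2 0 sym[of r p] sym[of r q] sym[of s p] sym[of s q]
      by (intro disjI1 exI[of _ "?B + 1"]) simp
  next
    case 3
    then show ?thesis using relabel[OF d] 0 by (intro disjI2 exI[of _ "?B + 2"]) simp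
  next
    case 4
    have "distinct [q, p, s, r]" using d by auto
    from relabel[OF this] show ?thesis
      using 4 0 sym[of q p] sym[of s r] by (intro disjI2 exI[of _ "?E + 2"]) simp
  qed
qed

theorem lemma6p2:
  fixes a1 a2 a3 a4 a5 a6 :: nat
    and C :: "'k::field poly4 set"
  assumes "C = tetrahedral a1 a2 a3 a4 a5 a6"
    and "minimal_curve C"
  shows "has_rao_diameter C 2 \<longleftrightarrow>
    (\<exists>k\<ge>1. isomorphic_curves C (tetrahedral k (k - 1) 0 0 (k - 1) (k + 1))) \<or>
    (\<exists>k\<ge>2. isomorphic_curves C (tetrahedral k (k - 2) 0 0 (k - 1) k))"
proof
  define w where "w = edge_weights a1 a2 a3 a4 a5 a6"
  have C: "C = tetra w" unfolding assms(1) w_def by (rule tetrahedral_eq_tetra)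
  have sym: "w x y = w y x" for x y unfolding w_def by (rule edge_weights_sym)
  assume diam: "has_rao_diameter C 2"
  obtain p q r s where dom: "dominant w p q r s"
    using not_star_imp_dominant[of w] sym minimal_imp_not_star[of w, where 'k = 'k] assms(2) unfolding C by blast
  \<comment> \<open>Swapping \<open>r\<close> and \<open>s\<close> exchanges the two sums in the
    maximum, so the first may be taken as the larger.\<close>
  have dom': "dominant w p q s r" using dom sym[of s r] by (auto simp: dominant_def add.commute)
  have eq: "w p q + w r s = max (w p r + w q s) (w p s + w q r) + 3"
    using diam diameter_dominant[of w p q r s, where 'k = 'k] sym dom unfolding C by blast
  show "(\<exists>k\<ge>1. isomorphic_curves C (tetrahedral k (k - 1) 0 0 (k - 1) (k + 1))) \<or>
    (\<exists>k\<ge>2. isomorphic_curves C (tetrahedral k (k - 2) 0 0 (k - 1) k))"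
  proof (cases "w p s + w q r \<le> w p r + w q s")
    case True
    show ?thesis unfolding C
      by (rule dominant_diameter_two_shape[OF _ dom True]) (use sym eq True in simp_all)
  next
    case False
    show ?thesis unfolding C
      by (rule dominant_diameter_two_shape[OF _ dom']) (use sym eq False sym[of s r] in simp_all)
  qed
next
  assume "(\<exists>k\<ge>1. isomorphic_curves C (tetrahedral k (k - 1) 0 0 (k - 1) (k + 1))) \<or>
    (\<exists>k\<ge>2. isomorphic_curves C (tetrahedral k (k - 2) 0 0 (k - 1) k))"
  then show "has_rao_diameter C 2"
  proof (elim disjE exE conjE)
    fix k :: nat assume k: "k \<ge> 1"
      and iso: "isomorphic_curves C (tetrahedral k (k - 1) 0 0 (k - 1) (k + 1))"
    obtain w p q r s where w: "\<forall>x y. w x y = w y x" "distinct [p, q, r, s]" "C = tetra w"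
      "w p q = k" "w p r = k - 1" "w p s = 0" "w q r = 0" "w q s = k - 1" "w r s = k + 1"
      using isomorphic_tetrahedral[OF iso] by blast
    \<comment> \<open>The criterion reads \<open>2 * k + 1 = 2 * (k - 1) + 3\<close>.\<close>
    then have "dominant w p q r s" using k by (simp add: dominant_def)
    then show ?thesis using diameter_dominant[of w p q r s, where 'k = 'k] w k by simp
  next
    fix k :: nat assume k: "k \<ge> 2"
      and iso: "isomorphic_curves C (tetrahedral k (k - 2) 0 0 (k - 1) k)"
    obtain w p q r s where w: "\<forall>x y. w x y = w y x" "distinct [p, q, r, s]" "C = tetra w"
      "w p q = k" "w p r = k - 2" "w p s = 0" "w q r = 0" "w q s = k - 1" "w r s = k"
      using isomorphic_tetrahedral[OF iso] by blast
    \<comment> \<open>The criterion reads \<open>2 * k = (2 * k - 3) + 3\<close>.\<close>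
    then have "dominant w p q r s" using k by (simp add: dominant_def)
    then show ?thesis using diameter_dominant[of w p q r s, where 'k = 'k] w k by simp
  qed
qed

end
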